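(* For every $1\leq p<\infty$ the algebra $\mathcal A(T^{(p)})$ is not amenable.
   Context: For a Banach space $X$, $\mathcal A(X)$ is the operator norm closure in $\mathcal B(X)$ of the continuous finite-rank operators on $X$. A Banach algebra is amenable if every continuous derivation from it into the dual of any Banach bimodule over it is inner. The spaces $T^{(p)}$ are defined as follows. Let $(t_n)$ be the unit vector basis of $c_{00}$ (scalar sequences with finite support). For finite nonempty $E,F\subset\mathbb N$, $E<F$ means $\max E<\min F$, and $\{k\}\le E$ means $k\le\min E$. For $E\subset\mathbb N$ and $x=\sum_n\alpha_nt_n\in c_{00}$ put $Ex:=\sum_{n\in E}\alpha_nt_n$. Let $\|\cdot\|_0$ be the sup norm on $c_{00}$ and, for $m\ge0$, $$\|x\|_{m+1}:=\max\Big\{\|x\|_m,\ 2^{-1}\max\Big[\sum_{j=1}^k\|E_jx\|_m\Big]\Big\}\qquad(x\in c_{00}),$$ where the inner maximum is over all choices of finite subsets $E_1,\dots,E_k$ of $\mathbb N$ with $\{k\}\le E_1<E_2<\dots<E_k$ (over all $k$). Put $\|x\|:=\lim_{m\to\infty}\|x\|_m$; this is a norm on $c_{00}$, and $T^*$ is the completion of $c_{00}$ in it (the dual of Tsirelson's space). $(t_n)$ is a normalized 1-unconditional basis of $T^*$. For $1\le p<\infty$, $T^{(p)}$ is the set of all formal sums $x=\sum_n\alpha_nt_n$ such that $\sum_n|\alpha_n|^pt_n\in T^*$, with norm $\|x\|_{(p)}=\big\|\sum_n|\alpha_n|^pt_n\big\|^{1/p}$. Thus $T^{(1)}=T^*$.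 *)

theory Defs
  imports "HOL-Analysis.Analysis" "HOL-Algebra.Module"
begin

(* T^(p) depends on the real number p, so Banach spaces, algebras and bimodules are structures with
   explicit carriers: HOL-Algebra modules over the scalar field, plus a norm. The scalar field is
   the type 'k, used below with real and complex. A Banach space ignores the ring fields mult and
   one; a Banach algebra uses mult, ignores one, and need not have a unit. *)

record ('k, 'v) normed_space = "('k, 'v) module" +
  nrm :: "'v \<Rightarrow> real"

definition scalars :: "('k::real_normed_field, 'k) normed_space" where
  "scalars = \<lparr>carrier = UNIV, mult = (*), one = 1, zero = 0, add = (+), smult = (*), nrm = norm\<rparr>"

locale banach_space =
  fixes X :: "('k::real_normed_field, 'v, 'm) normed_space_scheme" (structure)
  assumes is_module: "Module.module (scalars :: ('k, 'k) normed_space) X"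
    and nrm_nonneg: "x \<in> carrier X \<Longrightarrow> 0 \<le> nrm X x"
    and nrm_eq_0_iff: "x \<in> carrier X \<Longrightarrow> nrm X x = 0 \<longleftrightarrow> x = \<zero>"
    and nrm_add_le: "x \<in> carrier X \<Longrightarrow> y \<in> carrier X \<Longrightarrow> nrm X (x \<oplus> y) \<le> nrm X x + nrm X y"
    and nrm_smult: "x \<in> carrier X \<Longrightarrow> nrm X (c \<odot> x) = norm c * nrm X x"
    and complete: "(\<And>n. s n \<in> carrier X) \<Longrightarrow>
      (\<And>e. e > 0 \<Longrightarrow> \<exists>N. \<forall>m\<ge>N. \<forall>n\<ge>N. nrm X (s m \<ominus> s n) < e) \<Longrightarrow>
      \<exists>x\<in>carrier X. (\<lambda>n. nrm X (s n \<ominus> x)) \<longlonglongrightarrow> 0"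

(* Maps between carriers are extensional (undefined outside the carrier), so that a map is
   determined by its values on the carrier. *)

definition bounded_linear_maps ::
  "('k::real_normed_field, 'v, 'm) normed_space_scheme \<Rightarrow> ('k, 'w, 'n) normed_space_scheme
    \<Rightarrow> ('v \<Rightarrow> 'w) set" where
  "bounded_linear_maps X Y = {f \<in> carrier X \<rightarrow>\<^sub>E carrier Y.
     (\<forall>x\<in>carrier X. \<forall>y\<in>carrier X. f (x \<oplus>\<^bsub>X\<^esub> y) = f x \<oplus>\<^bsub>Y\<^esub> f y) \<and>
     (\<forall>c. \<forall>x\<in>carrier X. f (c \<odot>\<^bsub>X\<^esub> x) = c \<odot>\<^bsub>Y\<^esub> f x) \<and>
     (\<exists>K. \<forall>x\<in>carrier X. nrm Y (f x) \<le> K * nrm X x)}"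

definition operator_space ::
  "('k::real_normed_field, 'v, 'm) normed_space_scheme \<Rightarrow> ('k, 'w, 'n) normed_space_scheme
    \<Rightarrow> ('k, 'v \<Rightarrow> 'w) normed_space" where
  "operator_space X Y =
    \<lparr>carrier = bounded_linear_maps X Y,
     mult = undefined,
     one = undefined,
     zero = (\<lambda>x\<in>carrier X. \<zero>\<^bsub>Y\<^esub>),
     add = (\<lambda>f g. \<lambda>x\<in>carrier X. f x \<oplus>\<^bsub>Y\<^esub> g x),
     smult = (\<lambda>c f. \<lambda>x\<in>carrier X. c \<odot>\<^bsub>Y\<^esub> f x),
     nrm = (\<lambda>f. SUP x\<in>{x \<in> carrier X. nrm X x \<le> 1}. nrm Y (f x))\<rparr>"

definition bounded_operators ::
  "('k::real_normed_field, 'v, 'm) normed_space_scheme \<Rightarrow> ('k, 'v \<Rightarrow> 'v) normed_space" where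
  "bounded_operators X = (operator_space X X)\<lparr>mult := compose (carrier X)\<rparr>"

definition finite_rank_operators ::
  "('k::real_normed_field, 'v, 'm) normed_space_scheme \<Rightarrow> ('v \<Rightarrow> 'v) set" where
  "finite_rank_operators X = {f \<in> bounded_linear_maps X X.
     \<exists>B. finite B \<and> B \<subseteq> carrier X \<and>
       (\<forall>x\<in>carrier X. \<exists>c. f x = (\<Oplus>\<^bsub>X\<^esub>b\<in>B. c b \<odot>\<^bsub>X\<^esub> b))}"

definition approximable_operators ::
  "('k::real_normed_field, 'v, 'm) normed_space_scheme \<Rightarrow> ('k, 'v \<Rightarrow> 'v) normed_space" where
  "approximable_operators X = (bounded_operators X)\<lparr>carrier :=
     {f \<in> carrier (bounded_operators X). \<forall>e>0. \<exists>g\<in>finite_rank_operators X.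
        nrm (bounded_operators X) (f \<ominus>\<^bsub>bounded_operators X\<^esub> g) < e}\<rparr>"

record ('k, 'a, 'e) bimodule = "('k, 'e) normed_space" +
  lact :: "'a \<Rightarrow> 'e \<Rightarrow> 'e"
  ract :: "'e \<Rightarrow> 'a \<Rightarrow> 'e"

locale banach_bimodule = banach_space E
  for A :: "('k::real_normed_field, 'a, 'm) normed_space_scheme" (structure)
    and E :: "('k, 'a, 'e, 'n) bimodule_scheme" (structure) +
  assumes lact_closed: "a \<in> carrier A \<Longrightarrow> x \<in> carrier E \<Longrightarrow> lact E a x \<in> carrier E"
    and ract_closed: "a \<in> carrier A \<Longrightarrow> x \<in> carrier E \<Longrightarrow> ract E x a \<in> carrier E"
    and lact_add: "a \<in> carrier A \<Longrightarrow> x \<in> carrier E \<Longrightarrow> y \<in> carrier E \<Longrightarrow>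
      lact E a (x \<oplus>\<^bsub>E\<^esub> y) = lact E a x \<oplus>\<^bsub>E\<^esub> lact E a y"
    and ract_add: "a \<in> carrier A \<Longrightarrow> x \<in> carrier E \<Longrightarrow> y \<in> carrier E \<Longrightarrow>
      ract E (x \<oplus>\<^bsub>E\<^esub> y) a = ract E x a \<oplus>\<^bsub>E\<^esub> ract E y a"
    and add_lact: "a \<in> carrier A \<Longrightarrow> b \<in> carrier A \<Longrightarrow> x \<in> carrier E \<Longrightarrow>
      lact E (a \<oplus>\<^bsub>A\<^esub> b) x = lact E a x \<oplus>\<^bsub>E\<^esub> lact E b x"
    and add_ract: "a \<in> carrier A \<Longrightarrow> b \<in> carrier A \<Longrightarrow> x \<in> carrier E \<Longrightarrow>
      ract E x (a \<oplus>\<^bsub>A\<^esub> b) = ract E x a \<oplus>\<^bsub>E\<^esub> ract E x b"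
    and lact_smult: "a \<in> carrier A \<Longrightarrow> x \<in> carrier E \<Longrightarrow>
      lact E a (c \<odot>\<^bsub>E\<^esub> x) = c \<odot>\<^bsub>E\<^esub> lact E a x"
    and ract_smult: "a \<in> carrier A \<Longrightarrow> x \<in> carrier E \<Longrightarrow>
      ract E (c \<odot>\<^bsub>E\<^esub> x) a = c \<odot>\<^bsub>E\<^esub> ract E x a"
    and smult_lact: "a \<in> carrier A \<Longrightarrow> x \<in> carrier E \<Longrightarrow>
      lact E (c \<odot>\<^bsub>A\<^esub> a) x = c \<odot>\<^bsub>E\<^esub> lact E a x"
    and smult_ract: "a \<in> carrier A \<Longrightarrow> x \<in> carrier E \<Longrightarrow>
      ract E x (c \<odot>\<^bsub>A\<^esub> a) = c \<odot>\<^bsub>E\<^esub> ract E x a"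
    and lact_lact: "a \<in> carrier A \<Longrightarrow> b \<in> carrier A \<Longrightarrow> x \<in> carrier E \<Longrightarrow>
      lact E (a \<otimes>\<^bsub>A\<^esub> b) x = lact E a (lact E b x)"
    and ract_ract: "a \<in> carrier A \<Longrightarrow> b \<in> carrier A \<Longrightarrow> x \<in> carrier E \<Longrightarrow>
      ract E x (a \<otimes>\<^bsub>A\<^esub> b) = ract E (ract E x a) b"
    and lact_ract: "a \<in> carrier A \<Longrightarrow> b \<in> carrier A \<Longrightarrow> x \<in> carrier E \<Longrightarrow>
      lact E a (ract E x b) = ract E (lact E a x) b"
    and lact_bounded: "\<exists>K. \<forall>a\<in>carrier A. \<forall>x\<in>carrier E. nrm E (lact E a x) \<le> K * nrm A a * nrm E x"
    and ract_bounded: "\<exists>K. \<forall>a\<in>carrier A. \<forall>x\<in>carrier E. nrm E (ract E x a) \<le> K * nrm A a * nrm E x"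

definition dual_bimodule ::
  "('k::real_normed_field, 'a, 'e, 'n) bimodule_scheme \<Rightarrow> ('k, 'a, 'e \<Rightarrow> 'k) bimodule" where
  "dual_bimodule E = normed_space.extend (operator_space E scalars)
     (bimodule.fields
       (\<lambda>a f. \<lambda>x\<in>carrier E. f (ract E x a))
       (\<lambda>f a. \<lambda>x\<in>carrier E. f (lact E a x)))"

definition continuous_derivation ::
  "('k::real_normed_field, 'a, 'm) normed_space_scheme \<Rightarrow> ('k, 'a, 'e, 'n) bimodule_scheme
    \<Rightarrow> ('a \<Rightarrow> 'e) \<Rightarrow> bool" where
  "continuous_derivation A M D \<longleftrightarrow> D \<in> bounded_linear_maps A M \<and>
     (\<forall>a\<in>carrier A. \<forall>b\<in>carrier A.
        D (a \<otimes>\<^bsub>A\<^esub> b) = lact M a (D b) \<oplus>\<^bsub>M\<^esub> ract M (D a) b)"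

definition inner_derivation ::
  "('k::real_normed_field, 'a, 'm) normed_space_scheme \<Rightarrow> ('k, 'a, 'e, 'n) bimodule_scheme
    \<Rightarrow> ('a \<Rightarrow> 'e) \<Rightarrow> bool" where
  "inner_derivation A M D \<longleftrightarrow>
     (\<exists>x\<in>carrier M. \<forall>a\<in>carrier A. D a = lact M a x \<ominus>\<^bsub>M\<^esub> ract M x a)"

(* HOL cannot quantify over all types inside a formula, so E ranges over the Banach A-bimodules
   whose carrier is a set of elements of the type ('a => 'a => 'k) set. (That type is the home of
   quotients of spaces of bilinear forms on A.) For a Banach algebra A over the reals or the
   complex numbers this loses nothing. If A is nonzero, every subset of a Banach A-bimodule E of
   density character at most max(aleph_0, dens A) generates a closed sub-bimodule F with the same
   bound on its density character; hence card F <= card A, and F is isomorphic to a bimodule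
   considered here. Suppose that D : A -> E* is a continuous derivation and that for each such F
   its restriction A -> F* is inner. The implementing functionals on the F can be chosen with a
   common norm bound: otherwise the closed sub-bimodule generated by countably many bad F would be
   a counterexample. Extend them to E by Hahn-Banach; a weak* cluster point along the upward
   directed family of the F then implements D. *)
definition amenable :: "('k::real_normed_field, 'a) normed_space \<Rightarrow> bool" where
  "amenable A \<longleftrightarrow>
    (\<forall>E :: ('k, 'a, ('a \<Rightarrow> 'a \<Rightarrow> 'k) set) bimodule. banach_bimodule A E \<longrightarrow>
      (\<forall>D. continuous_derivation A (dual_bimodule E) D \<longrightarrow>
        inner_derivation A (dual_bimodule E) D))"

(* Formal sums (alpha_n t_n summed over n = 1, 2, ...) are functions x on nat with x n = alpha_n
   for n >= 1 and x 0 = 0. *)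

definition restr :: "nat set \<Rightarrow> (nat \<Rightarrow> 'k::zero) \<Rightarrow> nat \<Rightarrow> 'k" where
  "restr E x = (\<lambda>n. if n \<in> E then x n else 0)"

(* The lists [E_1, ..., E_k] with k >= 1 and {k} <= E_1 < ... < E_k. *)
definition admissible :: "nat set list set" where
  "admissible = {Es. Es \<noteq> [] \<and> (\<forall>E\<in>set Es. finite E \<and> E \<noteq> {}) \<and>
     length Es \<le> Min (hd Es) \<and> sorted_wrt (\<lambda>E F. Max E < Min F) Es}"

(* Used for finitely supported x only; both suprema are then maxima. *)
primrec tsirelson_seq :: "nat \<Rightarrow> (nat \<Rightarrow> 'k::real_normed_field) \<Rightarrow> real" where
  "tsirelson_seq 0 x = (SUP n. norm (x n))"
| "tsirelson_seq (Suc m) x = max (tsirelson_seq m x)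
     (1 / 2 * (SUP Es\<in>admissible. \<Sum>E\<leftarrow>Es. tsirelson_seq m (restr E x)))"

definition tsirelson_norm :: "(nat \<Rightarrow> 'k::real_normed_field) \<Rightarrow> real" where
  "tsirelson_norm x = lim (\<lambda>m. tsirelson_seq m x)"

(* Since (t_n) is a basis of the completion T* of c_00, the points of T* correspond to the formal
   sums whose partial sums are Cauchy in the norm of c_00, and the norm of such a point is the limit
   of the norms of its partial sums. *)

definition Tstar :: "(nat \<Rightarrow> 'k::real_normed_field) set" where
  "Tstar = {x. x 0 = 0 \<and>
     (\<forall>e>0. \<exists>N. \<forall>m n. N \<le> m \<and> m \<le> n \<longrightarrow> tsirelson_norm (restr {m<..n} x) < e)}"

definition Tstar_norm :: "(nat \<Rightarrow> 'k::real_normed_field) \<Rightarrow> real" where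
  "Tstar_norm x = lim (\<lambda>n. tsirelson_norm (restr {..n} x))"

definition abs_powr :: "real \<Rightarrow> (nat \<Rightarrow> 'k::real_normed_field) \<Rightarrow> nat \<Rightarrow> 'k" where
  "abs_powr p x = (\<lambda>n. of_real (norm (x n) powr p))"

definition Tp :: "real \<Rightarrow> ('k::real_normed_field, nat \<Rightarrow> 'k) normed_space" where
  "Tp p =
    \<lparr>carrier = {x. abs_powr p x \<in> Tstar},
     mult = undefined,
     one = undefined,
     zero = (\<lambda>n. 0),
     add = (\<lambda>x y n. x n + y n),
     smult = (\<lambda>c x n. c * x n),
     nrm = (\<lambda>x. Tstar_norm (abs_powr p x) powr (1 / p))\<rparr>"

end

(* If A(X) is amenable, there is a bounded functional phi on the bounded bilinear forms on B(X) that
   commutes with the action of A(X) and takes the form (a, b) |-> l(ab) to l(1): apply amenability to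
   the derivation c |-> (g |-> g(1, c, 1)) into the dual of the module of bounded trilinear forms g with
   g(a, cd, b) = g(ac, d, b) + g(a, c, db).

   Let X = T^(p), and write a_ij for the matrix entries of a. Commutation with matrix units shows that
   phi(a_ij b_ji) does not depend on i, and averaging over i shows that it is 0. For nonnegative
   weights w_i with sum 1, phi therefore takes the form
     sum_i w_i ((ab)_ii - sum_{j<N} a_ij b_ji) = sum_i w_i sum_{j>=N} a_ij b_ji
   to 1. But for suitable finitely supported w and large N this form has arbitrarily small norm.
   Indeed, any given finite number of vectors supported far out in T^(p) behave like functions in L_p,
   while T^* contains no l_1, so that there is a convex combination w of the basis with small norm.
   For p >= 2 the contradiction comes from the cotype p of L_p. For p < 2 every index is replaced
   by a block of m consecutive ones, and a random choice of one index in each block, combined with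
   the square function estimates in L_p and its dual, gains the factor m^(1/2 - 1/p). *)
theory Submission
  imports Defs
begin

subsection \<open>The norm of Tsirelson's space on finitely supported sequences\<close>

text \<open>The form measures how well the span of the coordinates in F embeds, with a projection,
  into the tail. In l_p it embeds perfectly: the shift by N and its left inverse give the form the
  value 1. In T^(p), vectors beyond 12^(card F), at most card F in number, satisfy a lower
  p-estimate with a constant independent of F (\<open>sum_nu_powr_le\<close>), while F carries a
  vector of mass 1 and small norm. Since N is chosen after F, the two conflict. For p < 2 the lower
  p-estimate cannot be applied to a square function, because the l_2-norm no longer dominates the
  l_p-norm. Selections avoid this at the cost of a functional on F of norm of order
  \<open>\<epsilon> powr (- (1 / p))\<close>, which must meet vectors of norm of order
  \<open>\<epsilon> powr (1 / p)\<close>. Hence the average is replaced by a nearly minimal one on F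
  (\<open>near_minimal_average\<close>). Bilinear forms are taken on B(X) so that the identity
  operator can be inserted. Admitting all solutions of the cocycle identity, and not only
  coboundaries, gives a complete module without closures or quotients.\<close>

definition fsupp :: "(nat \<Rightarrow> 'a::zero) \<Rightarrow> bool" where
  "fsupp x \<longleftrightarrow> (\<exists>M. \<forall>n\<ge>M. x n = 0)"

abbreviation lo :: "nat \<Rightarrow> (nat \<Rightarrow> 'a::zero) \<Rightarrow> nat \<Rightarrow> 'a" where
  "lo c \<equiv> restr {..<c}"
abbreviation hi :: "nat \<Rightarrow> (nat \<Rightarrow> 'a::zero) \<Rightarrow> nat \<Rightarrow> 'a" where
  "hi c \<equiv> restr {c..}"

lemma restr_restr: "restr A (restr B x) = restr (A \<inter> B) x"
  by (auto simp: restr_def)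

lemma restr_apply: "restr A x n = (if n \<in> A then x n else 0)"
  by (simp add: restr_def)

lemma fsupp_restr [simp]: "fsupp x \<Longrightarrow> fsupp (restr A x)"
  by (auto simp: fsupp_def restr_def)

lemma fsupp_restr_finite: "finite A \<Longrightarrow> fsupp (restr A x)"
  unfolding fsupp_def restr_def
  by (metis finite_nat_set_iff_bounded not_le)

lemma fsupp_restr_atMost [simp]: "fsupp (restr {..<n} x)" "fsupp (restr {..n} x)"
  by (simp_all add: fsupp_restr_finite)

lemma fsupp_mono: "fsupp y \<Longrightarrow> (\<And>n. \<bar>x n\<bar> \<le> \<bar>y n :: real\<bar>) \<Longrightarrow> fsupp x"
  unfolding fsupp_def by (metis abs_le_zero_iff abs_zero)

lemma fsupp_add [simp]:
  fixes x y :: "nat \<Rightarrow> 'a::monoid_add"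
  assumes "fsupp x" "fsupp y" shows "fsupp (\<lambda>n. x n + y n)"
proof -
  obtain M M' where "\<forall>n\<ge>M. x n = 0" "\<forall>n\<ge>M'. y n = 0" using assms by (auto simp: fsupp_def)
  then have "\<forall>n\<ge>max M M'. x n + y n = 0" by auto
  then show ?thesis unfolding fsupp_def by blast
qed

lemma fsupp_zero [simp]: "fsupp (\<lambda>n. 0)"
  by (simp add: fsupp_def)

lemma fsupp_cmult [simp]: "fsupp x \<Longrightarrow> fsupp (\<lambda>n. c * x n :: 'a::mult_zero)"
  unfolding fsupp_def by (metis mult_zero_right)

definition l1 :: "(nat \<Rightarrow> real) \<Rightarrow> real" where "l1 x = (\<Sum>n. \<bar>x n\<bar>)"

lemma fsupp_summable: "fsupp x \<Longrightarrow> summable (\<lambda>n. \<bar>x n :: real\<bar>)"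
proof -
  assume "fsupp x"
  then obtain M where "\<forall>n\<ge>M. x n = 0" by (auto simp: fsupp_def)
  then show ?thesis by (intro summable_finite[of "{..<M}"]) auto
qed

lemma l1_eq_sum: "(\<And>n. n \<ge> M \<Longrightarrow> x n = 0) \<Longrightarrow> l1 x = (\<Sum>n<M. \<bar>x n\<bar>)"
  unfolding l1_def by (subst suminf_finite[of "{..<M}"]) auto

lemma l1_zero [simp]: "l1 (\<lambda>n. 0) = 0"
  by (simp add: l1_def)

lemma l1_nonneg: "fsupp x \<Longrightarrow> 0 \<le> l1 x"
  unfolding l1_def by (intro suminf_nonneg fsupp_summable) auto

lemma l1_mono: "fsupp y \<Longrightarrow> (\<And>n. \<bar>x n\<bar> \<le> \<bar>y n\<bar>) \<Longrightarrow> l1 x \<le> l1 y"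
  unfolding l1_def using fsupp_mono by (intro suminf_le fsupp_summable) auto

lemma l1_add: "fsupp x \<Longrightarrow> fsupp y \<Longrightarrow> (\<And>n. 0 \<le> x n) \<Longrightarrow> (\<And>n. 0 \<le> y n) \<Longrightarrow>
    l1 (\<lambda>n. x n + y n) = l1 x + l1 y"
  unfolding l1_def using suminf_add[of "\<lambda>n. \<bar>x n\<bar>" "\<lambda>n. \<bar>y n\<bar>"] fsupp_summable[of x] fsupp_summable[of y] by simp

lemma l1_cmult: "fsupp x \<Longrightarrow> l1 (\<lambda>n. c * x n) = \<bar>c\<bar> * l1 x"
  unfolding l1_def abs_mult by (rule suminf_mult) (rule fsupp_summable)

lemma l1_split: "fsupp x \<Longrightarrow> l1 x = l1 (lo c x) + l1 (hi c x)"
proof -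
  assume "fsupp x"
  then have "(\<Sum>n. \<bar>lo c x n\<bar> + \<bar>hi c x n\<bar>) = l1 (lo c x) + l1 (hi c x)"
    unfolding l1_def by (subst suminf_add) (auto intro: fsupp_summable)
  moreover have "(\<lambda>n. \<bar>lo c x n\<bar> + \<bar>hi c x n\<bar>) = (\<lambda>n. \<bar>x n\<bar>)" by (auto simp: restr_def)
  ultimately show ?thesis by (simp add: l1_def)
qed

lemma abs_le_l1: "fsupp x \<Longrightarrow> \<bar>x n\<bar> \<le> l1 x"
  unfolding l1_def using sum_le_suminf[of "\<lambda>n. \<bar>x n\<bar>" "{n}"] by (auto intro: fsupp_summable)

text \<open>Since \<open>{k} \<le> E\<^sub>1\<close> means that all sets lie in \<open>[k, \<infinity>)\<close>, the inner maximum in the definition of the norm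
  is the supremum over \<open>k\<close> of \<open>split_sup N k (hi k x)\<close>: cutting into intervals loses nothing.\<close>
primrec split_sup :: "((nat \<Rightarrow> real) \<Rightarrow> real) \<Rightarrow> nat \<Rightarrow> (nat \<Rightarrow> real) \<Rightarrow> real" where
  "split_sup N 0 x = 0"
| "split_sup N (Suc n) x = (SUP c. N (lo c x) + split_sup N n (hi c x))"

text \<open>The properties shared by every level \<open>ts m\<close> and by the limit
  \<open>tn\<close>. Domination by \<open>l1\<close> keeps the suprema over
  \<open>admissible\<close> and the limit over the levels finite; homogeneity is shown separately,
  in \<open>tn_cmult\<close>.\<close>

locale lattice_seminorm =
  fixes N :: "(nat \<Rightarrow> real) \<Rightarrow> real"
  assumes zero [simp]: "N (\<lambda>n. 0) = 0"
    and mono: "fsupp y \<Longrightarrow> (\<And>n. \<bar>x n\<bar> \<le> \<bar>y n\<bar>) \<Longrightarrow> N x \<le> N y"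
    and tri: "fsupp x \<Longrightarrow> fsupp y \<Longrightarrow> N (\<lambda>n. x n + y n) \<le> N x + N y"
    and le_l1: "fsupp x \<Longrightarrow> N x \<le> l1 x"
begin

abbreviation "S \<equiv> split_sup N"

lemma nonneg: "fsupp x \<Longrightarrow> 0 \<le> N x"
  using mono[of x "\<lambda>n. 0"] by simp

lemma N_restr: "fsupp x \<Longrightarrow> N (restr A x) \<le> N x"
  by (rule mono) (auto simp: restr_def)

lemma N_split: "fsupp x \<Longrightarrow> N x \<le> N (lo c x) + N (hi c x)"
proof -
  assume "fsupp x"
  moreover have "(\<lambda>n. lo c x n + hi c x n) = x" by (auto simp: restr_def)
  ultimately show ?thesis using tri[of "lo c x" "hi c x"] by simp
qed

text \<open>All cuts beyond the support act like the cut at its end. The supremum in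
  \<open>split_sup\<close> is therefore a maximum, and later proofs can work with an optimal
  cut.\<close>

lemma S_range_finite: "fsupp x \<Longrightarrow> finite (range (\<lambda>c. N (lo c x) + S n (hi c x)))"
proof -
  assume "fsupp x"
  then obtain M where M: "\<forall>n\<ge>M. x n = 0" by (auto simp: fsupp_def)
  have "range (\<lambda>c. N (lo c x) + S n (hi c x)) \<subseteq> (\<lambda>c. N (lo c x) + S n (hi c x)) ` {..M}"
  proof (clarify)
    fix c
    have "lo c x = lo (min c M) x" "hi c x = hi (min c M) x"
      using M by (auto simp: restr_def)
    then show "N (lo c x) + S n (hi c x) \<in> (\<lambda>c. N (lo c x) + S n (hi c x)) ` {..M}"
      by (intro image_eqI[of _ _ "min c M"]) auto
  qed
  then show ?thesis by (rule finite_subset) simp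
qed

lemma S_ge: "fsupp x \<Longrightarrow> N (lo c x) + S n (hi c x) \<le> S (Suc n) x"
  unfolding split_sup.simps by (rule cSUP_upper) (auto intro: bdd_above_finite S_range_finite)

lemma S_attained: "fsupp x \<Longrightarrow> \<exists>c. S (Suc n) x = N (lo c x) + S n (hi c x)"
proof -
  assume x: "fsupp x"
  have "S (Suc n) x \<in> range (\<lambda>c. N (lo c x) + S n (hi c x))"
    unfolding split_sup.simps
    by (subst cSup_eq_Max) (auto intro!: S_range_finite x Max_in)
  then show ?thesis by auto
qed

lemma S_le: "(\<And>c. N (lo c x) + S n (hi c x) \<le> B) \<Longrightarrow> S (Suc n) x \<le> B"
  unfolding split_sup.simps by (rule cSUP_least) auto

declare split_sup.simps(2) [simp del]

lemma S_zero [simp]: "S n (\<lambda>n. 0) = 0"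
  by (induction n) (auto simp: split_sup.simps restr_def)

lemma S_nonneg: "fsupp x \<Longrightarrow> 0 \<le> S n x"
proof (induction n arbitrary: x)
  case (Suc n)
  then show ?case using S_ge[of x 0 n] nonneg[of "lo 0 x"] by (smt (verit) fsupp_restr)
qed simp

lemma S_Suc_ge: "fsupp x \<Longrightarrow> S n x \<le> S (Suc n) x"
proof -
  assume "fsupp x"
  moreover have "lo 0 x = (\<lambda>n. 0)" "hi 0 x = x" by (auto simp: restr_def)
  ultimately show ?thesis using S_ge[of x 0 n] by simp
qed

lemma S_mono_n: "fsupp x \<Longrightarrow> n \<le> n' \<Longrightarrow> S n x \<le> S n' x"
  by (rule lift_Suc_mono_le[of "\<lambda>n. S n x"]) (auto intro: S_Suc_ge)

lemma S_mono: "fsupp y \<Longrightarrow> (\<And>n. \<bar>x n\<bar> \<le> \<bar>y n\<bar>) \<Longrightarrow> S n x \<le> S n y"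
proof (induction n arbitrary: x y)
  case (Suc n)
  show ?case
  proof (rule S_le)
    fix c
    have "N (lo c x) \<le> N (lo c y)"
      by (rule mono, rule fsupp_restr, rule Suc.prems, simp add: restr_apply Suc.prems)
    moreover have "S n (hi c x) \<le> S n (hi c y)"
      by (rule Suc.IH, rule fsupp_restr, rule Suc.prems, simp add: restr_apply Suc.prems)
    ultimately
    show "N (lo c x) + S n (hi c x) \<le> S (Suc n) y" using S_ge[OF Suc.prems(1), of c n] by simp
  qed
qed simp

lemma S_restr: "fsupp x \<Longrightarrow> S n (restr A x) \<le> S n x"
  by (rule S_mono) (auto simp: restr_def)

lemma lo_all: "fsupp x \<Longrightarrow> \<exists>c. lo c x = x \<and> hi c x = (\<lambda>n. 0)"
proof -
  assume "fsupp x"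
  then obtain M where "\<forall>n\<ge>M. x n = 0" by (auto simp: fsupp_def)
  then have "lo M x = x \<and> hi M x = (\<lambda>n. 0)" by (auto simp: restr_def not_less)
  then show ?thesis by blast
qed

lemma S_1: assumes x: "fsupp x" shows "S (Suc 0) x = N x"
proof (rule antisym)
  show "S (Suc 0) x \<le> N x" by (rule S_le) (simp add: N_restr x)
  obtain c where "lo c x = x" using lo_all[OF x] by auto
  then show "N x \<le> S (Suc 0) x" using S_ge[OF x, of c 0] by simp
qed

lemma S_tri: "fsupp x \<Longrightarrow> fsupp y \<Longrightarrow> S n (\<lambda>n. x n + y n) \<le> S n x + S n y"
proof (induction n arbitrary: x y)
  case (Suc n)
  show ?case
  proof (rule S_le)
    fix c
    have e: "restr A (\<lambda>n. x n + y n) = (\<lambda>n. restr A x n + restr A y n)" for A by (auto simp: restr_def)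
    have "N (lo c (\<lambda>n. x n + y n)) \<le> N (lo c x) + N (lo c y)"
      "S n (hi c (\<lambda>n. x n + y n)) \<le> S n (hi c x) + S n (hi c y)"
      using Suc by (auto simp: e intro!: tri Suc.IH)
    then show "N (lo c (\<lambda>n. x n + y n)) + S n (hi c (\<lambda>n. x n + y n)) \<le> S (Suc n) x + S (Suc n) y"
      using S_ge[OF Suc.prems(1), of c n] S_ge[OF Suc.prems(2), of c n] by simp
  qed
qed simp

lemma S_split: "fsupp x \<Longrightarrow> S n x \<le> S n (lo c x) + S n (hi c x)"
proof -
  assume "fsupp x"
  moreover have "(\<lambda>n. lo c x n + hi c x n) = x" by (auto simp: restr_def)
  ultimately show ?thesis using S_tri[of "lo c x" "hi c x"] by simp
qed

lemma S_le_l1: "fsupp x \<Longrightarrow> S n x \<le> l1 x"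
proof (induction n arbitrary: x)
  case (Suc n)
  show ?case
  proof (rule S_le)
    fix c
    show "N (lo c x) + S n (hi c x) \<le> l1 x"
      using le_l1[of "lo c x"] Suc.IH[of "hi c x"] l1_split[OF Suc.prems, of c] Suc.prems by auto
  qed
qed (simp add: l1_nonneg)

text \<open>The pieces to the left of c and those to the right of c form one partition. If the first
  cut d of the left part exceeds c, that part is a single piece, and monotonicity in the number of
  pieces covers the rest.\<close>

lemma S_concat: "fsupp x \<Longrightarrow> S n (lo c x) + S n' (hi c x) \<le> S (n + n') x"
proof (induction n arbitrary: x)
  case 0
  then show ?case by (simp add: S_restr)
next
  case (Suc n)
  obtain d where d: "S (Suc n) (lo c x) = N (lo d (lo c x)) + S n (hi d (lo c x))"
    using S_attained[of "lo c x" n] Suc.prems by auto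
  show ?case
  proof (cases "d \<le> c")
    case True
    have "lo d (lo c x) = lo d x" "hi d (lo c x) = lo c (hi d x)" "hi c x = hi c (hi d x)"
      using True by (auto simp: restr_def)
    then have "S (Suc n) (lo c x) + S n' (hi c x) = N (lo d x) + (S n (lo c (hi d x)) + S n' (hi c (hi d x)))"
      using d by simp
    also have "\<dots> \<le> N (lo d x) + S (n + n') (hi d x)"
      using Suc.IH[of "hi d x"] Suc.prems by simp
    also have "\<dots> \<le> S (Suc n + n') x" using S_ge[OF Suc.prems] by simp
    finally show ?thesis .
  next
    case False
    then have "lo d (lo c x) = lo c x" "hi d (lo c x) = (\<lambda>n. 0)" by (auto simp: restr_def)
    then have "S (Suc n) (lo c x) + S n' (hi c x) = N (lo c x) + S n' (hi c x)"
      using d by simp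
    also have "\<dots> \<le> N (lo c x) + S (n + n') (hi c x)"
      using S_mono_n[of "hi c x" n' "n + n'"] Suc.prems by simp
    also have "\<dots> \<le> S (Suc n + n') x" using S_ge[OF Suc.prems] by simp
    finally show ?thesis .
  qed
qed

lemma S_le_mult: "fsupp x \<Longrightarrow> S n x \<le> n * N x"
proof (induction n arbitrary: x)
  case (Suc n)
  show ?case
  proof (rule S_le)
    fix c
    have "n * N (hi c x) \<le> n * N x" by (intro mult_left_mono) (auto intro: N_restr Suc.prems)
    then show "N (lo c x) + S n (hi c x) \<le> Suc n * N x"
      using Suc.IH[of "hi c x"] N_restr[OF Suc.prems, of "{..<c}"] Suc.prems by (auto simp: algebra_simps)
  qed
qed simp

text \<open>With n pieces, n consecutive coordinates can be separated into singletons, and each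
  singleton counts with at least its modulus.\<close>

lemma S_ge_consecutive:
  assumes sing: "\<And>i y. fsupp y \<Longrightarrow> \<bar>y i\<bar> \<le> N y"
  shows "fsupp x \<Longrightarrow> (\<And>i. x i \<noteq> 0 \<Longrightarrow> a \<le> i \<and> i < a + n) \<Longrightarrow> l1 x \<le> S n x"
proof (induction n arbitrary: x a)
  case 0
  then have "x i = 0" for i using 0(2)[of i] by linarith
  then have "x = (\<lambda>n. 0)" by auto
  then show ?case by simp
next
  case (Suc n)
  have "l1 (hi (Suc a) x) \<le> S n (hi (Suc a) x)"
  proof (rule Suc.IH[of _ "Suc a"])
    fix i assume "hi (Suc a) x i \<noteq> 0"
    then show "Suc a \<le> i \<and> i < Suc a + n"
      using Suc.prems(2)[of i] by (auto simp: restr_apply split: if_splits)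
  qed (simp add: Suc.prems(1))
  moreover have "l1 (lo (Suc a) x) \<le> \<bar>x a\<bar>"
  proof -
    have "l1 (lo (Suc a) x) = (\<Sum>n<Suc a. \<bar>lo (Suc a) x n\<bar>)" by (rule l1_eq_sum) (auto simp: restr_def)
    also have "\<dots> = (\<Sum>n\<in>{a}. \<bar>lo (Suc a) x n\<bar>)"
    proof (intro sum.mono_neutral_right ballI)
      fix i assume "i \<in> {..<Suc a} - {a}"
      then show "\<bar>lo (Suc a) x i\<bar> = 0" using Suc.prems(2)[of i] by (auto simp: restr_apply)
    qed auto
    finally show ?thesis by (simp add: restr_def)
  qed
  moreover have "\<bar>x a\<bar> \<le> N (lo (Suc a) x)"
    using sing[of "lo (Suc a) x" a] Suc.prems(1) by (simp add: restr_apply)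
  ultimately show ?case using S_ge[OF Suc.prems(1), of "Suc a" n] l1_split[OF Suc.prems(1), of "Suc a"] by simp
qed

text \<open>\<open>sum_list_le_S\<close> and \<open>S_list\<close> translate between cuts and the
  lists of sets in the definition of the norm. A set E is enlarged to everything up to
  \<open>Max E\<close>; conversely, each piece of a partition is intersected with the support, and
  empty pieces are dropped.\<close>

lemma sum_list_le_S:
  assumes "fsupp x" "\<forall>E\<in>set Es. finite E \<and> E \<noteq> {}" "sorted_wrt (\<lambda>E F. Max E < Min F) Es"
  shows "(\<Sum>E\<leftarrow>Es. N (restr E x)) \<le> S (length Es) x"
  using assms
proof (induction Es arbitrary: x)
  case (Cons E Es)
  let ?c = "Suc (Max E)"
  have E: "finite E" "E \<noteq> {}" using Cons.prems by auto
  have "N (restr E x) \<le> N (lo ?c x)"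
    by (rule mono) (use Cons.prems E in \<open>auto simp: restr_apply less_Suc_eq_le\<close>)
  moreover have "restr F x = restr F (hi ?c x)" if "F \<in> set Es" for F
  proof -
    have "Max E < Min F" "finite F" "F \<noteq> {}" using Cons.prems that by auto
    then have "F \<subseteq> {?c..}" by (auto simp: Suc_le_eq)
    then show ?thesis by (simp add: restr_restr inf.absorb1)
  qed
  then have "(\<Sum>F\<leftarrow>Es. N (restr F x)) = (\<Sum>F\<leftarrow>Es. N (restr F (hi ?c x)))"
    by (intro arg_cong[of _ _ sum_list] map_cong refl arg_cong[of _ _ N])
  moreover have "\<dots> \<le> S (length Es) (hi ?c x)"
    by (rule Cons.IH) (use Cons.prems in auto)
  ultimately show ?case using S_ge[OF Cons.prems(1), of ?c "length Es"] by simp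
qed simp

lemma S_list:
  assumes "fsupp x"
  shows "\<exists>Es. (\<forall>E\<in>set Es. finite E \<and> E \<noteq> {} \<and> E \<subseteq> {n. x n \<noteq> 0}) \<and> 
     sorted_wrt (\<lambda>E F. Max E < Min F) Es \<and> length Es \<le> n \<and> S n x = (\<Sum>E\<leftarrow>Es. N (restr E x))"
  using assms
proof (induction n arbitrary: x)
  case 0
  show ?case by (rule exI[of _ "[]"]) simp
next
  case (Suc n)
  obtain c where c: "S (Suc n) x = N (lo c x) + S n (hi c x)"
    using S_attained[OF Suc.prems] by auto
  obtain Es where Es: "\<forall>E\<in>set Es. finite E \<and> E \<noteq> {} \<and> E \<subseteq> {n. hi c x n \<noteq> 0}" 
     "sorted_wrt (\<lambda>E F. Max E < Min F) Es" "length Es \<le> n" "S n (hi c x) = (\<Sum>E\<leftarrow>Es. N (restr E (hi c x)))"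
    using Suc.IH[of "hi c x"] Suc.prems by auto
  have sub: "E \<subseteq> {c..}" "E \<subseteq> {n. x n \<noteq> 0}" if "E \<in> set Es" for E
    using Es(1) that by (fastforce simp: restr_def split: if_splits)+
  have m: "map (\<lambda>E. N (restr E (hi c x))) Es = map (\<lambda>E. N (restr E x)) Es"
    using sub(1) by (simp add: restr_restr inf.absorb1)
  have Seq: "S n (hi c x) = (\<Sum>E\<leftarrow>Es. N (restr E x))" using Es(4) by (simp only: m)
  let ?E = "{n. n < c \<and> x n \<noteq> 0}"
  have rE: "restr ?E x = lo c x" by (auto simp: restr_def)
  show ?case
  proof (cases "?E = {}")
    case True
    then have "lo c x = (\<lambda>n. 0)" by (auto simp: restr_def)
    then show ?thesis using c Seq Es sub by (intro exI[of _ Es]) auto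
  next
    case False
    have "Max ?E < Min E" if "E \<in> set Es" for E
    proof -
      have "Max ?E < c" using False by auto
      moreover have "c \<le> Min E" using sub[OF that] Es(1) that by auto
      ultimately show ?thesis by simp
    qed
    then show ?thesis using c Seq Es sub False rE by (intro exI[of _ "?E # Es"]) auto
  qed
qed

end

section \<open>The levels of the norm, their limit, and its implicit equation\<close>

abbreviation ts :: "nat \<Rightarrow> (nat \<Rightarrow> real) \<Rightarrow> real" where "ts \<equiv> tsirelson_seq"

lemma admissible_nonempty: "admissible \<noteq> {}"
proof -
  have "[{1}] \<in> admissible" by (simp add: admissible_def)
  then show ?thesis by blast
qed

lemma admissible_sum_le:
  assumes "lattice_seminorm N" "fsupp x" "Es \<in> admissible"
  shows "(\<Sum>E\<leftarrow>Es. N (restr E x)) \<le> split_sup N (length Es) (hi (length Es) x)" "length Es \<ge> 1"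
proof -
  interpret lattice_seminorm N by fact
  show "length Es \<ge> 1" using assms(3) by (cases Es) (auto simp: admissible_def)
  have Es: "\<forall>E\<in>set Es. finite E \<and> E \<noteq> {}" "sorted_wrt (\<lambda>E F. Max E < Min F) Es"
     "Es \<noteq> []" "length Es \<le> Min (hd Es)"
    using assms(3) by (auto simp: admissible_def)
  have sub: "E \<subseteq> {length Es..}" if E: "E \<in> set Es" for E
  proof -
    have "Min (hd Es) \<le> Min E"
    proof (cases "E = hd Es")
      case False
      then obtain F Fs where F: "Es = F # Fs" "E \<in> set Fs" using E Es(3) by (cases Es) auto
      then have "Max F < Min E" "Min F \<le> Max F" using Es by auto
      then show ?thesis using F by simp
    qed simp
    moreover have "finite E" "E \<noteq> {}" using Es E by auto
    ultimately show ?thesis using Es(4) by (auto dest: Min_le[of E])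
  qed
  have "map (\<lambda>E. N (restr E x)) Es = map (\<lambda>E. N (restr E (hi (length Es) x))) Es"
    using sub by (simp add: restr_restr inf.absorb1)
  then have "(\<Sum>E\<leftarrow>Es. N (restr E x)) = (\<Sum>E\<leftarrow>Es. N (restr E (hi (length Es) x)))" by (simp only:)
  also have "\<dots> \<le> split_sup N (length Es) (hi (length Es) x)"
    by (rule sum_list_le_S) (use assms(2) Es in auto)
  finally show "(\<Sum>E\<leftarrow>Es. N (restr E x)) \<le> split_sup N (length Es) (hi (length Es) x)" .
qed

lemma ts_bdd:
  assumes "lattice_seminorm (ts m)" "fsupp x"
  shows "bdd_above ((\<lambda>Es. \<Sum>E\<leftarrow>Es. ts m (restr E x)) ` admissible)"
proof -
  interpret lattice_seminorm "ts m" by fact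
  have "(\<Sum>E\<leftarrow>Es. ts m (restr E x)) \<le> l1 x" if "Es \<in> admissible" for Es
    using admissible_sum_le[OF assms that] S_le_l1[of "hi (length Es) x" "length Es"] assms(2)
      l1_mono[OF assms(2), of "hi (length Es) x"]
    by (force simp: restr_apply)
  then show ?thesis by (auto intro!: bdd_aboveI[of _ "l1 x"])
qed

lemma abs_le_ts0: "fsupp x \<Longrightarrow> \<bar>x n\<bar> \<le> ts 0 x"
proof -
  assume "fsupp x"
  then have "bdd_above (range (\<lambda>n. norm (x n)))" by (auto intro!: bdd_aboveI[of _ "l1 x"] abs_le_l1)
  then show ?thesis using cSUP_upper[of n UNIV "\<lambda>n. norm (x n)"] by simp
qed

lemma ts_Suc_le: "ts m x \<le> B \<Longrightarrow> (\<And>Es. Es \<in> admissible \<Longrightarrow> (\<Sum>E\<leftarrow>Es. ts m (restr E x)) \<le> 2 * B) \<Longrightarrow> ts (Suc m) x \<le> B"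
  using cSUP_least[OF admissible_nonempty, of "\<lambda>Es. \<Sum>E\<leftarrow>Es. ts m (restr E x)" "2 * B"] by simp

lemma ts_Suc_ge:
  assumes "lattice_seminorm (ts m)" "fsupp x" "Es \<in> admissible"
  shows "(\<Sum>E\<leftarrow>Es. ts m (restr E x)) \<le> 2 * ts (Suc m) x"
  using cSUP_upper[OF assms(3) ts_bdd[OF assms(1,2)]] by (simp add: max_def)

lemma restr_add: "restr A (\<lambda>n. x n + y n :: real) = (\<lambda>n. restr A x n + restr A y n)"
  by (auto simp: restr_def)

lemma ts_lattice_seminorm: "lattice_seminorm (ts m)"
proof (induction m)
  case 0
  show ?case
  proof
    show "ts 0 (\<lambda>n. 0) = 0" by simp
    show "ts 0 x \<le> ts 0 y" if "fsupp y" "\<And>n. \<bar>x n\<bar> \<le> \<bar>y n\<bar>" for x y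
      unfolding tsirelson_seq.simps
      by (rule cSUP_least) (use that abs_le_ts0[of y] order_trans in fastforce)+
    show "ts 0 (\<lambda>n. x n + y n) \<le> ts 0 x + ts 0 y" if "fsupp x" "fsupp y" for x y
      unfolding tsirelson_seq.simps(1)[of "\<lambda>n. x n + y n"]
    proof (rule cSUP_least)
      show "norm (x n + y n) \<le> ts 0 x + ts 0 y" for n
        using abs_le_ts0[OF that(1), of n] abs_le_ts0[OF that(2), of n] by simp
    qed simp
    show "ts 0 x \<le> l1 x" if "fsupp x" for x
      unfolding tsirelson_seq.simps by (rule cSUP_least) (use that in \<open>auto simp: abs_le_l1\<close>)
  qed
next
  case (Suc m)
  interpret lattice_seminorm "ts m" by fact
  have up: "(\<Sum>E\<leftarrow>Es. ts m (restr E x)) \<le> 2 * ts (Suc m) x" if "fsupp x" "Es \<in> admissible" for Es x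
    by (rule ts_Suc_ge[OF Suc that])
  have le: "ts m x \<le> ts (Suc m) x" for x by simp
  show ?case
  proof
    show "ts (Suc m) (\<lambda>n. 0) = 0"
    proof -
      have "restr E (\<lambda>n. 0::real) = (\<lambda>n. 0)" for E by (auto simp: restr_def)
      then show ?thesis using admissible_nonempty by simp
    qed
    show "ts (Suc m) x \<le> ts (Suc m) y" if "fsupp y" "\<And>n. \<bar>x n\<bar> \<le> \<bar>y n\<bar>" for x y
    proof (rule ts_Suc_le)
      show "ts m x \<le> ts (Suc m) y" using mono[OF that] le[of y] by simp
      fix Es assume Es: "Es \<in> admissible"
      have "(\<Sum>E\<leftarrow>Es. ts m (restr E x)) \<le> (\<Sum>E\<leftarrow>Es. ts m (restr E y))"
        by (rule sum_list_mono, rule mono) (use that in \<open>simp_all add: restr_apply\<close>)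
      then show "(\<Sum>E\<leftarrow>Es. ts m (restr E x)) \<le> 2 * ts (Suc m) y" using up[OF that(1) Es] by simp
    qed
    show "ts (Suc m) (\<lambda>n. x n + y n) \<le> ts (Suc m) x + ts (Suc m) y" if "fsupp x" "fsupp y" for x y
    proof (rule ts_Suc_le)
      show "ts m (\<lambda>n. x n + y n) \<le> ts (Suc m) x + ts (Suc m) y" using tri[OF that] le[of y] le[of x] by simp
      fix Es assume Es: "Es \<in> admissible"
      have "(\<Sum>E\<leftarrow>Es. ts m (restr E (\<lambda>n. x n + y n))) \<le> (\<Sum>E\<leftarrow>Es. ts m (restr E x) + ts m (restr E y))"
        unfolding restr_add by (rule sum_list_mono, rule tri) (use that in simp_all)
      then show "(\<Sum>E\<leftarrow>Es. ts m (restr E (\<lambda>n. x n + y n))) \<le> 2 * (ts (Suc m) x + ts (Suc m) y)"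
        using up[OF that(1) Es] up[OF that(2) Es] by (simp add: sum_list_addf)
    qed
    show "ts (Suc m) x \<le> l1 x" if "fsupp x" for x
    proof (rule ts_Suc_le)
      show "ts m x \<le> l1 x" using le_l1[OF that] .
      fix Es assume Es: "Es \<in> admissible"
      have "(\<Sum>E\<leftarrow>Es. ts m (restr E x)) \<le> l1 (hi (length Es) x)"
        using admissible_sum_le[OF Suc that Es] S_le_l1[of "hi (length Es) x" "length Es"] that by simp
      also have "\<dots> \<le> l1 x" by (rule l1_mono) (simp_all add: that restr_apply)
      finally show "(\<Sum>E\<leftarrow>Es. ts m (restr E x)) \<le> 2 * l1 x" using l1_nonneg[OF that] by simp
    qed
  qed
qed

interpretation ts: lattice_seminorm "ts m" for m by (rule ts_lattice_seminorm)

declare tsirelson_seq.simps [simp del]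

lemma ts_mono_level: "m \<le> m' \<Longrightarrow> ts m x \<le> ts m' x"
  by (rule lift_Suc_mono_le[of "\<lambda>m. ts m x"]) (auto simp: tsirelson_seq.simps(2))

lemma abs_le_ts: "fsupp x \<Longrightarrow> \<bar>x n\<bar> \<le> ts m x"
  using abs_le_ts0[of x n] ts_mono_level[of 0 m x] by simp

lemma split_sup_mono_seminorm:
  assumes "lattice_seminorm M" "lattice_seminorm N" "\<And>x. fsupp x \<Longrightarrow> M x \<le> N x"
  shows "fsupp x \<Longrightarrow> split_sup M n x \<le> split_sup N n x"
proof (induction n arbitrary: x)
  case (Suc n)
  interpret M: lattice_seminorm M by fact
  interpret N: lattice_seminorm N by fact
  show ?case
  proof (rule M.S_le)
    fix c
    show "M (lo c x) + split_sup M n (hi c x) \<le> split_sup N (Suc n) x"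
      using assms(3)[of "lo c x"] Suc.IH[of "hi c x"] Suc.prems N.S_ge[OF Suc.prems, of c n] by simp
  qed
qed simp

text \<open>This reduces a bound on a level to coordinates and to splits one level below. Only the
  splits at level m are assumed bounded; since splits grow with the level, the induction can pass
  the assumption down.\<close>

lemma ts_le:
  assumes "fsupp x" "\<And>n. \<bar>x n\<bar> \<le> B" "\<And>s. s \<ge> 1 \<Longrightarrow> split_sup (ts m) s (hi s x) \<le> 2 * B"
  shows "ts (Suc m) x \<le> B"
  using assms(3)
proof (induction m)
  case 0
  show ?case
  proof (rule ts_Suc_le)
    show "ts 0 x \<le> B" unfolding tsirelson_seq.simps by (rule cSUP_least) (use assms in auto)
    show "(\<Sum>E\<leftarrow>Es. ts 0 (restr E x)) \<le> 2 * B" if "Es \<in> admissible" for Es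
      using admissible_sum_le(1)[OF ts_lattice_seminorm assms(1) that, of 0] admissible_sum_le(2)[OF ts_lattice_seminorm assms(1) that] 0[of "length Es"] by simp
  qed
next
  case (Suc m)
  show ?case
  proof (rule ts_Suc_le)
    show "ts (Suc m) x \<le> B"
    proof (rule Suc.IH)
      fix s :: nat assume "s \<ge> 1"
      have "split_sup (ts m) s (hi s x) \<le> split_sup (ts (Suc m)) s (hi s x)"
        by (rule split_sup_mono_seminorm[OF ts_lattice_seminorm ts_lattice_seminorm])
           (auto intro: ts_mono_level simp: assms(1))
      then show "split_sup (ts m) s (hi s x) \<le> 2 * B" using Suc.prems[OF \<open>s \<ge> 1\<close>] by simp
    qed
    show "(\<Sum>E\<leftarrow>Es. ts (Suc m) (restr E x)) \<le> 2 * B" if "Es \<in> admissible" for Es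
      using admissible_sum_le(1)[OF ts_lattice_seminorm assms(1) that, of "Suc m"] admissible_sum_le(2)[OF ts_lattice_seminorm assms(1) that] Suc.prems[of "length Es"] by simp
  qed
qed

abbreviation tn :: "(nat \<Rightarrow> real) \<Rightarrow> real" where "tn \<equiv> tsirelson_norm"

lemma ts_tendsto: "fsupp x \<Longrightarrow> (\<lambda>m. ts m x) \<longlonglongrightarrow> tn x"
proof -
  assume x: "fsupp x"
  have "incseq (\<lambda>m. ts m x)" by (auto simp: incseq_def intro: ts_mono_level)
  moreover have "ts m x \<le> l1 x" for m by (rule ts.le_l1[OF x])
  ultimately obtain L where "(\<lambda>m. ts m x) \<longlonglongrightarrow> L" using incseq_convergent by blast
  then show ?thesis unfolding tsirelson_norm_def by (simp add: limI)
qed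

lemma ts_le_tn: "fsupp x \<Longrightarrow> ts m x \<le> tn x"
  by (rule incseq_le[OF _ ts_tendsto]) (auto simp: incseq_def intro: ts_mono_level)

lemma tn_le_if_ts: "fsupp x \<Longrightarrow> (\<And>m. ts m x \<le> B) \<Longrightarrow> tn x \<le> B"
  by (rule LIMSEQ_le_const2[OF ts_tendsto]) auto

interpretation tn: lattice_seminorm tn
proof
  show "tn (\<lambda>n. 0) = 0" using ts_tendsto[of "\<lambda>n. 0"] by (simp add: LIMSEQ_const_iff)
  show "tn x \<le> tn y" if "fsupp y" "\<And>n. \<bar>x n\<bar> \<le> \<bar>y n\<bar>" for x y
    by (rule LIMSEQ_le[OF ts_tendsto[OF fsupp_mono[OF that]] ts_tendsto[OF that(1)]]) (auto intro: ts.mono that)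
  show "tn (\<lambda>n. x n + y n) \<le> tn x + tn y" if "fsupp x" "fsupp y" for x y
    by (rule LIMSEQ_le[OF ts_tendsto[OF fsupp_add[OF that]] tendsto_add[OF ts_tendsto[OF that(1)] ts_tendsto[OF that(2)]]])
       (auto intro: ts.tri that)
  show "tn x \<le> l1 x" if "fsupp x" for x by (rule tn_le_if_ts[OF that]) (rule ts.le_l1[OF that])
qed

lemmas tn_lattice_seminorm = tn.lattice_seminorm_axioms

lemma abs_le_tn: "fsupp x \<Longrightarrow> \<bar>x n\<bar> \<le> tn x"
  using abs_le_ts[of x n 0] ts_le_tn[of x 0] by simp

lemma split_ts_le_tn: "fsupp x \<Longrightarrow> split_sup (ts m) n x \<le> split_sup tn n x"
  by (rule split_sup_mono_seminorm) (auto intro: ts_le_tn ts_lattice_seminorm tn_lattice_seminorm)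

text \<open>Together with \<open>abs_le_tn\<close>, the lemmas \<open>tn_le\<close> and
  \<open>tn_ge\<close> express the implicit equation of Tsirelson's norm: tn x is the maximum of sup
  |x n| and half the supremum over s of \<open>split_sup tn s (hi s x)\<close>. Later proofs return
  to the levels only for inductions.\<close>

lemma tn_le:
  assumes "fsupp x" "\<And>n. \<bar>x n\<bar> \<le> B" "\<And>s. s \<ge> 1 \<Longrightarrow> split_sup tn s (hi s x) \<le> 2 * B"
  shows "tn x \<le> B"
proof (rule tn_le_if_ts[OF assms(1)])
  fix m
  have "ts m x \<le> ts (Suc m) x" by (rule ts_mono_level) simp
  also have "\<dots> \<le> B"
  proof (rule ts_le)
    fix s :: nat assume "s \<ge> 1"
    then show "split_sup (ts m) s (hi s x) \<le> 2 * B"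
      using split_ts_le_tn[of "hi s x" m s] assms(3)[of s] assms(1) by simp
  qed (use assms in auto)
  finally show "ts m x \<le> B" .
qed

lemma tendsto_sum_list':
  fixes f :: "nat \<Rightarrow> 'b \<Rightarrow> real"
  assumes "\<And>E. (\<lambda>m. f m E) \<longlonglongrightarrow> g E"
  shows "(\<lambda>m. \<Sum>E\<leftarrow>Es. f m E) \<longlonglongrightarrow> (\<Sum>E\<leftarrow>Es. g E)"
proof (induction Es)
  case (Cons E Es)
  then show ?case using tendsto_add[OF assms[of E] Cons] by simp
qed simp

text \<open>An optimal partition for \<open>tn\<close> is fixed first. Its sum at level m is
  controlled by level m + 1 of the norm, and m tends to infinity afterwards.\<close>

lemma tn_ge:
  assumes x: "fsupp x" and s: "s \<ge> 1"
  shows "split_sup tn s (hi s x) \<le> 2 * tn x"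
proof -
  obtain Es where Es: "\<forall>E\<in>set Es. finite E \<and> E \<noteq> {} \<and> E \<subseteq> {n. hi s x n \<noteq> 0}" 
     "sorted_wrt (\<lambda>E F. Max E < Min F) Es" "length Es \<le> s"
     "split_sup tn s (hi s x) = (\<Sum>E\<leftarrow>Es. tn (restr E (hi s x)))"
    using tn.S_list[of "hi s x" s] x by auto
  show ?thesis
  proof (cases "Es = []")
    case True
    then show ?thesis using Es tn.nonneg[OF x] by simp
  next
    case False
    have "E \<subseteq> {s..}" if "E \<in> set Es" for E using Es(1) that by (fastforce simp: restr_def split: if_splits)
    then have "hd Es \<subseteq> {s..}" "finite (hd Es)" "hd Es \<noteq> {}" using Es(1) hd_in_set[OF False] by blast+
    then have "s \<le> Min (hd Es)" by (auto simp: subset_iff)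
    then have adm: "Es \<in> admissible" using Es False by (auto simp: admissible_def)
    have hx: "fsupp (hi s x)" using x by simp
    have "(\<Sum>E\<leftarrow>Es. tn (restr E (hi s x))) \<le> 2 * tn (hi s x)"
    proof (rule LIMSEQ_le_const2)
      show "(\<lambda>m. \<Sum>E\<leftarrow>Es. ts m (restr E (hi s x))) \<longlonglongrightarrow> (\<Sum>E\<leftarrow>Es. tn (restr E (hi s x)))"
      proof (rule tendsto_sum_list'[of "\<lambda>m E. ts m (restr E (hi s x))" "\<lambda>E. tn (restr E (hi s x))" Es])
        show "(\<lambda>m. ts m (restr E (hi s x))) \<longlonglongrightarrow> tn (restr E (hi s x))" for E
          using ts_tendsto[of "restr E (hi s x)"] x by simp
      qed
      show "\<exists>N. \<forall>m\<ge>N. (\<Sum>E\<leftarrow>Es. ts m (restr E (hi s x))) \<le> 2 * tn (hi s x)"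
      proof (intro exI allI impI)
        fix m
        show "(\<Sum>E\<leftarrow>Es. ts m (restr E (hi s x))) \<le> 2 * tn (hi s x)"
          using ts_Suc_ge[OF ts_lattice_seminorm hx adm, of m] ts_le_tn[OF hx, of "Suc m"] by linarith
      qed
    qed
    then show ?thesis using Es(4) tn.N_restr[OF x, of "{s..}"] by simp
  qed
qed

lemma ts_cmult_le: "fsupp x \<Longrightarrow> 0 \<le> c \<Longrightarrow> ts m (\<lambda>n. c * x n) \<le> c * ts m x"
proof (induction m arbitrary: x)
  case 0
  have "norm (c * x n) \<le> c * ts 0 x" for n
    using abs_le_ts0[of x n] 0 by (simp add: abs_mult mult_left_mono)
  then show ?case unfolding tsirelson_seq.simps(1)[of "\<lambda>n. c * x n"] by (intro cSUP_least) auto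
next
  case (Suc m)
  show ?case
  proof (rule ts_Suc_le)
    show "ts m (\<lambda>n. c * x n) \<le> c * ts (Suc m) x"
      using Suc mult_left_mono[OF ts_mono_level[of m "Suc m" x], of c] by force
    fix Es assume Es: "Es \<in> admissible"
    have e: "restr E (\<lambda>n. c * x n) = (\<lambda>n. c * restr E x n)" for E by (auto simp: restr_def)
    have "(\<Sum>E\<leftarrow>Es. ts m (restr E (\<lambda>n. c * x n))) \<le> (\<Sum>E\<leftarrow>Es. c * ts m (restr E x))"
      unfolding e by (rule sum_list_mono, rule Suc.IH) (use Suc.prems in simp_all)
    also have "\<dots> = c * (\<Sum>E\<leftarrow>Es. ts m (restr E x))" by (simp add: sum_list_const_mult)
    also have "\<dots> \<le> c * (2 * ts (Suc m) x)"
      by (intro mult_left_mono ts_Suc_ge ts_lattice_seminorm) (use Suc Es in simp_all)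
    finally show "(\<Sum>E\<leftarrow>Es. ts m (restr E (\<lambda>n. c * x n))) \<le> 2 * (c * ts (Suc m) x)" by simp
  qed
qed

lemma tn_cmult: assumes "fsupp x" "0 \<le> c" shows "tn (\<lambda>n. c * x n) = c * tn x"
proof (cases "c = 0")
  case False
  have le: "tn (\<lambda>n. d * y n) \<le> d * tn y" if "fsupp y" "0 \<le> d" for d y
  proof (rule tn_le_if_ts)
    fix m
    have "ts m (\<lambda>n. d * y n) \<le> d * ts m y" using ts_cmult_le that by blast
    also have "\<dots> \<le> d * tn y" using ts_le_tn that by (intro mult_left_mono) auto
    finally show "ts m (\<lambda>n. d * y n) \<le> d * tn y" .
  qed (use that in simp)
  have "tn (\<lambda>n. inverse c * (c * x n)) \<le> inverse c * tn (\<lambda>n. c * x n)"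
    by (rule le) (use assms in auto)
  then have "c * tn x \<le> tn (\<lambda>n. c * x n)"
    using False assms by (simp add: field_simps mult.assoc[symmetric])
  then show ?thesis using le[OF assms] by simp
qed simp

abbreviation ST :: "nat \<Rightarrow> (nat \<Rightarrow> real) \<Rightarrow> real" where "ST \<equiv> split_sup tn"

lemma hi_supp: "(\<And>i. x i \<noteq> 0 \<Longrightarrow> l \<le> i) \<Longrightarrow> hi l x = x"
  by (force simp: restr_def)

lemma tn_ge': "fsupp x \<Longrightarrow> 1 \<le> s \<Longrightarrow> (\<And>i. x i \<noteq> 0 \<Longrightarrow> s \<le> i) \<Longrightarrow> ST s x \<le> 2 * tn x"
  using tn_ge[of x s] by (simp add: hi_supp)

text \<open>An interval [l, 2l) has l coordinates, none below l, so its singletons form an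
  admissible family.\<close>

lemma l1_le_tn:
  assumes "fsupp x" "1 \<le> l" "\<And>i. x i \<noteq> 0 \<Longrightarrow> l \<le> i \<and> i < l + l"
  shows "l1 x \<le> 2 * tn x"
proof -
  have "l1 x \<le> ST l x" by (rule tn.S_ge_consecutive[of _ l]) (use assms abs_le_tn in auto)
  also have "\<dots> \<le> 2 * tn x" by (rule tn_ge') (use assms in auto)
  finally show ?thesis .
qed

subsection \<open>Lower estimates for vectors supported far out\<close>

text \<open>Cut at \<open>2\<^sup>t * l\<close>: a vector supported on \<open>[l, 2l)\<close> is normed, up to a factor 2, by its \<open>l\<^sub>1\<close>-norm, so the many
  pieces can be merged into \<open>g + 1\<close> ones.\<close>
lemma ST_group:
  assumes "fsupp x" "1 \<le> l" "\<And>i. x i \<noteq> 0 \<Longrightarrow> l \<le> i" "n \<le> 2 ^ g * l"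
  shows "ST n x \<le> 2 * ST (Suc g) x"
  using assms
proof (induction g arbitrary: l x)
  case 0
  have "ST n x \<le> ST l x" by (rule tn.S_mono_n) (use 0 in auto)
  also have "\<dots> \<le> 2 * tn x" by (rule tn_ge') (use 0 in auto)
  finally show ?case using tn.S_1[OF 0(1)] by simp
next
  case (Suc g)
  let ?c = "2 * l"
  have "ST n (lo ?c x) \<le> l1 (lo ?c x)" by (rule tn.S_le_l1) simp
  also have "\<dots> \<le> 2 * tn (lo ?c x)"
  proof (rule l1_le_tn[of _ l])
    fix i assume "lo ?c x i \<noteq> 0"
    then show "l \<le> i \<and> i < l + l" using Suc.prems(3)[of i] by (auto simp: restr_apply split: if_splits)
  qed (use Suc in auto)
  finally have 1: "ST n (lo ?c x) \<le> 2 * tn (lo ?c x)" .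
  have 2: "ST n (hi ?c x) \<le> 2 * ST (Suc g) (hi ?c x)"
  proof (rule Suc.IH[of _ ?c])
    fix i assume "hi ?c x i \<noteq> 0"
    then show "?c \<le> i" by (auto simp: restr_apply split: if_splits)
  qed (use Suc.prems in auto)
  have "ST n x \<le> ST n (lo ?c x) + ST n (hi ?c x)" by (rule tn.S_split[OF Suc.prems(1)])
  also have "\<dots> \<le> 2 * (tn (lo ?c x) + ST (Suc g) (hi ?c x))" using 1 2 by simp
  also have "\<dots> \<le> 2 * ST (Suc (Suc g)) x" using tn.S_ge[OF Suc.prems(1), of ?c "Suc g"] by simp
  finally show ?case .
qed

text \<open>Cut both vectors at the earlier of their two first cuts. By subadditivity the longer
  first piece divides into a part before that cut and a remainder that stays attached to the
  following pieces, so each step uses up one piece of only one vector. Hence s + s' intervals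
  suffice, each costing K pieces of the sum.\<close>

lemma merge_split:
  assumes "lattice_seminorm M" "lattice_seminorm N"
    "\<And>x. fsupp x \<Longrightarrow> M x \<le> tn x" "\<And>x. fsupp x \<Longrightarrow> N x \<le> tn x"
    "\<And>v w. fsupp v \<Longrightarrow> fsupp w \<Longrightarrow> (\<And>n. 0 \<le> v n) \<Longrightarrow> (\<And>n. 0 \<le> w n) \<Longrightarrow> M v + N w \<le> ST K (\<lambda>n. v n + w n)"
    "K \<ge> 1"
    "fsupp v" "fsupp w" "\<And>n. 0 \<le> v n" "\<And>n. 0 \<le> w n"
  shows "split_sup M s v + split_sup N s' w \<le> ST ((s + s') * K) (\<lambda>n. v n + w n)"
  using assms(7-)
proof (induction "s + s'" arbitrary: s s' v w rule: less_induct)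
  case less
  interpret M: lattice_seminorm M by fact
  interpret N: lattice_seminorm N by fact
  let ?x = "\<lambda>n. v n + w n"
  have x: "fsupp ?x" using less.prems by simp
  have vx: "ST j v \<le> ST j ?x" "ST j w \<le> ST j ?x" for j
    by (rule tn.S_mono; use less.prems in \<open>simp add: abs_le_iff\<close>)+
  have key: "M (lo c v) + N (lo c w) + (split_sup M a (hi c v) + split_sup N b (hi c w)) \<le> ST ((s + s') * K) ?x"
    if "a + b + 1 = s + s'" for a b c
  proof -
    have "M (lo c v) + N (lo c w) \<le> ST K (lo c ?x)"
      unfolding restr_add by (rule assms(5)) (use less.prems in \<open>auto simp: restr_apply\<close>)
    moreover have "split_sup M a (hi c v) + split_sup N b (hi c w) \<le> ST ((a + b) * K) (hi c ?x)"
      unfolding restr_add by (rule less.hyps) (use less.prems that in \<open>auto simp: restr_apply\<close>)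
    moreover have "ST K (lo c ?x) + ST ((a + b) * K) (hi c ?x) \<le> ST (K + (a + b) * K) ?x"
      by (rule tn.S_concat[OF x])
    moreover have "K + (a + b) * K = (s + s') * K" using that by (metis add.commute mult_Suc Suc_eq_plus1)
    ultimately show ?thesis by simp
  qed
  show ?case
  proof (cases s)
    case 0
    have "split_sup N s' w \<le> ST s' w" by (rule split_sup_mono_seminorm) (use assms less.prems tn_lattice_seminorm in auto)
    also have "\<dots> \<le> ST (s' * K) w" by (rule tn.S_mono_n) (use less.prems \<open>K \<ge> 1\<close> in auto)
    finally show ?thesis using vx(2)[of "s' * K"] 0 by simp
  next
    case s: (Suc s0)
    show ?thesis
    proof (cases s')
      case 0
      have "split_sup M s v \<le> ST s v" by (rule split_sup_mono_seminorm) (use assms less.prems tn_lattice_seminorm in auto)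
      also have "\<dots> \<le> ST (s * K) v" by (rule tn.S_mono_n) (use less.prems \<open>K \<ge> 1\<close> in auto)
      finally show ?thesis using vx(1)[of "s * K"] 0 by simp
    next
      case s': (Suc s0')
      obtain c where c: "split_sup M s v = M (lo c v) + split_sup M s0 (hi c v)"
        using M.S_attained less.prems s by blast
      obtain d where d: "split_sup N s' w = N (lo d w) + split_sup N s0' (hi d w)"
        using N.S_attained less.prems s' by blast
      show ?thesis
      proof (cases "c \<le> d")
        case True
        have "N (lo d w) \<le> N (lo c (lo d w)) + N (hi c (lo d w))" by (rule N.N_split) (use less.prems in simp)
        moreover have "N (lo d (hi c w)) + split_sup N s0' (hi d (hi c w)) \<le> split_sup N s' (hi c w)"
          unfolding s' by (rule N.S_ge) (use less.prems in simp)
        moreover have "lo c (lo d w) = lo c w" "hi c (lo d w) = lo d (hi c w)" "hi d (hi c w) = hi d w"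
          using True by (auto simp: restr_def)
        ultimately have "split_sup N s' w \<le> N (lo c w) + split_sup N s' (hi c w)" using d by simp
        then show ?thesis using c key[of s0 s' c] s by simp
      next
        case False
        have "M (lo c v) \<le> M (lo d (lo c v)) + M (hi d (lo c v))" by (rule M.N_split) (use less.prems in simp)
        moreover have "M (lo c (hi d v)) + split_sup M s0 (hi c (hi d v)) \<le> split_sup M s (hi d v)"
          unfolding s by (rule M.S_ge) (use less.prems in simp)
        moreover have "lo d (lo c v) = lo d v" "hi d (lo c v) = lo c (hi d v)" "hi c (hi d v) = hi c v"
          using False by (auto simp: restr_def)
        ultimately have "split_sup M s v \<le> M (lo d v) + split_sup M s (hi d v)" using c by simp
        then show ?thesis using d key[of s s0' d] s' by simp
      qed
    qed
  qed
qed

lemma hi_hi: "hi a (hi b x) = hi (max a b) x" by (auto simp: restr_def)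

lemma half_split_ts_le:
  assumes "fsupp x" "1 \<le> s" "\<And>i. x i \<noteq> 0 \<Longrightarrow> s \<le> i"
  shows "split_sup (ts m) s x \<le> 2 * tn x"
  using split_ts_le_tn[OF assms(1), of m s] tn_ge'[OF assms] by simp

context
  fixes v w :: "nat \<Rightarrow> real"
  assumes vw: "fsupp v" "fsupp w" "\<And>n. 0 \<le> v n" "\<And>n. 0 \<le> w n"
begin

text \<open>Each level of the norm is a coordinate or half a split sum. This lemma and the next two
  compare a term of v with a term of w in the possible combinations. Here a cut separates i from j;
  if i = j, the two values add up in a single coordinate.\<close>

lemma pair_sup_sup: "v i + w j \<le> ST 2 (\<lambda>n. v n + w n)"
proof -
  let ?x = "\<lambda>n. v n + w n"
  have x: "fsupp ?x" using vw by simp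
  have ST2: "tn (lo c ?x) + tn (hi c ?x) \<le> ST 2 ?x" for c
    using tn.S_ge[OF x, of c 1] tn.S_1[of "hi c ?x"] x by (simp add: numeral_2_eq_2)
  have pt: "?x n \<le> tn ?x" "n < c \<Longrightarrow> ?x n \<le> tn (lo c ?x)" "c \<le> n \<Longrightarrow> ?x n \<le> tn (hi c ?x)" for n c
    using abs_le_tn[OF x, of n] abs_le_tn[of "lo c ?x" n] abs_le_tn[of "hi c ?x" n] x vw(3)[of n] vw(4)[of n]
    by (simp_all add: restr_apply)
  have "ST 1 ?x \<le> ST 2 ?x" by (rule tn.S_mono_n[OF x]) simp
  then have "tn ?x \<le> ST 2 ?x" using tn.S_1[OF x] by simp
  moreover have "v i \<le> ?x i" "w j \<le> ?x j" using vw by simp_all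
  ultimately show ?thesis
    using pt(1)[of i] pt(2)[of i j] pt(3)[of j j] pt(2)[of j i] pt(3)[of i i] ST2[of i] ST2[of j]
    by (cases i j rule: linorder_cases) auto
qed

text \<open>The three pieces are the coordinates before i, the coordinate i, and those after i. The
  share of the split sum at i is at most w i and joins v i.\<close>

lemma pair_sup_split:
  assumes "1 \<le> s"
  shows "v i + split_sup (ts k) s (hi s w) / 2 \<le> ST 3 (\<lambda>n. v n + w n)"
proof -
  let ?x = "\<lambda>n. v n + w n" and ?y = "hi s w" and ?S = "split_sup (ts k) s"
  have x: "fsupp ?x" and y: "fsupp ?y" using vw by simp_all
  have "?S ?y \<le> ?S (lo i ?y) + ?S (hi i ?y)" by (rule ts.S_split[OF y])
  moreover have "?S (hi i ?y) \<le> ?S (lo (Suc i) (hi i ?y)) + ?S (hi (Suc i) (hi i ?y))"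
    by (rule ts.S_split) (simp add: y)
  moreover have "?S (lo (Suc i) (hi i ?y)) \<le> w i"
  proof -
    have "?S (lo (Suc i) (hi i ?y)) \<le> l1 (lo (Suc i) (hi i ?y))" by (rule ts.S_le_l1) simp
    also have "\<dots> = (\<Sum>n<Suc i. \<bar>lo (Suc i) (hi i ?y) n\<bar>)" by (rule l1_eq_sum) (simp add: restr_apply)
    also have "\<dots> = (\<Sum>n\<in>{i}. \<bar>lo (Suc i) (hi i ?y) n\<bar>)"
      by (rule sum.mono_neutral_right) (auto simp: restr_apply)
    also have "\<dots> \<le> w i" using vw by (simp add: restr_apply)
    finally show ?thesis .
  qed
  moreover
  have "?S (restr A ?y) \<le> 2 * tn (restr A ?x)" for A
  proof -
    have "?S (restr A ?y) \<le> 2 * tn (restr A ?y)"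
      by (rule half_split_ts_le) (use y assms in \<open>auto simp: restr_apply split: if_splits\<close>)
    also have "tn (restr A ?y) \<le> tn (restr A ?x)"
      by (rule tn.mono) (use x vw in \<open>auto simp: restr_apply\<close>)
    finally show ?thesis by simp
  qed
  note A = this
  have "hi (Suc i) (hi i ?y) = hi (Suc i) ?y" by (auto simp: restr_def)
  then have "?S (lo i ?y) \<le> 2 * tn (lo i ?x)" "?S (hi (Suc i) (hi i ?y)) \<le> 2 * tn (hi (Suc i) ?x)"
    using A[of "{..<i}"] A[of "{Suc i..}"] by simp_all
  moreover have "v i + w i \<le> tn (lo (Suc i) (hi i ?x))"
    using abs_le_tn[of "lo (Suc i) (hi i ?x)" i] vw by (simp add: restr_apply)
  moreover have "tn (lo i ?x) + ST 2 (hi i ?x) \<le> ST 3 ?x"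
    using tn.S_ge[OF x, of i 2] by (simp add: numeral_3_eq_3 numeral_2_eq_2)
  moreover have "tn (lo (Suc i) (hi i ?x)) + tn (hi (Suc i) ?x) \<le> ST 2 (hi i ?x)"
    using tn.S_ge[of "hi i ?x" "Suc i" 1] tn.S_1[of "hi (Suc i) ?x"] x by (simp add: hi_hi numeral_2_eq_2)
  ultimately show ?thesis using vw(4)[of i] by simp
qed

text \<open>The constant 6 reproduces itself: past position \<open>s'\<close> the induction hypothesis yields \<open>(s + s') * 6 \<le> 2\<^sup>4 * s'\<close>
  pieces, which merge into 5; the part before \<open>s'\<close> contributes one more.\<close>
lemma pair_split_split:
  assumes merge: "\<And>v w s s'. fsupp v \<Longrightarrow> fsupp w \<Longrightarrow> (\<And>n. 0 \<le> v n) \<Longrightarrow> (\<And>n. 0 \<le> w n) \<Longrightarrow>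
      split_sup (ts k) s v + split_sup (ts k) s' w \<le> ST ((s + s') * 6) (\<lambda>n. v n + w n)"
    and s: "1 \<le> s" "s \<le> s'"
  shows "split_sup (ts k) s (hi s v) / 2 + split_sup (ts k) s' (hi s' w) / 2 \<le> ST 6 (\<lambda>n. v n + w n)"
proof -
  let ?x = "\<lambda>n. v n + w n" and ?y = "hi s v" and ?S = "split_sup (ts k)"
  have x: "fsupp ?x" and y: "fsupp ?y" using vw by simp_all
  have "?S s ?y \<le> ?S s (lo s' ?y) + ?S s (hi s' ?y)" by (rule ts.S_split[OF y])
  moreover have "hi s' ?y = hi s' v" using s by (simp add: hi_hi max_def)
  moreover have "?S s (lo s' ?y) \<le> 2 * tn (lo s' ?x)"
  proof -
    have "?S s (lo s' ?y) \<le> 2 * tn (lo s' ?y)"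
      by (rule half_split_ts_le) (use y s in \<open>auto simp: restr_apply split: if_splits\<close>)
    also have "tn (lo s' ?y) \<le> tn (lo s' ?x)"
      by (rule tn.mono) (use x vw in \<open>auto simp: restr_apply\<close>)
    finally show ?thesis by simp
  qed
  moreover have "?S s (hi s' v) + ?S s' (hi s' w) \<le> ST ((s + s') * 6) (hi s' ?x)"
    unfolding restr_add by (rule merge) (use vw in \<open>simp_all add: restr_apply\<close>)
  moreover have "ST ((s + s') * 6) (hi s' ?x) \<le> 2 * ST (Suc 4) (hi s' ?x)"
    by (rule ST_group[of _ s']) (use x s in \<open>auto simp: restr_apply split: if_splits\<close>)
  moreover have "tn (lo s' ?x) + ST 5 (hi s' ?x) \<le> ST 6 ?x"
    using tn.S_ge[OF x, of s' 5] by (simp add: eval_nat_numeral)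
  ultimately show ?thesis by (simp add: eval_nat_numeral)
qed

end

text \<open>The number 6 does not change with the level k, which allows the passage to the limit in
  \<open>pair_tn\<close>.\<close>

lemma pair_ts:
  assumes "fsupp v" "fsupp w" "\<And>n. 0 \<le> v n" "\<And>n. 0 \<le> w n"
  shows "ts k v + ts k w \<le> ST 6 (\<lambda>n. v n + w n)"
  using assms
proof (induction k arbitrary: v w)
  case 0
  let ?x = "\<lambda>n. v n + w n"
  have x: "fsupp ?x" using 0 by simp
  have le: "ST 2 ?x \<le> ST 6 ?x" by (rule tn.S_mono_n[OF x]) simp
  have "ts 0 v \<le> ST 6 ?x - w j" for j
    unfolding tsirelson_seq.simps
  proof (rule cSUP_least)
    fix i show "norm (v i) \<le> ST 6 ?x - w j" using pair_sup_sup[OF 0, of i j] le 0 by simp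
  qed simp
  then have "ts 0 w \<le> ST 6 ?x - ts 0 v"
    unfolding tsirelson_seq.simps(1)[of w]
  proof (intro cSUP_least)
    fix j show "norm (w j) \<le> ST 6 ?x - ts 0 v"
      using \<open>\<And>j. ts 0 v \<le> ST 6 ?x - w j\<close>[of j] 0(4)[of j] by simp
  qed simp
  then show ?case by simp
next
  case (Suc k)
  let ?x = "\<lambda>n. v n + w n"
  have x: "fsupp ?x" using Suc by simp
  have le: "ST 2 ?x \<le> ST 6 ?x" "ST 3 ?x \<le> ST 6 ?x" by (rule tn.S_mono_n[OF x]; simp)+
  have comm: "(\<lambda>n. w n + v n) = ?x" by (simp add: add.commute)
  have merge: "split_sup (ts k) s v + split_sup (ts k) s' w \<le> ST ((s + s') * 6) (\<lambda>n. v n + w n)"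
    if "fsupp v" "fsupp w" "\<And>n. 0 \<le> v n" "\<And>n. 0 \<le> w n" for v w s s'
    by (rule merge_split[OF ts_lattice_seminorm ts_lattice_seminorm]) (use that Suc.IH in \<open>auto intro: ts_le_tn\<close>)
  \<comment> \<open>\<open>ts_le\<close> is applied first to v and then, with the chosen term of v
    moved to the right, to w. This leaves exactly the pairs of terms treated above.\<close>
  have "ts (Suc k) v \<le> ST 6 ?x - ts (Suc k) w"
  proof (rule ts_le[OF Suc.prems(1)])
    fix i
    have "ts (Suc k) w \<le> ST 6 ?x - v i"
    proof (rule ts_le[OF Suc.prems(2)])
      show "\<bar>w j\<bar> \<le> ST 6 ?x - v i" for j
        using pair_sup_sup[OF Suc.prems, of i j] le Suc.prems by simp
      show "split_sup (ts k) s (hi s w) \<le> 2 * (ST 6 ?x - v i)" if "1 \<le> s" for s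
        using pair_sup_split[OF Suc.prems that, of i k] le by simp
    qed
    then show "\<bar>v i\<bar> \<le> ST 6 ?x - ts (Suc k) w" using Suc.prems by simp
  next
    fix s :: nat assume s: "1 \<le> s"
    have "ts (Suc k) w \<le> ST 6 ?x - split_sup (ts k) s (hi s v) / 2"
    proof (rule ts_le[OF Suc.prems(2)])
      show "\<bar>w j\<bar> \<le> ST 6 ?x - split_sup (ts k) s (hi s v) / 2" for j
        using pair_sup_split[OF Suc.prems(2,1,4,3) s, of j k] le Suc.prems(4)[of j] by (simp add: comm)
      show "split_sup (ts k) s' (hi s' w) \<le> 2 * (ST 6 ?x - split_sup (ts k) s (hi s v) / 2)" if s': "1 \<le> s'" for s'
      proof (cases "s \<le> s'")
        case True
        have "split_sup (ts k) s (hi s v) / 2 + split_sup (ts k) s' (hi s' w) / 2 \<le> ST 6 ?x"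
          by (rule pair_split_split, (fact Suc.prems)+, rule merge, (simp; fail)+, fact s, fact True)
        then show ?thesis by simp
      next
        case False
        then have "s' \<le> s" by simp
        have "split_sup (ts k) s' (hi s' w) / 2 + split_sup (ts k) s (hi s v) / 2 \<le> ST 6 (\<lambda>n. w n + v n)"
          by (rule pair_split_split, (fact Suc.prems)+, rule merge, (simp; fail)+, fact s', fact \<open>s' \<le> s\<close>)
        then show ?thesis unfolding comm by simp
      qed
    qed
    then show "split_sup (ts k) s (hi s v) \<le> 2 * (ST 6 ?x - ts (Suc k) w)" by simp
  qed
  then show ?case by simp
qed

lemma pair_tn:
  assumes "fsupp v" "fsupp w" "\<And>n. 0 \<le> v n" "\<And>n. 0 \<le> w n"
  shows "tn v + tn w \<le> ST 6 (\<lambda>n. v n + w n)"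
  by (rule LIMSEQ_le_const2[OF tendsto_add[OF ts_tendsto ts_tendsto]]) (use assms pair_ts in auto)

lemma fsupp_sum [simp]: "(\<And>q. q \<in> A \<Longrightarrow> fsupp (v q :: nat \<Rightarrow> real)) \<Longrightarrow> fsupp (\<lambda>n. \<Sum>q\<in>A. v q n)"
  by (induction A rule: infinite_finite_induct) auto

lemma sum_tn_le_ST:
  assumes "finite A" "\<And>q. q \<in> A \<Longrightarrow> fsupp (v q)" "\<And>q n. q \<in> A \<Longrightarrow> 0 \<le> v q n"
  shows "(\<Sum>q\<in>A. tn (v q)) \<le> ST (12 ^ card A) (\<lambda>n. \<Sum>q\<in>A. v q n)"
  using assms
proof (induction A rule: finite_induct)
  case (insert a A)
  let ?x = "\<lambda>n. \<Sum>q\<in>A. v q n"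
  have x: "fsupp ?x" using insert by simp
  have "(\<Sum>q\<in>insert a A. tn (v q)) \<le> tn (v a) + ST (12 ^ card A) ?x" using insert by simp
  also have "\<dots> = ST 1 (v a) + ST (12 ^ card A) ?x" using tn.S_1[of "v a"] insert by simp
  also have "\<dots> \<le> ST ((1 + 12 ^ card A) * 6) (\<lambda>n. v a n + ?x n)"
    by (rule merge_split[OF tn_lattice_seminorm tn_lattice_seminorm]) (use insert pair_tn in \<open>auto intro: sum_nonneg\<close>)
  \<comment> \<open>This is where 12 comes from: (1 + n) * 6 is at most 12 * n for n at least
    1.\<close>
  also have "\<dots> \<le> ST (12 ^ card (insert a A)) (\<lambda>n. v a n + ?x n)"
    by (rule tn.S_mono_n) (use insert in auto)
  finally show ?case using insert by simp
qed simp

text \<open>Beyond position 12^(card A), splitting into 12^(card A) pieces is admissible. So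
  finitely many nonnegative vectors far out add up as in l_1, even when their supports overlap or
  interlace.\<close>

lemma sum_tn_le:
  assumes "finite A" "\<And>q. q \<in> A \<Longrightarrow> fsupp (v q)" "\<And>q n. q \<in> A \<Longrightarrow> 0 \<le> v q n"
    "\<And>q n. q \<in> A \<Longrightarrow> v q n \<noteq> 0 \<Longrightarrow> 12 ^ card A \<le> n"
  shows "(\<Sum>q\<in>A. tn (v q)) \<le> 2 * tn (\<lambda>n. \<Sum>q\<in>A. v q n)"
proof -
  have "ST (12 ^ card A) (\<lambda>n. \<Sum>q\<in>A. v q n) \<le> 2 * tn (\<lambda>n. \<Sum>q\<in>A. v q n)"
  proof (rule tn_ge')
    fix n assume "(\<Sum>q\<in>A. v q n) \<noteq> 0"
    then obtain q where "q \<in> A" "v q n \<noteq> 0" by (meson sum.not_neutral_contains_not_neutral)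
    then show "12 ^ card A \<le> n" by (rule assms(4))
  qed (use assms in auto)
  moreover have "(\<Sum>q\<in>A. tn (v q)) \<le> ST (12 ^ card A) (\<lambda>n. \<Sum>q\<in>A. v q n)"
    by (rule sum_tn_le_ST) (use assms in auto)
  ultimately show ?thesis by simp
qed

lemma fsupp_divide [simp]: "fsupp x \<Longrightarrow> fsupp (\<lambda>n. x n / c :: real)"
  unfolding fsupp_def by (metis div_0)

subsection \<open>Compressing blocks of coordinates\<close>

definition block_sum :: "nat \<Rightarrow> (nat \<Rightarrow> real) \<Rightarrow> nat \<Rightarrow> real" where
  "block_sum m v i = (\<Sum>j<m. v (m * i + j))"

text \<open>The mass of each block of m coordinates is moved to the coordinate that f selects in it.
  Its p-th root is the vector to which the matrix b is applied once one index per block has been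
  chosen.\<close>

definition compress :: "nat \<Rightarrow> (nat \<Rightarrow> nat) \<Rightarrow> (nat \<Rightarrow> real) \<Rightarrow> nat \<Rightarrow> real" where
  "compress m f v n = (if n mod m = f (n div m) then block_sum m v (n div m) else 0)"

context
  fixes m :: nat and f :: "nat \<Rightarrow> nat"
  assumes m: "1 \<le> m" and f: "\<And>i. f i < m"
begin

private abbreviation "Z \<equiv> compress m f"

lemma block_sum_lo: "block_sum m (lo (m * i) v) i' = (if i' < i then block_sum m v i' else 0)"
proof -
  have "m * i' + j < m * i \<longleftrightarrow> i' < i" if "j < m" for j
  proof
    assume "i' < i"
    then have "m * (i' + 1) \<le> m * i" by (intro mult_le_mono) auto
    then show "m * i' + j < m * i" using that by simp
  next
    assume "m * i' + j < m * i"
    then have "m * i' < m * i" by linarith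
    then show "i' < i" using m by simp
  qed
  then show ?thesis by (auto simp: block_sum_def restr_apply)
qed

lemma div_less_cut: "n div m < i \<longleftrightarrow> n < m * i"
  using m by (simp add: div_less_iff_less_mult mult.commute)

lemma Z_lo: "Z (lo (m * i) v) = lo (m * i) (Z v)"
  by (rule ext) (simp add: compress_def block_sum_lo restr_apply div_less_cut)

lemma Z_add: "Z (\<lambda>n. v n + w n) = (\<lambda>n. Z v n + Z w n)"
  by (rule ext) (simp add: compress_def block_sum_def sum.distrib)

lemma Z_hi: "Z (hi (m * i) v) = hi (m * i) (Z v)"
proof -
  have "v = (\<lambda>n. lo (m * i) v n + hi (m * i) v n)" by (auto simp: restr_def)
  then have "Z v = (\<lambda>n. Z (lo (m * i) v) n + Z (hi (m * i) v) n)" using Z_add by metis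
  then have "Z v n = Z (lo (m * i) v) n + Z (hi (m * i) v) n" for n by (rule fun_cong)
  then have "Z v n = lo (m * i) (Z v) n + Z (hi (m * i) v) n" for n by (simp only: Z_lo)
  then have "Z (hi (m * i) v) n = Z v n - lo (m * i) (Z v) n" for n by (simp add: algebra_simps)
  then have "Z (hi (m * i) v) n = hi (m * i) (Z v) n" for n by (simp add: restr_apply)
  then show ?thesis by blast
qed

lemma fsupp_Z: assumes "fsupp v" shows "fsupp (Z v)"
proof -
  obtain M where M: "\<forall>n\<ge>M. v n = 0" using assms by (auto simp: fsupp_def)
  have "Z v n = 0" if "n \<ge> m * M" for n
  proof -
    have "M \<le> n div m" using div_less_cut[of n M] that by simp
    moreover have "n div m \<le> m * (n div m)" using m by simp
    ultimately have "M \<le> m * (n div m)" by linarith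
    then have "block_sum m v (n div m) = 0" using M by (simp add: block_sum_def)
    then show ?thesis by (simp add: compress_def)
  qed
  then show ?thesis by (auto simp: fsupp_def)
qed

text \<open>A compressed vector has at most one nonzero coordinate per block, so every cut of it
  amounts to a cut between blocks. The cut moves down by less than m, which the first conjunct
  records.\<close>

lemma Z_cut: "\<exists>i. c \<le> m * i + (m - 1) \<and> (\<forall>v. lo c (Z v) = Z (lo (m * i) v) \<and> hi c (Z v) = Z (hi (m * i) v))"
proof -
  define q r where "q = c div m" and "r = c mod m"
  have c: "c = m * q + r" "r < m" using m by (simp_all add: q_def r_def)
  define i where "i = (if f q < r then q + 1 else q)"
  have ci: "c \<le> m * i + (m - 1)" using c f[of q] by (auto simp: i_def)
  have "n < c \<longleftrightarrow> n < m * i" if n: "n mod m = f (n div m)" for n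
  proof -
    define k where "k = n div m"
    have nk: "n = m * k + f k" using n div_mult_mod_eq[of n m] by (simp add: k_def mult.commute)
    consider "k < q" | "k = q" | "q < k" by linarith
    then show ?thesis
    proof cases
      case 1
      then have "m * (k + 1) \<le> m * q" by (intro mult_le_mono) auto
      then have "n < m * q" using nk f[of k] by simp
      then show ?thesis using c by (auto simp: i_def)
    next
      case 2
      then show ?thesis using c f[of q] nk by (auto simp: i_def)
    next
      case 3
      then have "m * (q + 1) \<le> m * k" by (intro mult_le_mono) auto
      then have "m * (q + 1) \<le> n" using nk by simp
      then show ?thesis using c by (auto simp: i_def)
    qed
  qed
  then have "(Z v n = 0) \<or> (n < c \<longleftrightarrow> n < m * i)" for v n by (auto simp: compress_def)
  then have "lo c (Z v) = lo (m * i) (Z v)" "hi c (Z v) = hi (m * i) (Z v)" for v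
    unfolding restr_def by (metis lessThan_iff, metis atLeast_iff not_less)
  then show ?thesis using ci by (intro exI[of _ i]) (simp add: Z_lo Z_hi)
qed

lemma compress_split:
  assumes IH: "\<And>y. fsupp y \<Longrightarrow> (\<And>n. 0 \<le> y n) \<Longrightarrow> (\<And>n. y n \<noteq> 0 \<Longrightarrow> m \<le> n) \<Longrightarrow> ts k (Z y) \<le> 2 * ST 4 y"
  shows "fsupp y \<Longrightarrow> (\<And>n. 0 \<le> y n) \<Longrightarrow> (\<And>n. y n \<noteq> 0 \<Longrightarrow> m \<le> n) \<Longrightarrow> split_sup (ts k) s (Z y) \<le> 2 * ST (4 * s) y"
proof (induction s arbitrary: y)
  case (Suc s)
  obtain c where c: "split_sup (ts k) (Suc s) (Z y) = ts k (lo c (Z y)) + split_sup (ts k) s (hi c (Z y))"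
    using ts.S_attained[OF fsupp_Z[OF Suc.prems(1)]] by blast
  obtain i where i: "lo c (Z y) = Z (lo (m * i) y)" "hi c (Z y) = Z (hi (m * i) y)" using Z_cut by blast
  have r: "fsupp (restr A y)" "0 \<le> restr A y n" "restr A y n \<noteq> 0 \<Longrightarrow> m \<le> n" for A n
    using Suc.prems(1) Suc.prems(2)[of n] Suc.prems(3)[of n] by (auto simp: restr_apply split: if_splits)
  have "ts k (Z (lo (m * i) y)) \<le> 2 * ST 4 (lo (m * i) y)" by (rule IH) (fact r)+
  moreover have "split_sup (ts k) s (Z (hi (m * i) y)) \<le> 2 * ST (4 * s) (hi (m * i) y)" by (rule Suc.IH) (fact r)+
  moreover have "ST 4 (lo (m * i) y) + ST (4 * s) (hi (m * i) y) \<le> ST (4 + 4 * s) y"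
    by (rule tn.S_concat[OF Suc.prems(1)])
  ultimately show ?case using c i by simp
qed simp

text \<open>The bound depends neither on m nor on f, and it reproduces itself from level to level.
  Each of the s pieces becomes 4, and s is at most twice the new cut m * i', so that the 4 * s
  pieces merge into 4 by \<open>ST_group\<close> with g = 3. The resulting factor 2 is absorbed by
  the factor 1/2 in the norm.\<close>

lemma ts_compress:
  assumes "fsupp v" "\<And>n. 0 \<le> v n" "\<And>n. v n \<noteq> 0 \<Longrightarrow> m \<le> n"
  shows "ts k (Z v) \<le> 2 * ST 4 v"
proof -
  have sup: "\<bar>Z v n\<bar> \<le> 2 * ST 4 v" if v: "fsupp v" "\<And>n. 0 \<le> v n" "\<And>n. v n \<noteq> 0 \<Longrightarrow> m \<le> n" for v n
  proof -
    define i where "i = n div m"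
    let ?r = "restr {m * i..<m * i + m} v"
    have "block_sum m v i \<le> 2 * tn v"
    \<comment> \<open>Block 0 is empty by the support condition. For i at least 1 the block lies in
      [m * i, 2 * m * i), where \<open>l1_le_tn\<close> applies.\<close>
    proof (cases "i = 0")
      case True
      have "v j = 0" if "j < m" for j using v(3)[of j] that by auto
      then show ?thesis using True tn.nonneg[OF v(1)] by (simp add: block_sum_def)
    next
      case False
      have "block_sum m v i = (\<Sum>n\<in>{m * i..<m * i + m}. v n)"
        using sum.shift_bounds_nat_ivl[of v 0 "m * i" m] by (simp add: block_sum_def atLeast0LessThan add.commute)
      also have "\<dots> = (\<Sum>n<m * i + m. \<bar>?r n\<bar>)"
        by (rule sum.mono_neutral_cong_left) (auto simp: restr_apply v)
      also have "\<dots> = l1 ?r" by (rule l1_eq_sum[symmetric]) (simp add: restr_apply)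
      also have "\<dots> \<le> 2 * tn ?r"
      proof (rule l1_le_tn[of _ "m * i"])
        have mi: "m \<le> m * i" "1 \<le> m * i" using False m by simp_all
        show "m * i \<le> n \<and> n < m * i + m * i" if "?r n \<noteq> 0" for n
        proof -
          have "m * i \<le> n" "n < m * i + m" using that by (auto simp: restr_apply split: if_splits)
          then show ?thesis using mi by linarith
        qed
        show "1 \<le> m * i" by fact
      qed (simp add: v)
      also have "tn ?r \<le> tn v" by (rule tn.N_restr[OF v(1)])
      finally show ?thesis by simp
    qed
    moreover have "0 \<le> block_sum m v i" using v by (simp add: block_sum_def sum_nonneg)
    moreover have "tn v \<le> ST 4 v" using tn.S_mono_n[OF v(1), of "Suc 0" 4] tn.S_1[OF v(1)] by simp
    moreover have "0 \<le> ST 4 v" by (rule tn.S_nonneg[OF v(1)])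
    ultimately show ?thesis by (simp add: compress_def i_def)
  qed
  show ?thesis using assms
  proof (induction k arbitrary: v)
    case 0
    show ?case unfolding tsirelson_seq.simps
      by (rule cSUP_least) (use sup[OF 0] in auto)
  next
    case (Suc k)
    show ?case
    proof (rule ts_le[OF fsupp_Z[OF Suc.prems(1)]])
      show "\<bar>Z v n\<bar> \<le> 2 * ST 4 v" for n by (rule sup[OF Suc.prems])
      fix s :: nat assume s: "1 \<le> s"
      obtain i where i: "s \<le> m * i + (m - 1)" "hi s (Z v) = Z (hi (m * i) v)" using Z_cut by blast
      \<comment> \<open>Block 0 carries no mass, so a cut at 0 may be moved to m. Then s is at most
        2 * (m * i').\<close>
      define i' where "i' = max i 1"
      have i': "1 \<le> m * i'" "s \<le> 2 * (m * i')"
      proof -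
        have "m * 1 \<le> m * i'" "m * i \<le> m * i'" by (rule mult_le_mono; simp add: i'_def)+
        then show "1 \<le> m * i'" "s \<le> 2 * (m * i')" using m i(1) by linarith+
      qed
      have hv: "hi (m * i) v = hi (m * i') v"
      proof (cases "i = 0")
        case True
        have "v j = 0" if "j < m" for j using Suc.prems(3)[of j] that by auto
        then show ?thesis using True by (auto simp: i'_def restr_def)
      next
        case False
        then have "i' = i" by (simp add: i'_def)
        then show ?thesis by simp
      qed
      let ?y = "hi (m * i') v"
      have y: "fsupp ?y" "0 \<le> ?y n" "?y n \<noteq> 0 \<Longrightarrow> m \<le> n" for n
        using Suc.prems(1) Suc.prems(2)[of n] Suc.prems(3)[of n] by (auto simp: restr_apply split: if_splits)
      have "split_sup (ts k) s (Z ?y) \<le> 2 * ST (4 * s) ?y"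
      proof (rule compress_split)
        show "ts k (Z y) \<le> 2 * ST 4 y"
          if "fsupp y" "\<And>n. 0 \<le> y n" "\<And>n. y n \<noteq> 0 \<Longrightarrow> m \<le> n" for y by (rule Suc.IH[OF that])
      qed (fact y)+
      also have "ST (4 * s) ?y \<le> 2 * ST (Suc 3) ?y"
      proof (rule ST_group[of _ "m * i'"])
        show "4 * s \<le> 2 ^ 3 * (m * i')" using i'(2) by (simp add: mult.commute[of m])
      qed (use i' y(1) in \<open>auto simp: restr_apply split: if_splits\<close>)
      also have "ST (Suc 3) ?y \<le> ST 4 v" using tn.S_restr[OF Suc.prems(1), of 4] by simp
      finally show "split_sup (ts k) s (hi s (Z v)) \<le> 2 * (2 * ST 4 v)" using i(2) hv by simp
    qed
  qed
qed

lemma tn_compress: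
  assumes "fsupp v" "\<And>n. 0 \<le> v n" "\<And>n. v n \<noteq> 0 \<Longrightarrow> m \<le> n"
  shows "tn (Z v) \<le> 8 * tn v"
proof -
  have "tn (Z v) \<le> 2 * ST 4 v" by (rule tn_le_if_ts[OF fsupp_Z[OF assms(1)]]) (rule ts_compress[OF assms])
  then show ?thesis using tn.S_le_mult[OF assms(1), of 4] by simp
qed

end

subsection \<open>Averages of small norm\<close>

definition averages :: "real \<Rightarrow> bool" where
  "averages A \<longleftrightarrow> (\<forall>n. \<exists>u. fsupp u \<and> (\<forall>i. 0 \<le> u i) \<and> (\<forall>i. u i \<noteq> 0 \<longrightarrow> n \<le> i) \<and> l1 u = 1 \<and> tn u \<le> A)"

lemma averages_1: "averages 1"
  unfolding averages_def
proof
  fix n :: nat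
  let ?u = "\<lambda>i. if i = n then 1 else 0 :: real"
  have u: "fsupp ?u" by (auto simp: fsupp_def intro!: exI[of _ "Suc n"])
  have "l1 ?u = (\<Sum>i<Suc n. \<bar>?u i\<bar>)" by (rule l1_eq_sum) auto
  also have "\<dots> = (\<Sum>i<Suc n. ?u i)" by (rule sum.cong) auto
  also have "\<dots> = 1" by (simp del: sum.lessThan_Suc add: sum.delta)
  finally have "l1 ?u = 1" .
  then show "\<exists>u. fsupp u \<and> (\<forall>i. 0 \<le> u i) \<and> (\<forall>i. u i \<noteq> 0 \<longrightarrow> n \<le> i) \<and> l1 u = 1 \<and> tn u \<le> 1"
    using u tn.le_l1[OF u] by (intro exI[of _ ?u]) auto
qed

text \<open>The factor counts incidences: s successive intervals and k successive vectors meet in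
  fewer than k + s pairs, and each restriction has norm at most A. One more vector in front adds
  one.\<close>

lemma ST_prepend:
  fixes A :: real
  assumes "0 \<le> A" "fsupp z" "\<And>i. z i \<noteq> 0 \<Longrightarrow> M \<le> i" "\<And>s. ST s z \<le> (real k + real s) * A"
  shows "fsupp x \<Longrightarrow> tn x \<le> A \<Longrightarrow> (\<And>i. x i \<noteq> 0 \<Longrightarrow> i < M) \<Longrightarrow> ST s (\<lambda>i. x i + z i) \<le> (real k + 1 + real s) * A"
proof (induction s arbitrary: x)
  case 0
  then show ?case using assms(1) by simp
next
  case (Suc s)
  have zM: "i < M \<Longrightarrow> z i = 0" for i using assms(3)[of i] by force
  have xM: "M \<le> i \<Longrightarrow> x i = 0" for i using Suc.prems(3)[of i] by force
  show ?case
  proof (rule tn.S_le)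
    fix c
    show "tn (lo c (\<lambda>i. x i + z i)) + ST s (hi c (\<lambda>i. x i + z i)) \<le> (real k + 1 + real (Suc s)) * A"
    proof (cases "c \<le> M")
      case True
      have e: "lo c (\<lambda>i. x i + z i) = lo c x" "hi c (\<lambda>i. x i + z i) = (\<lambda>i. hi c x i + z i)"
        using True zM by (auto simp: restr_def)
      have r: "tn (restr B x) \<le> A" for B using tn.N_restr[OF Suc.prems(1), of B] Suc.prems(2) by simp
      have "ST s (\<lambda>i. hi c x i + z i) \<le> (real k + 1 + real s) * A"
      proof (rule Suc.IH)
        show "i < M" if "hi c x i \<noteq> 0" for i
          using that Suc.prems(3)[of i] by (auto simp: restr_apply split: if_splits)
      qed (use Suc.prems(1) r in simp_all)
      then show ?thesis using r[of "{..<c}"] unfolding e by (simp add: algebra_simps)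
    next
      case False
      have e: "lo c (\<lambda>i. x i + z i) = (\<lambda>i. x i + lo c z i)" "hi c (\<lambda>i. x i + z i) = hi c z"
        using False xM by (auto simp: restr_def)
      have "tn (\<lambda>i. x i + lo c z i) \<le> A + tn (lo c z)"
        using tn.tri[OF Suc.prems(1), of "lo c z"] Suc.prems(2) assms(2) by simp
      moreover have "tn (lo c z) + ST s (hi c z) \<le> (real k + real (Suc s)) * A"
        using tn.S_ge[OF assms(2), of c s] assms(4)[of "Suc s"] by simp
      ultimately show ?thesis unfolding e by (simp add: algebra_simps)
    qed
  qed
qed

text \<open>The vector z is a sum of k successive averages. The last conjunct says that splitting
  into s pieces, with s much smaller than k, gains little over the triangle inequality.\<close>

lemma averages_spread:
  assumes "averages A" "0 \<le> A"
  shows "\<exists>z. fsupp z \<and> (\<forall>i. 0 \<le> z i) \<and> (\<forall>i. z i \<noteq> 0 \<longrightarrow> n \<le> i) \<and> l1 z = real k \<and> tn z \<le> real k * A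
     \<and> (\<forall>s. ST s z \<le> (real k + real s) * A)"
proof (induction k arbitrary: n)
  case 0
  show ?case by (intro exI[of _ "\<lambda>i. 0"]) (use assms in auto)
next
  case (Suc k)
  obtain x where x: "fsupp x" "\<And>i. 0 \<le> x i" "\<And>i. x i \<noteq> 0 \<Longrightarrow> n \<le> i" "l1 x = 1" "tn x \<le> A"
    using assms(1) unfolding averages_def by blast
  obtain M0 where M0: "\<forall>i\<ge>M0. x i = 0" using x(1) by (auto simp: fsupp_def)
  define M where "M = max n M0"
  obtain z where z: "fsupp z" "\<And>i. 0 \<le> z i" "\<And>i. z i \<noteq> 0 \<Longrightarrow> M \<le> i" "l1 z = real k" "tn z \<le> real k * A"
     "\<And>s. ST s z \<le> (real k + real s) * A"
    using Suc.IH[of M] by blast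
  let ?w = "\<lambda>i. x i + z i"
  have "ST s ?w \<le> (real k + 1 + real s) * A" for s
  proof (rule ST_prepend[where M = M])
    show "i < M" if "x i \<noteq> 0" for i
    proof (rule ccontr)
      assume "\<not> i < M"
      then have "M0 \<le> i" by (simp add: M_def)
      then show False using M0 that by simp
    qed
  qed (use assms x z in auto)
  moreover have "n \<le> i" if "?w i \<noteq> 0" for i
    using that x(3)[of i] z(3)[of i] by (cases "x i = 0") (auto simp: M_def)
  moreover have "l1 ?w = real (Suc k)" using l1_add[OF x(1) z(1) x(2) z(2)] x z by simp
  moreover have "tn ?w \<le> real (Suc k) * A" using tn.tri[OF x(1) z(1)] x(5) z(5) by (simp add: algebra_simps)
  ultimately show ?case using x z by (intro exI[of _ ?w]) (auto simp: add.commute)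
qed

text \<open>Take the mean of \<open>x\<close> and of an average of \<open>k\<close> successive vectors supported after \<open>x\<close>, all of norm at most \<open>A\<close>.
  Admissible sets that meet the support of \<open>x\<close> are too few to split more than a small proportion of the later
  vectors, and otherwise \<open>x\<close> does not contribute.\<close>
lemma averages_contract:
  assumes "averages A" "0 \<le> A"
  shows "averages (7 / 8 * A)"
  unfolding averages_def
proof
  fix n
  obtain x where x: "fsupp x" "\<And>i. 0 \<le> x i" "\<And>i. x i \<noteq> 0 \<Longrightarrow> n \<le> i" "l1 x = 1" "tn x \<le> A"
    using assms(1) unfolding averages_def by blast
  obtain M0 where M0: "\<forall>i\<ge>M0. x i = 0" using x(1) by (auto simp: fsupp_def)
  define M where "M = max n (max 1 M0)"
  \<comment> \<open>For s at most M, the pieces that can reach x raise the bound k * A to at most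
    3/2 * k * A. The mean then gives (2 + 3/2) / 2 = 7/4, and the factor 1/2 in the norm turns it
    into 7/8.\<close>
  define k where "k = 2 * M"
  have k: "real k > 0" by (simp add: k_def M_def)
  obtain z where z: "fsupp z" "\<And>i. 0 \<le> z i" "\<And>i. z i \<noteq> 0 \<Longrightarrow> M \<le> i" "l1 z = real k" "tn z \<le> real k * A"
     "\<And>s. ST s z \<le> (real k + real s) * A"
    using averages_spread[OF assms, of M k] by blast
  let ?y = "\<lambda>i. 1 / real k * z i"
  let ?u = "\<lambda>i. 1 / 2 * (x i + ?y i)"
  have y: "fsupp ?y" "\<And>i. 0 \<le> ?y i" "l1 ?y = 1"
    using fsupp_cmult[OF z(1), of "1 / real k"] z(2,4) k l1_cmult[OF z(1), of "1 / real k"] by simp_all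
  have y4: "tn ?y \<le> A"
  proof -
    have "tn ?y = 1 / real k * tn z" by (rule tn_cmult[OF z(1)]) simp
    also have "\<dots> \<le> 1 / real k * (real k * A)" by (rule mult_left_mono[OF z(5)]) simp
    finally show ?thesis using k by simp
  qed
  have u: "fsupp ?u" "\<And>i. 0 \<le> ?u i"
    using fsupp_cmult[OF fsupp_add[OF x(1) y(1)], of "1 / 2"] x(2) z(2) by simp_all
  have "l1 ?u = 1" using l1_cmult[of "\<lambda>i. x i + ?y i" "1 / 2"] l1_add[OF x(1) y(1) x(2) y(2)] x y by simp
  moreover have "n \<le> i" if "?u i \<noteq> 0" for i
    using that x(3)[of i] z(3)[of i] by (cases "x i = 0") (auto simp: M_def)
  moreover have "tn ?u \<le> 7 / 8 * A"
  proof (rule tn_le[OF u(1)])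
    fix i
    have xi: "x i \<le> A" "?y i \<le> A" using abs_le_tn[OF x(1), of i] abs_le_tn[OF y(1), of i] x(5) y4 by linarith+
    have "x i = 0 \<or> ?y i = 0" using M0 z(3)[of i] by (cases "i < M") (auto simp: M_def)
    then have "x i + ?y i \<le> A" using xi by auto
    then show "\<bar>?u i\<bar> \<le> 7 / 8 * A" using u(2)[of i] assms(2) by simp
  next
    fix s :: nat assume s: "1 \<le> s"
    have sc: "ST s (\<lambda>i. c * w i) = c * ST s w" if "fsupp w" "0 \<le> c" for c w
      using that(1)
    proof (induction s arbitrary: w)
      case (Suc s)
      have e: "restr B (\<lambda>i. c * w i) = (\<lambda>i. c * restr B w i)" for B by (auto simp: restr_def)
      have f: "fsupp (\<lambda>i. c * w i)" using Suc.prems by simp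
      have c: "tn (lo d (\<lambda>i. c * w i)) + ST s (hi d (\<lambda>i. c * w i)) = c * (tn (lo d w) + ST s (hi d w))" for d
        unfolding e using Suc.IH[of "hi d w"] tn_cmult[of "lo d w" c] Suc.prems that(2) by (simp add: algebra_simps)
      show ?case
      proof (rule antisym)
        show "ST (Suc s) (\<lambda>i. c * w i) \<le> c * ST (Suc s) w"
          by (rule tn.S_le) (use c tn.S_ge[OF Suc.prems] that in \<open>auto intro: mult_left_mono\<close>)
        obtain d where "ST (Suc s) w = tn (lo d w) + ST s (hi d w)" using tn.S_attained[OF Suc.prems] by blast
        then show "c * ST (Suc s) w \<le> ST (Suc s) (\<lambda>i. c * w i)" using c tn.S_ge[OF f, of d s] by simp
      qed
    qed simp
    have hu: "hi s ?u = (\<lambda>i. 1 / 2 * (hi s x i + 1 / real k * hi s z i))" by (auto simp: restr_def)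
    have "ST s (hi s ?u) = 1 / 2 * ST s (\<lambda>i. hi s x i + 1 / real k * hi s z i)"
      unfolding hu by (rule sc) (use x z in simp_all)
    also have "\<dots> \<le> 1 / 2 * (ST s (hi s x) + ST s (\<lambda>i. 1 / real k * hi s z i))"
      by (intro mult_left_mono tn.S_tri) (use x z in simp_all)
    also have "ST s (\<lambda>i. 1 / real k * hi s z i) = 1 / real k * ST s (hi s z)"
      by (rule sc) (use z in simp_all)
    finally have S: "ST s (hi s ?u) \<le> 1 / 2 * (ST s (hi s x) + 1 / real k * ST s (hi s z))" .
    have "ST s (hi s x) + 1 / real k * ST s (hi s z) \<le> 7 / 2 * A"
    proof (cases "s \<le> M")
      case True
      have "ST s (hi s x) \<le> 2 * A" using tn_ge[OF x(1) s] x(5) by simp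
      moreover have "ST s (hi s z) \<le> (real k + real s) * A" using z(6)[of s] tn.S_restr[OF z(1), of s "{s..}"] by simp
      moreover have "(real k + real s) * A \<le> (3 / 2 * real k) * A"
        using True assms(2) by (intro mult_right_mono) (simp_all add: k_def)
      ultimately have "ST s (hi s x) \<le> 2 * A" "ST s (hi s z) \<le> real k * (3 / 2 * A)" by (simp_all add: algebra_simps)
      moreover from this(2) have "1 / real k * ST s (hi s z) \<le> 3 / 2 * A" using k by (simp add: field_simps)
      ultimately show ?thesis by simp
    next
      case False
      then have "hi s x = (\<lambda>i. 0)" using M0 by (auto simp: restr_def M_def)
      then have "ST s (hi s x) = 0" by simp
      moreover have "ST s (hi s z) \<le> real k * (2 * A)" using tn_ge[OF z(1) s] z(5) by simp
      then have "1 / real k * ST s (hi s z) \<le> 2 * A" using k by (simp add: field_simps)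
      ultimately show ?thesis using assms(2) by linarith
    qed
    then have "1 / 2 * (ST s (hi s x) + 1 / real k * ST s (hi s z)) \<le> 1 / 2 * (7 / 2 * A)"
      by (rule mult_left_mono) simp
    also have "\<dots> = 2 * (7 / 8 * A)" by simp
    finally show "ST s (hi s ?u) \<le> 2 * (7 / 8 * A)" by (rule order_trans[OF S])
  qed
  ultimately show "\<exists>u. fsupp u \<and> (\<forall>i. 0 \<le> u i) \<and> (\<forall>i. u i \<noteq> 0 \<longrightarrow> n \<le> i) \<and> l1 u = 1 \<and> tn u \<le> 7 / 8 * A"
    using u by (intro exI[of _ ?u]) auto
qed

lemma small_averages:
  assumes "0 < e"
  shows "\<exists>u. fsupp u \<and> (\<forall>i. 0 \<le> u i) \<and> (\<forall>i. u i \<noteq> 0 \<longrightarrow> n \<le> i) \<and> l1 u = 1 \<and> tn u \<le> e"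
proof -
  have av: "averages ((7 / 8) ^ j)" for j :: nat
    by (induction j) (use averages_1 averages_contract in auto)
  obtain j :: nat where "(7 / 8 :: real) ^ j < e" using real_arch_pow_inv[OF assms, of "7/8"] by auto
  then show ?thesis using av[of j] unfolding averages_def by (meson less_imp_le order_trans)
qed

subsection \<open>The \<open>p\<close>-convexification\<close>

lemma powr_convex_nonneg:
  fixes a b t p :: real
  assumes "0 \<le> a" "0 \<le> b" "0 \<le> t" "t \<le> 1" "1 \<le> p"
  shows "(t * a + (1 - t) * b) powr p \<le> t * a powr p + (1 - t) * b powr p"
proof -
  have sub: "(s * c) powr p \<le> s * c powr p" if "0 \<le> s" "s \<le> 1" "0 \<le> c" for s c :: real
  proof -
    have "s powr p \<le> s" using that assms(5) powr_mono'[of 1 p s] by simp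
    then show ?thesis using that by (auto simp: powr_mult intro!: mult_right_mono)
  qed
  consider "a = 0" | "b = 0" | "a > 0" "b > 0" using assms by linarith
  then show ?thesis
  proof cases
    case 1
    then show ?thesis using sub[of "1 - t" b] assms by simp
  next
    case 2
    then show ?thesis using sub[of t a] assms by simp
  next
    case 3
    then show ?thesis
      using convex_onD[OF powr_convex[OF assms(5)], of "1 - t" a b] assms by simp
  qed
qed

text \<open>The exponents 1 - 1/p and 1/p replace a conjugate pair, so that p = 1 is covered. The
  proof sums Young's inequality for the normalized sequences.\<close>

lemma weighted_Holder:
  fixes u t :: "'i \<Rightarrow> real"
  assumes "finite F" "\<And>q. q \<in> F \<Longrightarrow> 0 \<le> u q" "\<And>q. q \<in> F \<Longrightarrow> 0 \<le> t q" "1 \<le> p" "0 < sum u F"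
  shows "(\<Sum>q\<in>F. u q powr (1 - 1 / p) * t q) \<le> sum u F powr (1 - 1 / p) * (\<Sum>q\<in>F. t q powr p) powr (1 / p)"
proof (cases "(\<Sum>q\<in>F. t q powr p) = 0")
  case True
  then have "\<forall>q\<in>F. t q = 0" using assms(1) by (subst (asm) sum_nonneg_eq_0_iff) auto
  then show ?thesis by simp
next
  case False
  define U T where "U = sum u F" and "T = (\<Sum>q\<in>F. t q powr p)"
  have T: "T > 0" using False sum_nonneg[of F "\<lambda>q. t q powr p"] by (simp add: T_def less_le)
  have U: "U > 0" using assms by (simp add: U_def)
  have le: "u q powr (1 - 1 / p) * t q \<le> (U powr (1 - 1 / p) * T powr (1 / p)) * ((1 - 1 / p) * (u q / U) + 1 / p * (t q powr p / T))"
    if q: "q \<in> F" for q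
  proof (cases "u q = 0 \<or> t q = 0")
    case True
    then show ?thesis using assms q U T by auto
  next
    case False
    then have uq: "u q > 0" "t q > 0" using assms(2,3)[OF q] by auto
    have "(u q / U) powr (1 - 1 / p) * (t q powr p / T) powr (1 / p) \<le> (1 - 1 / p) * (u q / U) + 1 / p * (t q powr p / T)"
      by (rule Youngs_inequality_0) (use uq U T assms(4) in auto)
    moreover have "(u q / U) powr (1 - 1 / p) * (t q powr p / T) powr (1 / p)
        = u q powr (1 - 1 / p) * t q / (U powr (1 - 1 / p) * T powr (1 / p))"
      using uq U T assms(4) by (simp add: powr_divide powr_powr)
    ultimately show ?thesis using U T by (simp add: field_simps)
  qed
  have "(\<Sum>q\<in>F. u q powr (1 - 1 / p) * t q)
     \<le> (\<Sum>q\<in>F. (U powr (1 - 1 / p) * T powr (1 / p)) * ((1 - 1 / p) * (u q / U) + 1 / p * (t q powr p / T)))"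
    by (rule sum_mono) (rule le)
  also have "\<dots> = (U powr (1 - 1 / p) * T powr (1 / p)) * ((1 - 1 / p) * (sum u F / U) + 1 / p * (T / T))"
    unfolding T_def by (simp add: sum_distrib_left[symmetric] sum.distrib sum_divide_distrib[symmetric])
  also have "\<dots> = U powr (1 - 1 / p) * T powr (1 / p)" using U T by (simp add: U_def)
  finally show ?thesis by (simp add: U_def T_def)
qed

text \<open>The norm of T^(p) on a finite set S of coordinates. The matrix estimates are all made
  with \<open>nu\<close>; the completed space appears only in the last part.\<close>

definition nu :: "real \<Rightarrow> nat set \<Rightarrow> (nat \<Rightarrow> 'a::real_normed_vector) \<Rightarrow> real" where
  "nu p S x = tn (restr S (\<lambda>n. norm (x n) powr p)) powr (1 / p)"

context
  fixes p :: real and S :: "nat set"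
  assumes p: "1 \<le> p" and S: "finite S"
begin

lemma fsupp_S [simp]: "fsupp (restr S x)"
  by (rule fsupp_restr_finite[OF S])

lemma nu_powr: "nu p S x powr p = tn (restr S (\<lambda>n. norm (x n) powr p))"
  using p tn.nonneg[of "restr S (\<lambda>n. norm (x n) powr p)"] by (simp add: nu_def powr_powr)

lemma nu_nonneg: "0 \<le> nu p S x"
  by (simp add: nu_def)

lemma nu_mono: "(\<And>n. n \<in> S \<Longrightarrow> norm (x n) \<le> norm (y n)) \<Longrightarrow> nu p S x \<le> nu p S y"
  unfolding nu_def using p
  by (intro powr_mono2 tn.mono tn.nonneg) (auto simp: restr_apply intro: powr_mono2)

lemma nu_cong: "(\<And>n. n \<in> S \<Longrightarrow> norm (x n) = norm (y n)) \<Longrightarrow> nu p S x = nu p S y"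
  by (intro antisym nu_mono) auto

lemma nu_scale:
  assumes "0 \<le> c" "\<And>n. n \<in> S \<Longrightarrow> norm (y n) = c * norm (x n)" shows "nu p S y = c * nu p S x"
proof -
  have "restr S (\<lambda>n. norm (y n) powr p) = (\<lambda>n. c powr p * restr S (\<lambda>n. norm (x n) powr p) n)"
    using assms by (auto simp: restr_def powr_mult)
  then have "tn (restr S (\<lambda>n. norm (y n) powr p)) = c powr p * tn (restr S (\<lambda>n. norm (x n) powr p))"
    using tn_cmult[of "restr S (\<lambda>n. norm (x n) powr p)" "c powr p"] by simp
  then show ?thesis using p assms(1) by (simp add: nu_def powr_mult powr_powr tn.nonneg)
qed

lemma norm_le_nu: "i \<in> S \<Longrightarrow> norm (x i) \<le> nu p S x"
proof -
  assume i: "i \<in> S"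
  have "norm (x i) powr p \<le> tn (restr S (\<lambda>n. norm (x n) powr p))"
    using abs_le_tn[of "restr S (\<lambda>n. norm (x n) powr p)" i] i by (simp add: restr_apply)
  then have "(norm (x i) powr p) powr (1 / p) \<le> nu p S x"
    unfolding nu_def using p by (intro powr_mono2) auto
  then show ?thesis using p by (simp add: powr_powr)
qed

lemma nu_tri: "nu p S (\<lambda>n. x n + y n) \<le> nu p S x + nu p S y"
proof -
  define A B where "A = nu p S x" and "B = nu p S y"
  consider "A = 0" | "B = 0" | "A > 0" "B > 0" using nu_nonneg[of x] nu_nonneg[of y] by (auto simp: A_def B_def less_le)
  then show ?thesis
  proof cases
    case 1
    then have "x n = 0" if "n \<in> S" for n using norm_le_nu[OF that, of x] by (simp add: A_def)
    then show ?thesis using nu_cong[of "\<lambda>n. x n + y n" y] nu_nonneg[of x] by simp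
  next
    case 2
    then have "y n = 0" if "n \<in> S" for n using norm_le_nu[OF that, of y] by (simp add: B_def)
    then show ?thesis using nu_cong[of "\<lambda>n. x n + y n" x] nu_nonneg[of y] by simp
  next
    case 3
    \<comment> \<open>Convexity is used for the normalized vectors x / A and y / B with weights A /
      C and B / C. The constants c and d are such that the two terms add up to C^p.\<close>
    define C t where "C = A + B" and "t = A / C"
    have C: "C > 0" "t > 0" "t < 1" "1 - t = B / C" using 3 by (auto simp: C_def t_def field_simps)
    define c d where "c = t * (C / A) powr p" and "d = (1 - t) * (C / B) powr p"
    have cd: "0 \<le> c" "0 \<le> d" using C 3 by (auto simp: c_def d_def)
    let ?X = "restr S (\<lambda>n. norm (x n) powr p)" and ?Y = "restr S (\<lambda>n. norm (y n) powr p)"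
    have pt: "norm (x n + y n) powr p \<le> c * norm (x n) powr p + d * norm (y n) powr p" for n
    proof -
      have "norm (x n + y n) powr p \<le> (norm (x n) + norm (y n)) powr p"
        using p by (intro powr_mono2 norm_triangle_ineq) auto
      also have "norm (x n) + norm (y n) = t * (C / A * norm (x n)) + (1 - t) * (C / B * norm (y n))"
        using 3 C by (simp add: t_def)
      also have "\<dots> powr p \<le> t * (C / A * norm (x n)) powr p + (1 - t) * (C / B * norm (y n)) powr p"
        by (rule powr_convex_nonneg) (use 3 C p in auto)
      also have "(C / A * norm (x n)) powr p = (C / A) powr p * norm (x n) powr p"
        by (rule powr_mult)
      also have "(C / B * norm (y n)) powr p = (C / B) powr p * norm (y n) powr p"
        by (rule powr_mult)
      finally show ?thesis unfolding c_def d_def mult.assoc .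
    qed
    have "tn (restr S (\<lambda>n. norm (x n + y n) powr p)) \<le> tn (\<lambda>n. c * ?X n + d * ?Y n)"
    proof (rule tn.mono)
      show "fsupp (\<lambda>n. c * ?X n + d * ?Y n)" by simp
      show "\<bar>restr S (\<lambda>n. norm (x n + y n) powr p) n\<bar> \<le> \<bar>c * ?X n + d * ?Y n\<bar>" for n
        using pt[of n] cd by (simp add: restr_apply)
    qed
    also have "\<dots> \<le> tn (\<lambda>n. c * ?X n) + tn (\<lambda>n. d * ?Y n)" by (rule tn.tri) auto
    also have "\<dots> = c * A powr p + d * B powr p"
      using cd by (simp add: tn_cmult A_def B_def nu_powr)
    also have "\<dots> = t * C powr p + (1 - t) * C powr p" using 3 C by (simp add: c_def d_def powr_divide)
    also have "\<dots> = C powr p" by (simp add: algebra_simps)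
    finally have "nu p S (\<lambda>n. x n + y n) \<le> (C powr p) powr (1 / p)"
      unfolding nu_def using p by (intro powr_mono2 tn.nonneg) auto
    then show ?thesis using p C by (simp add: powr_powr C_def A_def B_def)
  qed
qed

lemma nu_zero: "(\<And>n. n \<in> S \<Longrightarrow> x n = 0) \<Longrightarrow> nu p S x = 0"
  using nu_scale[of 0 x x] by simp

lemma nu_sum: "finite Q \<Longrightarrow> nu p S (\<lambda>n. \<Sum>q\<in>Q. x q n) \<le> (\<Sum>q\<in>Q. nu p S (x q))"
proof (induction Q rule: finite_induct)
  case empty
  then show ?case by (simp add: nu_zero)
next
  case (insert a Q)
  then show ?case using nu_tri[of "x a" "\<lambda>n. \<Sum>q\<in>Q. x q n"] by simp
qed

text \<open>The l_1 behaviour of \<open>sum_tn_le\<close>, rescaled by p: far out, T^(p) satisfies a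
  lower p-estimate with a constant independent of the number of vectors. The matrix estimates use
  the position \<open>12 ^ card\<close> only through this lemma.\<close>

lemma sum_nu_powr_le:
  fixes x :: "'i \<Rightarrow> nat \<Rightarrow> 'a::real_normed_vector" and y :: "nat \<Rightarrow> 'b::real_normed_vector"
  assumes "finite Q" "S \<subseteq> {12 ^ card Q..}" "\<And>n. n \<in> S \<Longrightarrow> (\<Sum>q\<in>Q. norm (x q n) powr p) \<le> norm (y n) powr p"
  shows "(\<Sum>q\<in>Q. nu p S (x q) powr p) \<le> 2 * nu p S y powr p"
proof -
  have "(\<Sum>q\<in>Q. tn (restr S (\<lambda>n. norm (x q n) powr p))) \<le> 2 * tn (\<lambda>n. \<Sum>q\<in>Q. restr S (\<lambda>n. norm (x q n) powr p) n)"
  proof (rule sum_tn_le)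
    show "12 ^ card Q \<le> n" if "restr S (\<lambda>n. norm (x q n) powr p) n \<noteq> 0" for q n
      using that assms(2) by (auto simp: restr_apply split: if_splits)
  qed (simp_all add: assms(1) restr_apply)
  also have "tn (\<lambda>n. \<Sum>q\<in>Q. restr S (\<lambda>n. norm (x q n) powr p) n) \<le> tn (restr S (\<lambda>n. norm (y n) powr p))"
  proof (rule tn.mono)
    show "\<bar>\<Sum>q\<in>Q. restr S (\<lambda>n. norm (x q n) powr p) n\<bar> \<le> \<bar>restr S (\<lambda>n. norm (y n) powr p) n\<bar>" for n
      using assms(3)[of n] by (auto simp: restr_apply sum_nonneg)
  qed simp
  finally show ?thesis by (simp add: nu_powr)
qed

end

subsection \<open>Random signs and random selections\<close>

definition signed :: "'i set \<Rightarrow> 'i \<Rightarrow> real" where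
  "signed s i = (if i \<in> s then 1 else -1)"

lemma sum_Pow_insert:
  assumes "finite I" "a \<notin> I"
  shows "(\<Sum>s\<in>Pow (insert a I). g s :: real) = (\<Sum>s\<in>Pow I. g s + g (insert a s))"
proof -
  have "(\<Sum>s\<in>Pow (insert a I). g s) = (\<Sum>s\<in>Pow I. g s) + (\<Sum>s\<in>insert a ` Pow I. g s)"
    unfolding Pow_insert by (rule sum.union_disjoint) (use assms in auto)
  also have "(\<Sum>s\<in>insert a ` Pow I. g s) = (\<Sum>s\<in>Pow I. g (insert a s))"
    by (rule sum.reindex_cong[of "insert a"]) (use assms in \<open>auto simp: inj_on_def\<close>)
  finally show ?thesis by (simp add: sum.distrib)
qed

text \<open>The induction pairs s with \<open>insert a s\<close>: terms of odd degree in z a cancel,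
  and in the fourth moment the square of the inner product is bounded by Cauchy-Schwarz. Inner
  products make the real and the complex case one.\<close>

lemma rademacher_moments:
  fixes z :: "'i \<Rightarrow> 'a::real_inner"
  assumes "finite I"
  shows "(\<Sum>s\<in>Pow I. (norm (\<Sum>i\<in>I. signed s i *\<^sub>R z i))\<^sup>2) = 2 ^ card I * (\<Sum>i\<in>I. (norm (z i))\<^sup>2)" (is "?A I = _")
    and "(\<Sum>s\<in>Pow I. (norm (\<Sum>i\<in>I. signed s i *\<^sub>R z i)) ^ 4) \<le> 2 ^ card I * (3 * (\<Sum>i\<in>I. (norm (z i))\<^sup>2)\<^sup>2)" (is "?B I \<le> _")
  using assms
proof (induction I rule: finite_induct)
  case (insert a I)
  let ?S = "\<lambda>s. \<Sum>i\<in>I. signed s i *\<^sub>R z i" and ?Q = "\<Sum>i\<in>I. (norm (z i))\<^sup>2"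
  have S: "(\<Sum>i\<in>insert a I. signed s i *\<^sub>R z i) = ?S s - z a"
      "(\<Sum>i\<in>insert a I. signed (insert a s) i *\<^sub>R z i) = ?S s + z a" if "s \<in> Pow I" for s
  proof -
    have "(\<Sum>i\<in>I. signed (insert a s) i *\<^sub>R z i) = ?S s"
      by (rule sum.cong) (use insert in \<open>auto simp: signed_def\<close>)
    then show "(\<Sum>i\<in>insert a I. signed (insert a s) i *\<^sub>R z i) = ?S s + z a"
      using insert by (simp add: signed_def add.commute)
    show "(\<Sum>i\<in>insert a I. signed s i *\<^sub>R z i) = ?S s - z a"
      using insert that by (auto simp: signed_def)
  qed
  have n2: "(norm (w - z a))\<^sup>2 + (norm (w + z a))\<^sup>2 = 2 * ((norm w)\<^sup>2 + (norm (z a))\<^sup>2)" for w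
    by (simp add: power2_norm_eq_inner inner_diff inner_add algebra_simps)
  have n4: "(norm (w - z a)) ^ 4 + (norm (w + z a)) ^ 4 \<le> 2 * ((norm w) ^ 4 + 6 * (norm w)\<^sup>2 * (norm (z a))\<^sup>2 + (norm (z a)) ^ 4)" for w
  proof -
    define x y r where "x = (norm w)\<^sup>2" and "y = (norm (z a))\<^sup>2" and "r = inner w (z a)"
    have e: "(norm (w - z a))\<^sup>2 = x + y - 2 * r" "(norm (w + z a))\<^sup>2 = x + y + 2 * r"
      by (simp_all add: power2_norm_eq_inner inner_diff inner_add inner_commute x_def y_def r_def algebra_simps)
    have "\<bar>r\<bar> \<le> norm w * norm (z a)" unfolding r_def by (rule Cauchy_Schwarz_ineq2)
    then have "r\<^sup>2 \<le> x * y" unfolding x_def y_def power_mult_distrib[symmetric] by (metis abs_ge_zero power2_abs power_mono)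
    have p4: "c ^ 4 = (c\<^sup>2)\<^sup>2" for c :: real by simp
    have "(x + y - 2 * r)\<^sup>2 + (x + y + 2 * r)\<^sup>2 = 2 * (x\<^sup>2 + 2 * x * y + y\<^sup>2) + 8 * r\<^sup>2" by (simp add: power2_eq_square algebra_simps)
    also have "\<dots> \<le> 2 * (x\<^sup>2 + 6 * x * y + y\<^sup>2)" using \<open>r\<^sup>2 \<le> x * y\<close> by simp
    finally show ?thesis unfolding p4 e by (simp add: x_def y_def)
  qed
  { case 1
    have "?A (insert a I) = (\<Sum>s\<in>Pow I. 2 * ((norm (?S s))\<^sup>2 + (norm (z a))\<^sup>2))"
      unfolding sum_Pow_insert[OF insert(1,2)] by (rule sum.cong) (simp_all add: S n2)
    also have "\<dots> = 2 * ((\<Sum>s\<in>Pow I. (norm (?S s))\<^sup>2) + 2 ^ card I * (norm (z a))\<^sup>2)"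
      using insert by (simp add: sum_distrib_left[symmetric] sum.distrib card_Pow)
    finally show ?case using insert by (simp add: algebra_simps)
  next
    case 2
    have "?B (insert a I) \<le> (\<Sum>s\<in>Pow I. 2 * ((norm (?S s)) ^ 4 + 6 * (norm (?S s))\<^sup>2 * (norm (z a))\<^sup>2 + (norm (z a)) ^ 4))"
      unfolding sum_Pow_insert[OF insert(1,2)] by (rule sum_mono) (simp only: S n4)
    also have "\<dots> = 2 * ((\<Sum>s\<in>Pow I. (norm (?S s)) ^ 4) + 6 * (\<Sum>s\<in>Pow I. (norm (?S s))\<^sup>2) * (norm (z a))\<^sup>2 + 2 ^ card I * (norm (z a)) ^ 4)"
      using insert(1) by (simp add: sum_distrib_left[symmetric] sum_distrib_right[symmetric] sum.distrib card_Pow)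
    also have "\<dots> \<le> 2 * (2 ^ card I * (3 * ?Q\<^sup>2) + 6 * (2 ^ card I * ?Q) * (norm (z a))\<^sup>2 + 2 ^ card I * (norm (z a)) ^ 4)"
      using insert.IH by simp
    also have "\<dots> \<le> 2 ^ card (insert a I) * (3 * ((norm (z a))\<^sup>2 + ?Q)\<^sup>2)"
      using insert(1,2) by (simp add: power2_eq_square power4_eq_xxxx algebra_simps)
    finally show ?case using insert(1,2) by simp
  }
qed simp_all

lemma khintchine:
  fixes z :: "'i \<Rightarrow> 'a::real_inner"
  assumes "finite I"
  shows "sqrt (\<Sum>i\<in>I. (norm (z i))\<^sup>2) \<le> 2 * ((\<Sum>s\<in>Pow I. norm (\<Sum>i\<in>I. signed s i *\<^sub>R z i)) / 2 ^ card I)"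
proof -
  define Q where "Q = sqrt (\<Sum>i\<in>I. (norm (z i))\<^sup>2)"
  define S where "S = (\<lambda>s. norm (\<Sum>i\<in>I. signed s i *\<^sub>R z i))"
  have Q2: "Q\<^sup>2 = (\<Sum>i\<in>I. (norm (z i))\<^sup>2)" by (simp add: Q_def sum_nonneg)
  have Q0: "0 \<le> Q" by (simp add: Q_def sum_nonneg)
  show ?thesis
  proof (cases "Q = 0")
    case True
    then show ?thesis by (simp add: Q_def sum_nonneg)
  next
    case False
    then have Q: "Q > 0" using Q0 by simp
    text \<open>This is \<open>(t - 3/2)\<^sup>2 (t + 3) \<ge> 0\<close>; comparing with the second and fourth moments avoids the Hoelder inequality.\<close>
    have pt: "S s / Q \<ge> (S s)\<^sup>2 / Q\<^sup>2 - 4 / 27 * ((S s) ^ 4 / Q ^ 4)" for s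
    proof -
      define t where "t = S s / Q"
      have t: "t \<ge> 0" using Q by (simp add: t_def S_def)
      have "0 \<le> 4 / 27 * ((t - 3 / 2)\<^sup>2 * (t + 3)) * t" using t by simp
      also have "\<dots> = t - t\<^sup>2 + 4 / 27 * t ^ 4" by (simp add: power2_eq_square power4_eq_xxxx algebra_simps)
      finally show ?thesis by (simp add: t_def power_divide)
    qed
    have "(\<Sum>s\<in>Pow I. S s) / Q \<ge> (\<Sum>s\<in>Pow I. (S s)\<^sup>2 / Q\<^sup>2 - 4 / 27 * ((S s) ^ 4 / Q ^ 4))"
      unfolding sum_divide_distrib by (rule sum_mono) (rule pt)
    also have "(\<Sum>s\<in>Pow I. (S s)\<^sup>2 / Q\<^sup>2 - 4 / 27 * ((S s) ^ 4 / Q ^ 4))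
       = (\<Sum>s\<in>Pow I. (S s)\<^sup>2) / Q\<^sup>2 - 4 / 27 * ((\<Sum>s\<in>Pow I. (S s) ^ 4) / Q ^ 4)"
      by (simp add: sum_subtractf sum_divide_distrib sum_distrib_left)
    finally have 1: "(\<Sum>s\<in>Pow I. (S s)\<^sup>2) / Q\<^sup>2 - 4 / 27 * ((\<Sum>s\<in>Pow I. (S s) ^ 4) / Q ^ 4) \<le> (\<Sum>s\<in>Pow I. S s) / Q" .
    have "(\<Sum>s\<in>Pow I. (S s)\<^sup>2) / Q\<^sup>2 = 2 ^ card I"
      using rademacher_moments(1)[OF assms, of z] Q by (simp add: S_def Q2[symmetric])
    moreover have "(\<Sum>s\<in>Pow I. (S s) ^ 4) / Q ^ 4 \<le> 2 ^ card I * 3"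
      using rademacher_moments(2)[OF assms, of z] Q by (simp add: S_def Q2[symmetric] field_simps)
    ultimately have "2 ^ card I - 4 / 27 * (2 ^ card I * 3) \<le> (\<Sum>s\<in>Pow I. S s) / Q" using 1 by linarith
    moreover have "(0::real) < 2 ^ card I" by simp
    \<comment> \<open>The factor on the left was 1 - 4/9 = 5/9, which exceeds 1/2; hence the
      constant 2.\<close>
    ultimately have "2 ^ card I / 2 \<le> (\<Sum>s\<in>Pow I. S s) / Q" by linarith
    then show ?thesis using Q unfolding Q_def[symmetric] S_def by (simp add: field_simps)
  qed
qed

text \<open>For uniformly random f the coordinates f i are independent. A function of one
  coordinate, or a product for two, is written as a product over all of I and summed factor by
  factor.\<close>

lemma PiE_average:
  fixes g h :: "nat \<Rightarrow> real"
  assumes "finite I" "1 \<le> m"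
  shows "i \<in> I \<Longrightarrow> (\<Sum>f\<in>PiE I (\<lambda>_. {..<m}). g (f i)) = real m ^ card I * ((\<Sum>j<m. g j) / m)"
    and "i \<in> I \<Longrightarrow> l \<in> I \<Longrightarrow> i \<noteq> l \<Longrightarrow>
      (\<Sum>f\<in>PiE I (\<lambda>_. {..<m}). g (f i) * h (f l)) = real m ^ card I * (((\<Sum>j<m. g j) / m) * ((\<Sum>j<m. h j) / m))"
proof -
  have m: "real m > 0" using assms by simp
  show "(\<Sum>f\<in>PiE I (\<lambda>_. {..<m}). g (f i)) = real m ^ card I * ((\<Sum>j<m. g j) / m)" if i: "i \<in> I"
  proof -
    define G where "G = (\<lambda>x y. if x = i then g y else 1)"
    have "(\<Sum>f\<in>PiE I (\<lambda>_. {..<m}). g (f i)) = (\<Sum>f\<in>PiE I (\<lambda>_. {..<m}). \<Prod>x\<in>I. G x (f x))"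
      by (rule sum.cong) (use assms i in \<open>auto simp: G_def\<close>)
    also have "\<dots> = (\<Prod>x\<in>I. \<Sum>y<m. G x y)" by (rule prod_sum_PiE[symmetric]) (use assms in auto)
    also have "\<dots> = (\<Sum>y<m. G i y) * (\<Prod>x\<in>I - {i}. \<Sum>y<m. G x y)"
      using prod.remove[OF assms(1) i] by simp
    also have "(\<Prod>x\<in>I - {i}. \<Sum>y<m. G x y) = (\<Prod>x\<in>I - {i}. real m)"
      by (rule prod.cong) (auto simp: G_def)
    also have "\<dots> = real m ^ card I / m" using i assms m card_gt_0_iff[of I]
      by (auto simp: card_Diff_singleton power_diff)
    finally show ?thesis by (simp add: G_def)
  qed
  show "(\<Sum>f\<in>PiE I (\<lambda>_. {..<m}). g (f i) * h (f l)) = real m ^ card I * (((\<Sum>j<m. g j) / m) * ((\<Sum>j<m. h j) / m))"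
    if i: "i \<in> I" "l \<in> I" "i \<noteq> l"
  proof -
    define G where "G = (\<lambda>x y. if x = i then g y else if x = l then h y else 1)"
    have "(\<Prod>x\<in>I. G x (f x)) = g (f i) * h (f l)" for f
    proof -
      have "(\<Prod>x\<in>I. G x (f x)) = G i (f i) * (G l (f l) * (\<Prod>x\<in>I - {i} - {l}. G x (f x)))"
        using prod.remove[OF assms(1) i(1), of "\<lambda>x. G x (f x)"] prod.remove[of "I - {i}" l "\<lambda>x. G x (f x)"] assms i by simp
      also have "(\<Prod>x\<in>I - {i} - {l}. G x (f x)) = 1" by (rule prod.neutral) (auto simp: G_def)
      finally show ?thesis using i by (simp add: G_def)
    qed
    then have "(\<Sum>f\<in>PiE I (\<lambda>_. {..<m}). g (f i) * h (f l)) = (\<Sum>f\<in>PiE I (\<lambda>_. {..<m}). \<Prod>x\<in>I. G x (f x))" by simp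
    also have "\<dots> = (\<Prod>x\<in>I. \<Sum>y<m. G x y)" by (rule prod_sum_PiE[symmetric]) (use assms in auto)
    also have "\<dots> = (\<Sum>y<m. G i y) * ((\<Sum>y<m. G l y) * (\<Prod>x\<in>I - {i} - {l}. \<Sum>y<m. G x y))"
      using prod.remove[OF assms(1) i(1), of "\<lambda>x. \<Sum>y<m. G x y"] prod.remove[of "I - {i}" l "\<lambda>x. \<Sum>y<m. G x y"] assms i by simp
    also have "(\<Prod>x\<in>I - {i} - {l}. \<Sum>y<m. G x y) = (\<Prod>x\<in>I - {i} - {l}. real m)"
      by (rule prod.cong) (auto simp: G_def)
    also have "\<dots> = real m ^ card I / (m * m)"
    proof -
      have "card I = Suc (Suc (card (I - {i} - {l})))"
        using i assms by (metis card_Suc_Diff1 finite_Diff insert_Diff insert_iff)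
      then show ?thesis using m by simp
    qed
    finally show ?thesis using i by (simp add: G_def)
  qed
qed

text \<open>\<open>B\<^sub>f \<ge> B\<^sub>f A\<^sub>f / (1 + A\<^sub>f)\<close> with \<open>A\<^sub>f = (\<Sum>\<^sub>i \<alpha>\<^sub>i\<^sub>f\<^sub>i\<^sup>2)\<^sup>1\<^sup>/\<^sup>2\<close>, and \<open>1 / (1 + A\<^sub>f)\<close> is bounded below by a
  quantity that is independent of the \<open>i\<close>-th coordinate of \<open>f\<close>, so that the average factorizes.\<close>
lemma selection_average:
  fixes \<alpha> \<beta> :: "nat \<Rightarrow> nat \<Rightarrow> real"
  assumes I: "finite I" and m: "1 \<le> m" and nn: "\<And>i j. 0 \<le> \<alpha> i j" "\<And>i j. 0 \<le> \<beta> i j"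
    and lam: "0 \<le> L" "\<And>i j. i \<in> I \<Longrightarrow> j < m \<Longrightarrow> \<alpha> i j \<le> L" "(\<Sum>i\<in>I. \<Sum>j<m. (\<alpha> i j)\<^sup>2) \<le> m * L\<^sup>2"
  shows "(\<Sum>i\<in>I. \<Sum>j<m. \<alpha> i j * \<beta> i j) / m
     \<le> 3 * L * ((\<Sum>f\<in>PiE I (\<lambda>_. {..<m}). sqrt (\<Sum>i\<in>I. (\<beta> i (f i))\<^sup>2)) / real m ^ card I)"
proof (cases "L = 0")
  case True
  then have "\<alpha> i j = 0" if "i \<in> I" "j < m" for i j using lam(2)[OF that] nn(1)[of i j] by simp
  then show ?thesis using True by simp
next
  case False
  then have L: "L > 0" using lam by simp
  have mm: "real m > 0" using m by simp
  define a where "a = (\<lambda>i j. \<alpha> i j / L)"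
  have a: "0 \<le> a i j" for i j using nn L by (simp add: a_def)
  have a1: "a i j \<le> 1" if "i \<in> I" "j < m" for i j using lam(2)[OF that] L by (simp add: a_def)
  have a2: "(\<Sum>i\<in>I. \<Sum>j<m. (a i j)\<^sup>2) \<le> m"
  proof -
    have "(\<Sum>i\<in>I. \<Sum>j<m. (a i j)\<^sup>2) = (\<Sum>i\<in>I. \<Sum>j<m. (\<alpha> i j)\<^sup>2) / L\<^sup>2"
      by (simp add: a_def power_divide sum_divide_distrib)
    also have "\<dots> \<le> (m * L\<^sup>2) / L\<^sup>2" by (rule divide_right_mono[OF lam(3)]) simp
    finally show ?thesis using L by simp
  qed
  define F where "F = PiE I (\<lambda>_. {..<m})"
  define N where "N = real m ^ card I"
  have N: "N > 0" using mm by (simp add: N_def)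
  have finF: "finite F" unfolding F_def using I by (intro finite_PiE) auto
  define P where "P = (\<lambda>i. (\<Sum>j<m. a i j * \<beta> i j) / m)"
  define R where "R = (\<lambda>i. (\<Sum>j<m. (a i j)\<^sup>2) / m)"
  have P0: "0 \<le> P i" and R0: "0 \<le> R i" for i using a nn by (auto simp: P_def R_def intro!: sum_nonneg divide_nonneg_nonneg)
  have R1: "(\<Sum>i\<in>I. R i) \<le> 1" using a2 mm by (simp add: R_def sum_divide_distrib[symmetric])
  have pt: "(\<Sum>i\<in>I. a i (f i) * \<beta> i (f i) * (7 / 18 - 1 / 18 * (\<Sum>l\<in>I - {i}. (a l (f l))\<^sup>2)))
      \<le> sqrt (\<Sum>i\<in>I. (\<beta> i (f i))\<^sup>2)" if f: "f \<in> F" for f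
  proof -
    define A where "A = sqrt (\<Sum>i\<in>I. (a i (f i))\<^sup>2)"
    define B where "B = sqrt (\<Sum>i\<in>I. (\<beta> i (f i))\<^sup>2)"
    have A0: "0 \<le> A" and B0: "0 \<le> B" by (simp_all add: A_def B_def sum_nonneg)
    have CS: "(\<Sum>i\<in>I. a i (f i) * \<beta> i (f i)) \<le> A * B"
      using L2_set_mult_ineq[of "\<lambda>i. a i (f i)" "\<lambda>i. \<beta> i (f i)" I] a nn by (simp add: L2_set_def A_def B_def)
    have lin: "7 / 18 - 1 / 18 * (\<Sum>l\<in>I - {i}. (a l (f l))\<^sup>2) \<le> 1 / (1 + A)" if i: "i \<in> I" for i
    proof -
      define t where "t = sqrt (\<Sum>l\<in>I - {i}. (a l (f l))\<^sup>2)"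
      have t0: "0 \<le> t" and t2: "t\<^sup>2 = (\<Sum>l\<in>I - {i}. (a l (f l))\<^sup>2)" by (simp_all add: t_def sum_nonneg)
      have fi: "f i < m" using f i by (auto simp: F_def PiE_def Pi_def)
      have "A\<^sup>2 = (a i (f i))\<^sup>2 + t\<^sup>2"
        unfolding t2 using sum.remove[OF I i, of "\<lambda>l. (a l (f l))\<^sup>2"] by (simp add: A_def sum_nonneg)
      also have "\<dots> \<le> 1 + t\<^sup>2" using a1[OF i fi] a[of i "f i"] by (simp add: power_le_one)
      also have "\<dots> \<le> (1 + t)\<^sup>2" using t0 by (simp add: power2_eq_square algebra_simps)
      finally have "A\<^sup>2 \<le> (1 + t)\<^sup>2" .
      then have "A \<le> 1 + t" by (rule power2_le_imp_le) (use t0 in simp)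
      then have "1 / (2 + t) \<le> 1 / (1 + A)" using A0 t0 by (intro divide_left_mono) auto
      \<comment> \<open>As a function of t^2 the left side is the tangent to 1 / (2 + t) at t = 1.
        Being affine in t^2, it can be averaged with \<open>PiE_average\<close>; as the mean of t^2
        is at most 1, the result is at least 6/18 = 1/3, whence the factor 3.\<close>
      moreover have "7 / 18 - 1 / 18 * t\<^sup>2 \<le> 1 / (2 + t)"
      proof -
        have "0 \<le> (t - 1)\<^sup>2 * (t + 4)" using t0 by simp
        then have "(7 - t\<^sup>2) * (2 + t) \<le> 18" by (simp add: power2_eq_square algebra_simps)
        then show ?thesis using t0 by (simp add: field_simps)
      qed
      ultimately show ?thesis using t2 by simp
    qed
    have "(\<Sum>i\<in>I. a i (f i) * \<beta> i (f i) * (7 / 18 - 1 / 18 * (\<Sum>l\<in>I - {i}. (a l (f l))\<^sup>2)))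
        \<le> (\<Sum>i\<in>I. a i (f i) * \<beta> i (f i) * (1 / (1 + A)))"
      by (intro sum_mono mult_left_mono lin) (use a nn in auto)
    also have "\<dots> = (\<Sum>i\<in>I. a i (f i) * \<beta> i (f i)) / (1 + A)" by (simp add: sum_divide_distrib)
    also have "\<dots> \<le> (A * B) / (1 + A)" using CS A0 by (intro divide_right_mono) auto
    also have "\<dots> \<le> B" using A0 B0 by (simp add: field_simps)
    finally show ?thesis by (simp add: B_def)
  qed
  have "N * (\<Sum>i\<in>I. P i) / 3 \<le> (\<Sum>f\<in>F. \<Sum>i\<in>I. a i (f i) * \<beta> i (f i) * (7 / 18 - 1 / 18 * (\<Sum>l\<in>I - {i}. (a l (f l))\<^sup>2)))"
  proof -
    have "(\<Sum>f\<in>F. \<Sum>i\<in>I. a i (f i) * \<beta> i (f i) * (7 / 18 - 1 / 18 * (\<Sum>l\<in>I - {i}. (a l (f l))\<^sup>2)))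
      = (\<Sum>i\<in>I. 7 / 18 * (\<Sum>f\<in>F. a i (f i) * \<beta> i (f i)) - 1 / 18 * (\<Sum>l\<in>I - {i}. \<Sum>f\<in>F. (a i (f i) * \<beta> i (f i)) * (a l (f l))\<^sup>2))"
      by (subst sum.swap, rule sum.cong)
         (simp_all add: right_diff_distrib sum_subtractf sum_distrib_left sum.swap[of _ F] algebra_simps)
    also have "\<dots> = (\<Sum>i\<in>I. 7 / 18 * (N * P i) - 1 / 18 * (\<Sum>l\<in>I - {i}. N * (P i * R l)))"
    proof (rule sum.cong[OF refl])
      fix i assume i: "i \<in> I"
      have "(\<Sum>f\<in>F. a i (f i) * \<beta> i (f i)) = N * P i"
        unfolding F_def N_def P_def by (rule PiE_average(1)[OF I m i, of "\<lambda>j. a i j * \<beta> i j"])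
      moreover have "(\<Sum>f\<in>F. (a i (f i) * \<beta> i (f i)) * (a l (f l))\<^sup>2) = N * (P i * R l)" if "l \<in> I - {i}" for l
        unfolding F_def N_def P_def R_def
        by (rule PiE_average(2)[OF I m i, of l "\<lambda>j. a i j * \<beta> i j" "\<lambda>j. (a l j)\<^sup>2"]) (use that in auto)
      ultimately show "7 / 18 * (\<Sum>f\<in>F. a i (f i) * \<beta> i (f i)) - 1 / 18 * (\<Sum>l\<in>I - {i}. \<Sum>f\<in>F. (a i (f i) * \<beta> i (f i)) * (a l (f l))\<^sup>2)
         = 7 / 18 * (N * P i) - 1 / 18 * (\<Sum>l\<in>I - {i}. N * (P i * R l))" by simp
    qed
    also have "\<dots> \<ge> (\<Sum>i\<in>I. N * P i / 3)"
    proof (rule sum_mono)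
      fix i assume "i \<in> I"
      have "(\<Sum>l\<in>I - {i}. R l) \<le> (\<Sum>l\<in>I. R l)" by (rule sum_mono2) (use I R0 in auto)
      then have "N * P i * (\<Sum>l\<in>I - {i}. R l) \<le> N * P i * 1" using R1 N P0 by (intro mult_left_mono) auto
      then show "N * P i / 3 \<le> 7 / 18 * (N * P i) - 1 / 18 * (\<Sum>l\<in>I - {i}. N * (P i * R l))"
        by (simp add: sum_distrib_left[symmetric] mult.assoc)
    qed
    finally show ?thesis by (simp add: sum_distrib_left sum_divide_distrib)
  qed
  also have "\<dots> \<le> (\<Sum>f\<in>F. sqrt (\<Sum>i\<in>I. (\<beta> i (f i))\<^sup>2))" by (rule sum_mono) (rule pt)
  finally have "(\<Sum>i\<in>I. P i) \<le> 3 * ((\<Sum>f\<in>F. sqrt (\<Sum>i\<in>I. (\<beta> i (f i))\<^sup>2)) / N)" using N by (simp add: field_simps)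
  then have "L * (\<Sum>i\<in>I. P i) \<le> L * (3 * ((\<Sum>f\<in>F. sqrt (\<Sum>i\<in>I. (\<beta> i (f i))\<^sup>2)) / N))" using L by (intro mult_left_mono) auto
  moreover have "L * (\<Sum>i\<in>I. P i) = (\<Sum>i\<in>I. \<Sum>j<m. \<alpha> i j * \<beta> i j) / m"
    using L by (simp add: P_def a_def sum_distrib_left sum_divide_distrib)
  moreover have "L * (3 * x) = 3 * L * x" for x by simp
  ultimately show ?thesis by (simp only: F_def N_def)
qed

subsection \<open>Weighted traces of products of matrices\<close>

definition matrix_bound ::
  "real \<Rightarrow> nat set \<Rightarrow> nat set \<Rightarrow> real \<Rightarrow> (nat \<Rightarrow> nat \<Rightarrow> 'k::real_normed_field) \<Rightarrow> bool" where
  "matrix_bound p S S' K a \<longleftrightarrow> (\<forall>x. nu p S' (\<lambda>i. \<Sum>j\<in>S. a i j * x j) \<le> K * nu p S x)"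

lemma matrix_boundD: "matrix_bound p S S' K a \<Longrightarrow> nu p S' (\<lambda>i. \<Sum>j\<in>S. a i j * x j) \<le> K * nu p S x"
  by (simp add: matrix_bound_def)

lemma phase_exists: "\<exists>s::'k::real_normed_field. norm s = 1 \<and> c * s = of_real (norm c)"
proof (cases "c = 0")
  case False
  then show ?thesis by (intro exI[of _ "of_real (norm c) / c"]) (simp add: norm_divide)
qed (auto intro: exI[of _ 1])

context
  fixes p :: real and F J :: "nat set" and A B :: real
    and a b :: "nat \<Rightarrow> nat \<Rightarrow> 'k::{real_normed_field, real_inner}"
  assumes p: "1 \<le> p" and F: "finite F" and J: "finite J" and AB: "0 \<le> A" "0 \<le> B"
    and a: "matrix_bound p J F A a" and b: "matrix_bound p F J B b"
begin

text \<open>Changing the signs of x does not change \<open>nu p F x\<close>, so the same bound holds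
  for the images of all signed versions of x. Khintchine's inequality turns their mean into the
  square function.\<close>

lemma square_function_le:
  fixes x :: "nat \<Rightarrow> real"
  shows "nu p J (\<lambda>j. sqrt (\<Sum>i\<in>F. (norm (of_real (x i) * b j i))\<^sup>2)) \<le> 2 * B * nu p F x"
proof -
  define n where "n = (2::real) ^ card F"
  have n: "n > 0" by (simp add: n_def)
  define g where "g = (\<lambda>s j. \<Sum>i\<in>F. b j i * of_real (signed s i * x i))"
  have g: "g s j = (\<Sum>i\<in>F. signed s i *\<^sub>R (of_real (x i) * b j i))" for s j
    unfolding g_def by (rule sum.cong) (simp_all add: scaleR_conv_of_real mult_ac)
  have "nu p J (\<lambda>j. sqrt (\<Sum>i\<in>F. (norm (of_real (x i) * b j i))\<^sup>2))
      \<le> nu p J (\<lambda>j. \<Sum>s\<in>Pow F. 2 / n * norm (g s j))"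
  proof (rule nu_mono[OF p J])
    fix j
    have "sqrt (\<Sum>i\<in>F. (norm (of_real (x i) * b j i))\<^sup>2) \<le> (\<Sum>s\<in>Pow F. 2 / n * norm (g s j))"
      using khintchine[OF F, of "\<lambda>i. of_real (x i) * b j i"]
      by (simp add: g n_def sum_distrib_left sum_divide_distrib)
    moreover have "0 \<le> sqrt (\<Sum>i\<in>F. (norm (of_real (x i) * b j i))\<^sup>2)" by (simp add: sum_nonneg)
    ultimately show "norm (sqrt (\<Sum>i\<in>F. (norm (of_real (x i) * b j i))\<^sup>2)) \<le> norm (\<Sum>s\<in>Pow F. 2 / n * norm (g s j))"
      by simp
  qed
  also have "\<dots> \<le> (\<Sum>s\<in>Pow F. nu p J (\<lambda>j. 2 / n * norm (g s j)))"
    by (rule nu_sum[OF p J]) (simp add: F)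
  also have "\<dots> \<le> (\<Sum>s\<in>Pow F. 2 / n * (B * nu p F x))"
  proof (rule sum_mono)
    fix s
    have "nu p J (\<lambda>j. 2 / n * norm (g s j)) = 2 / n * nu p J (g s)"
      by (rule nu_scale[OF p J]) (use n in \<open>auto simp: abs_mult\<close>)
    also have "nu p J (g s) \<le> B * nu p F (\<lambda>i. of_real (signed s i * x i) :: 'k)"
      unfolding g_def by (rule matrix_boundD[OF b])
    also have "nu p F (\<lambda>i. of_real (signed s i * x i) :: 'k) = nu p F x"
      by (rule nu_cong[OF p F]) (simp add: norm_mult signed_def)
    finally show "nu p J (\<lambda>j. 2 / n * norm (g s j)) \<le> 2 / n * (B * nu p F x)" using n by (simp add: divide_right_mono)
  qed
  also have "\<dots> = 2 * B * nu p F x" using F by (simp add: card_Pow n_def)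
  finally show ?thesis .
qed

text \<open>The square function estimate for the transpose of a, stated without dual norms: by
  \<open>yK\<close> the weights y form a functional of norm at most K on F, and the square function
  of its image is tested against h. Unimodular phases turn the sums of moduli over j into values of
  that functional.\<close>

lemma dual_square_function_le:
  fixes h y :: "nat \<Rightarrow> real"
  assumes h: "\<And>j. 0 \<le> h j" and y: "\<And>q. 0 \<le> y q" and K: "0 \<le> K"
    and yK: "\<And>x :: nat \<Rightarrow> 'k. (\<Sum>q\<in>F. y q * norm (x q)) \<le> K * nu p F x"
  shows "(\<Sum>j\<in>J. h j * sqrt (\<Sum>q\<in>F. (y q * norm (a q j))\<^sup>2)) \<le> 2 * K * A * nu p J h"
proof -
  define n where "n = (2::real) ^ card F"
  have n: "n > 0" by (simp add: n_def)
  define c where "c = (\<lambda>s j. \<Sum>q\<in>F. signed s q *\<^sub>R (y q *\<^sub>R a q j))"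
  have key: "(\<Sum>j\<in>J. h j * norm (c s j)) \<le> K * A * nu p J h" for s
  proof -
    obtain t where t: "\<And>j. norm (t j) = 1" "\<And>j. c s j * t j = of_real (norm (c s j))"
      using phase_exists[of "c s _"] by metis
    let ?x = "\<lambda>j. t j * of_real (h j)"
    have "(\<Sum>j\<in>J. h j * norm (c s j)) = norm (of_real (\<Sum>j\<in>J. h j * norm (c s j)) :: 'k)"
      unfolding norm_of_real by (simp add: sum_nonneg h)
    also have "of_real (\<Sum>j\<in>J. h j * norm (c s j)) = (\<Sum>j\<in>J. c s j * ?x j)"
      by (simp add: t(2)[symmetric] mult_ac)
    also have "\<dots> = (\<Sum>q\<in>F. (signed s q * y q) *\<^sub>R (\<Sum>j\<in>J. a q j * ?x j))"
      unfolding c_def sum_distrib_right scaleR_sum_right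
      by (subst sum.swap) (simp add: scaleR_conv_of_real mult_ac)
    also have "norm \<dots> \<le> (\<Sum>q\<in>F. norm ((signed s q * y q) *\<^sub>R (\<Sum>j\<in>J. a q j * ?x j)))" by (rule norm_sum)
    also have "\<dots> = (\<Sum>q\<in>F. y q * norm (\<Sum>j\<in>J. a q j * ?x j))"
      by (rule sum.cong) (use y in \<open>simp_all add: abs_mult signed_def\<close>)
    also have "\<dots> \<le> K * nu p F (\<lambda>q. \<Sum>j\<in>J. a q j * ?x j)" by (rule yK)
    also have "\<dots> \<le> K * (A * nu p J ?x)" by (intro mult_left_mono K matrix_boundD[OF a])
    also have "nu p J ?x = nu p J h" by (rule nu_cong[OF p J]) (simp add: norm_mult t)
    finally show ?thesis by simp
  qed
  have "(\<Sum>j\<in>J. h j * sqrt (\<Sum>q\<in>F. (y q * norm (a q j))\<^sup>2)) \<le> (\<Sum>j\<in>J. \<Sum>s\<in>Pow F. 2 / n * (h j * norm (c s j)))"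
  proof (rule sum_mono)
    fix j
    have "sqrt (\<Sum>q\<in>F. (y q * norm (a q j))\<^sup>2) \<le> 2 * ((\<Sum>s\<in>Pow F. norm (c s j)) / n)"
      using khintchine[OF F, of "\<lambda>q. y q *\<^sub>R a q j"] y by (simp add: c_def n_def)
    then have "h j * sqrt (\<Sum>q\<in>F. (y q * norm (a q j))\<^sup>2) \<le> h j * (2 * ((\<Sum>s\<in>Pow F. norm (c s j)) / n))"
      by (rule mult_left_mono) (rule h)
    then show "h j * sqrt (\<Sum>q\<in>F. (y q * norm (a q j))\<^sup>2) \<le> (\<Sum>s\<in>Pow F. 2 / n * (h j * norm (c s j)))"
      by (simp add: sum_distrib_left sum_divide_distrib mult_ac)
  qed
  also have "\<dots> = (\<Sum>s\<in>Pow F. 2 / n * (\<Sum>j\<in>J. h j * norm (c s j)))"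
    by (subst sum.swap) (simp add: sum_distrib_left)
  also have "\<dots> \<le> (\<Sum>s\<in>Pow F. 2 / n * (K * A * nu p J h))"
    by (intro sum_mono mult_left_mono key) (use n in simp)
  also have "\<dots> = 2 * K * A * nu p J h" using F by (simp add: card_Pow n_def)
  finally show ?thesis .
qed

text \<open>When q j maximizes the weighted entry in column j, this tests the maximal function of
  the rows of a against h. The map q splits h into parts k r with disjoint supports, row r sees only
  its own part, and Hoelder's inequality with the lower p-estimate far out reassembles the
  parts.\<close>

lemma maximal_function_le:
  fixes h u :: "nat \<Rightarrow> real"
  assumes h: "\<And>j. 0 \<le> h j" and u: "\<And>q. 0 \<le> u q" "0 < sum u F" and q: "\<And>j. j \<in> J \<Longrightarrow> q j \<in> F"
    and J': "J \<subseteq> {12 ^ card F..}"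
  shows "(\<Sum>j\<in>J. h j * (u (q j) powr (1 - 1 / p) * norm (a (q j) j))) \<le> 2 * A * sum u F powr (1 - 1 / p) * nu p J h"
proof -
  define k where "k = (\<lambda>r j. if q j = r then h j else 0)"
  have row: "(\<Sum>j\<in>J. k r j * norm (a r j)) \<le> A * nu p J (k r)" if r: "r \<in> F" for r
  proof -
    obtain t where t: "\<And>j. norm (t j) = 1" "\<And>j. a r j * t j = of_real (norm (a r j))"
      using phase_exists[of "a r _"] by metis
    let ?x = "\<lambda>j. t j * of_real (k r j)"
    have k0: "0 \<le> k r j" for j using h by (simp add: k_def)
    have "(\<Sum>j\<in>J. k r j * norm (a r j)) = norm (of_real (\<Sum>j\<in>J. k r j * norm (a r j)) :: 'k)"
      unfolding norm_of_real by (simp add: sum_nonneg k0)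
    also have "of_real (\<Sum>j\<in>J. k r j * norm (a r j)) = (\<Sum>j\<in>J. a r j * ?x j)"
      by (simp add: t(2)[symmetric] mult_ac)
    also have "norm \<dots> \<le> nu p F (\<lambda>i. \<Sum>j\<in>J. a i j * ?x j)" by (rule norm_le_nu[OF p F r])
    also have "\<dots> \<le> A * nu p J ?x" by (rule matrix_boundD[OF a])
    also have "nu p J ?x = nu p J (k r)" by (rule nu_cong[OF p J]) (simp add: norm_mult t)
    finally show ?thesis .
  qed
  have "(\<Sum>j\<in>J. h j * (u (q j) powr (1 - 1 / p) * norm (a (q j) j)))
      = (\<Sum>j\<in>J. \<Sum>r\<in>F. u r powr (1 - 1 / p) * (k r j * norm (a r j)))"
  proof (rule sum.cong[OF refl])
    fix j assume "j \<in> J"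
    then have "(\<Sum>r\<in>F. u r powr (1 - 1 / p) * (k r j * norm (a r j)))
       = (\<Sum>r\<in>{q j}. u r powr (1 - 1 / p) * (k r j * norm (a r j)))"
      by (intro sum.mono_neutral_right) (use F q in \<open>auto simp: k_def\<close>)
    then show "h j * (u (q j) powr (1 - 1 / p) * norm (a (q j) j))
       = (\<Sum>r\<in>F. u r powr (1 - 1 / p) * (k r j * norm (a r j)))" by (simp add: k_def)
  qed
  also have "\<dots> = (\<Sum>r\<in>F. u r powr (1 - 1 / p) * (\<Sum>j\<in>J. k r j * norm (a r j)))"
    by (subst sum.swap) (simp add: sum_distrib_left)
  also have "\<dots> \<le> (\<Sum>r\<in>F. u r powr (1 - 1 / p) * (A * nu p J (k r)))"
    by (intro sum_mono mult_left_mono row) auto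
  also have "\<dots> = A * (\<Sum>r\<in>F. u r powr (1 - 1 / p) * nu p J (k r))"
    by (simp add: sum_distrib_left mult_ac)
  also have "\<dots> \<le> A * (sum u F powr (1 - 1 / p) * (\<Sum>r\<in>F. nu p J (k r) powr p) powr (1 / p))"
    by (intro mult_left_mono weighted_Holder F u p AB nu_nonneg[OF p J])
  also have "\<dots> \<le> A * (sum u F powr (1 - 1 / p) * (2 * nu p J h))"
  proof (intro mult_left_mono AB)
    have "(\<Sum>r\<in>F. nu p J (k r) powr p) \<le> 2 * nu p J h powr p"
    proof (rule sum_nu_powr_le[OF p J F J'])
      fix j assume "j \<in> J"
      then have "(\<Sum>r\<in>F. norm (k r j) powr p) = (\<Sum>r\<in>{q j}. norm (k r j) powr p)"
        by (intro sum.mono_neutral_right) (use F q p in \<open>auto simp: k_def\<close>)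
      then show "(\<Sum>r\<in>F. norm (k r j) powr p) \<le> norm (h j) powr p" by (simp add: k_def)
    qed
    then have "(\<Sum>r\<in>F. nu p J (k r) powr p) powr (1 / p) \<le> (2 * nu p J h powr p) powr (1 / p)"
      using p by (intro powr_mono2) (auto intro: sum_nonneg)
    also have "\<dots> = 2 powr (1 / p) * nu p J h" using p nu_nonneg[OF p J, of h] by (simp add: powr_mult powr_powr)
    also have "\<dots> \<le> 2 * nu p J h"
    proof (intro mult_right_mono nu_nonneg[OF p J])
      show "(2::real) powr (1 / p) \<le> 2" using p powr_mono[of "1 / p" 1 "2::real"] by simp
    qed
    finally show "(\<Sum>r\<in>F. nu p J (k r) powr p) powr (1 / p) \<le> 2 * nu p J h" .
  qed simp
  finally show ?thesis by (simp add: mult_ac)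
qed

text \<open>The inner sum over j is at most A times the norm of column i of b. After Hoelder's
  inequality over i, the lower p-estimate compares the scaled columns with their square function,
  which dominates their pointwise l_p-sum because p is at least 2, and
  \<open>square_function_le\<close> returns to the weight u. The constant is 2 * 2.\<close>

lemma trace_bound_ge_2:
  fixes u :: "nat \<Rightarrow> real"
  assumes p2: "2 \<le> p" and u: "\<And>i. 0 \<le> u i" "sum u F = 1" and J': "J \<subseteq> {12 ^ card F..}"
  shows "norm (\<Sum>i\<in>F. of_real (u i) * (\<Sum>j\<in>J. a i j * b j i)) \<le> 4 * A * B * tn (restr F u) powr (1 / p)"
proof -
  define x where "x = (\<lambda>i. u i powr (1 / p))"
  define g where "g = (\<lambda>j. sqrt (\<Sum>i\<in>F. (norm (of_real (x i) * b j i))\<^sup>2))"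
  define \<beta> where "\<beta> = (\<lambda>i j. of_real (x i) * b j i)"
  have x0: "0 \<le> x i" for i by (simp add: x_def)
  have "norm (\<Sum>i\<in>F. of_real (u i) * (\<Sum>j\<in>J. a i j * b j i)) \<le> (\<Sum>i\<in>F. u i * norm (\<Sum>j\<in>J. a i j * b j i))"
    by (rule order_trans[OF norm_sum]) (simp add: norm_mult u)
  also have "\<dots> \<le> (\<Sum>i\<in>F. u i * (A * nu p J (\<lambda>j. b j i)))"
  proof (intro sum_mono mult_left_mono u)
    fix i assume i: "i \<in> F"
    have "norm (\<Sum>j\<in>J. a i j * b j i) \<le> nu p F (\<lambda>i'. \<Sum>j\<in>J. a i' j * b j i)" by (rule norm_le_nu[OF p F i])
    also have "\<dots> \<le> A * nu p J (\<lambda>j. b j i)" by (rule matrix_boundD[OF a])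
    finally show "norm (\<Sum>j\<in>J. a i j * b j i) \<le> A * nu p J (\<lambda>j. b j i)" .
  qed
  also have "\<dots> = A * (\<Sum>i\<in>F. u i powr (1 - 1 / p) * nu p J (\<beta> i))"
    unfolding sum_distrib_left
  proof (rule sum.cong[OF refl])
    fix i
    have "nu p J (\<beta> i) = x i * nu p J (\<lambda>j. b j i)"
      by (rule nu_scale[OF p J]) (use x0 in \<open>auto simp: \<beta>_def norm_mult\<close>)
    moreover have "u i powr (1 - 1 / p) * x i = u i"
      using u(1)[of i] unfolding x_def by (cases "u i = 0") (simp_all add: powr_add[symmetric])
    ultimately have "u i powr (1 - 1 / p) * nu p J (\<beta> i) = u i * nu p J (\<lambda>j. b j i)" by (simp add: mult.assoc[symmetric])
    then show "u i * (A * nu p J (\<lambda>j. b j i)) = A * (u i powr (1 - 1 / p) * nu p J (\<beta> i))" by simp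
  qed
  also have "\<dots> \<le> A * (sum u F powr (1 - 1 / p) * (\<Sum>i\<in>F. nu p J (\<beta> i) powr p) powr (1 / p))"
    by (intro mult_left_mono weighted_Holder F u p AB nu_nonneg[OF p J]) (simp add: u)
  also have "\<dots> \<le> A * (2 * nu p J g)"
  proof (intro mult_left_mono AB)
    have "(\<Sum>i\<in>F. nu p J (\<beta> i) powr p) \<le> 2 * nu p J g powr p"
    proof (rule sum_nu_powr_le[OF p J F J'])
      fix j
      have g0: "0 \<le> g j" by (simp add: g_def sum_nonneg)
      have g2: "(g j)\<^sup>2 = (\<Sum>i\<in>F. (norm (\<beta> i j))\<^sup>2)" by (simp add: g_def \<beta>_def sum_nonneg)
      have le: "norm (\<beta> i j) \<le> g j" if "i \<in> F" for i
      proof (rule power2_le_imp_le[OF _ g0])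
        show "(norm (\<beta> i j))\<^sup>2 \<le> (g j)\<^sup>2" unfolding g2 by (rule member_le_sum) (use F that in auto)
      qed
      have pw: "t powr p = t\<^sup>2 * t powr (p - 2)" if "0 \<le> t" for t :: real
        using that p2 by (cases "t = 0") (simp_all add: powr_add[symmetric] powr_numeral[symmetric] del: powr_numeral)
      have "(\<Sum>i\<in>F. norm (\<beta> i j) powr p) \<le> (\<Sum>i\<in>F. (norm (\<beta> i j))\<^sup>2 * g j powr (p - 2))"
      proof (rule sum_mono)
        fix i assume "i \<in> F"
        then show "norm (\<beta> i j) powr p \<le> (norm (\<beta> i j))\<^sup>2 * g j powr (p - 2)"
          unfolding pw[OF norm_ge_zero] using p2 le by (intro mult_left_mono powr_mono2) auto
      qed
      also have "\<dots> = g j powr p" unfolding pw[OF g0] g2 by (simp add: sum_distrib_right)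
      finally show "(\<Sum>i\<in>F. norm (\<beta> i j) powr p) \<le> norm (g j) powr p" using g0 by simp
    qed
    then have "(\<Sum>i\<in>F. nu p J (\<beta> i) powr p) powr (1 / p) \<le> (2 * nu p J g powr p) powr (1 / p)"
      using p by (intro powr_mono2) (auto intro: sum_nonneg)
    also have "\<dots> = 2 powr (1 / p) * nu p J g" using p nu_nonneg[OF p J, of g] by (simp add: powr_mult powr_powr)
    also have "\<dots> \<le> 2 * nu p J g"
    proof (intro mult_right_mono nu_nonneg[OF p J])
      show "(2::real) powr (1 / p) \<le> 2" using p powr_mono[of "1 / p" 1 "2::real"] by simp
    qed
    finally show "sum u F powr (1 - 1 / p) * (\<Sum>i\<in>F. nu p J (\<beta> i) powr p) powr (1 / p) \<le> 2 * nu p J g"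
      by (simp add: u)
  qed
  also have "\<dots> \<le> A * (2 * (2 * B * nu p F x))"
    unfolding g_def by (intro mult_left_mono AB square_function_le) auto
  also have "nu p F x = tn (restr F u) powr (1 / p)"
  proof -
    have "restr F (\<lambda>n. norm (x n) powr p) = restr F u"
      using p u(1) by (auto simp: restr_def x_def powr_powr)
    then show ?thesis by (simp add: nu_def)
  qed
  finally have "norm (\<Sum>i\<in>F. of_real (u i) * (\<Sum>j\<in>J. a i j * b j i)) \<le> 4 * (A * B * tn (restr F u) powr (1 / p))"
    by (simp add: mult_ac)
  then show ?thesis by (simp add: mult_ac)
qed

end

section \<open>Blocks of m coordinates and random selections, for the case p < 2\<close>

lemma sum_blocks:
  fixes g :: "nat \<Rightarrow> 'a::comm_monoid_add"
  assumes "finite I" "1 \<le> m"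
  shows "(\<Sum>n\<in>{n. n div m \<in> I}. g n) = (\<Sum>i\<in>I. \<Sum>j<m. g (m * i + j))"
proof -
  have "(\<Sum>i\<in>I. \<Sum>j<m. g (m * i + j)) = (\<Sum>z\<in>I \<times> {..<m}. g (m * fst z + snd z))"
    by (simp add: sum.cartesian_product case_prod_unfold)
  also have "\<dots> = (\<Sum>n\<in>{n. n div m \<in> I}. g n)"
    by (rule sum.reindex_bij_witness[of _ "\<lambda>n. (n div m, n mod m)" "\<lambda>z. m * fst z + snd z"]) (use assms in auto)
  finally show ?thesis by simp
qed

lemma finite_blocks: "finite I \<Longrightarrow> 1 \<le> m \<Longrightarrow> finite {n::nat. n div m \<in> I}"
proof -
  assume I: "finite I" "1 \<le> m"
  have "{n. n div m \<in> I} \<subseteq> (\<lambda>z. m * fst z + snd z) ` (I \<times> {..<m})"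
  proof
    fix n assume n: "n \<in> {n. n div m \<in> I}"
    then show "n \<in> (\<lambda>z. m * fst z + snd z) ` (I \<times> {..<m})"
      using I by (intro image_eqI[of _ _ "(n div m, n mod m)"]) auto
  qed
  then show ?thesis using I by (auto intro: finite_subset)
qed

definition block_weight :: "nat \<Rightarrow> (nat \<Rightarrow> real) \<Rightarrow> nat \<Rightarrow> real" where
  "block_weight m v n = block_sum m v (n div m)"

text \<open>The mean, over all selections of one index per block, of the square functions of the
  selected columns of b. It takes the place of h in the maximal and in the dual square function
  estimate.\<close>

definition selection_mean ::
  "real \<Rightarrow> nat \<Rightarrow> nat set \<Rightarrow> (nat \<Rightarrow> real) \<Rightarrow> (nat \<Rightarrow> nat \<Rightarrow> 'k::real_normed_vector) \<Rightarrow> nat \<Rightarrow> real" where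
  "selection_mean p m I v b j = (\<Sum>f\<in>PiE I (\<lambda>_. {..<m}).
     sqrt (\<Sum>i\<in>I. (block_sum m v i powr (1 / p) * norm (b j (m * i + f i)))\<^sup>2)) / real m ^ card I"

text \<open>The number \<epsilon> is a lower bound for the norms of probability vectors on F
  (\<open>low\<close>), and v attains it up to a factor 2. Both directions are used:
  \<open>low\<close> bounds a functional on F, v bounds the size of \<open>selection_mean\<close>,
  and the powers of \<epsilon> cancel in the product.\<close>

context
  fixes p A B \<epsilon> :: real and m :: nat and I J :: "nat set" and v :: "nat \<Rightarrow> real"
    and a b :: "nat \<Rightarrow> nat \<Rightarrow> 'k::{real_normed_field, real_inner}"
  assumes p: "1 \<le> p" and m: "1 \<le> m" and I: "finite I" and J: "finite J" and AB: "0 \<le> A" "0 \<le> B" and eps: "0 < \<epsilon>"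
    and v: "\<And>n. 0 \<le> v n" "\<And>n. v n \<noteq> 0 \<Longrightarrow> n div m \<in> I \<and> m \<le> n" "sum v {n. n div m \<in> I} = 1" "tn v \<le> 2 * \<epsilon>"
    and low: "\<And>g. (\<And>n. 0 \<le> g n) \<Longrightarrow> \<epsilon> * sum g {n. n div m \<in> I} \<le> tn (restr {n. n div m \<in> I} g)"
    and J': "J \<subseteq> {12 ^ card {n. n div m \<in> I}..}"
    and a: "matrix_bound p J {n. n div m \<in> I} A a" and b: "matrix_bound p {n. n div m \<in> I} J B b"
begin

private abbreviation "F \<equiv> {n. n div m \<in> I}"
private abbreviation "u \<equiv> block_sum m v"
private abbreviation "w \<equiv> block_weight m v"
private abbreviation "y n \<equiv> w n powr (1 - 1 / p)"
private abbreviation "h \<equiv> selection_mean p m I v b"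

private lemmas w_def = block_weight_def
private lemmas h_def = selection_mean_def

private lemma F: "finite F" by (rule finite_blocks[OF I m])

private lemma F_nonempty: "F \<noteq> {}"
  using v(3) by force

private lemma u_nonneg: "0 \<le> u i" by (simp add: block_sum_def sum_nonneg v)

private lemma w_nonneg: "0 \<le> w n" by (simp add: w_def u_nonneg)

private lemma sum_u: "sum u I = 1"
  using sum_blocks[OF I m, of v] v(3) by (simp add: block_sum_def)

private lemma sum_w: "sum w F = real m"
proof -
  have "sum w F = (\<Sum>i\<in>I. \<Sum>j<m. u i)"
    unfolding sum_blocks[OF I m] by (intro sum.cong refl) (use m in \<open>simp add: w_def\<close>)
  also have "\<dots> = real m * sum u I" by (simp add: sum_distrib_left)
  finally show ?thesis using sum_u by simp
qed

text \<open>By \<open>low\<close>, the norm \<open>nu p F\<close> dominates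
  \<open>\<epsilon> powr (1 / p)\<close> times the l_p-norm on F. On l_p the functional y has norm
  at most \<open>real m powr (1 - 1 / p)\<close>, because w has total mass m.\<close>

private lemma y_dual: "(\<Sum>q\<in>F. y q * norm (x q)) \<le> (real m powr (1 - 1 / p) * \<epsilon> powr (- (1 / p))) * nu p F (x :: nat \<Rightarrow> 'k)"
proof -
  have "(\<Sum>q\<in>F. y q * norm (x q)) \<le> sum w F powr (1 - 1 / p) * (\<Sum>q\<in>F. norm (x q) powr p) powr (1 / p)"
    by (rule weighted_Holder) (use F p w_nonneg sum_w m in auto)
  also have "\<dots> \<le> real m powr (1 - 1 / p) * (\<epsilon> powr (- (1 / p)) * nu p F x)"
    unfolding sum_w
  proof (rule mult_left_mono)
    have "(\<Sum>q\<in>F. norm (x q) powr p) \<le> tn (restr F (\<lambda>n. norm (x n) powr p)) / \<epsilon>"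
      using low[of "\<lambda>n. norm (x n) powr p"] eps by (simp add: field_simps)
    then have "(\<Sum>q\<in>F. norm (x q) powr p) powr (1 / p) \<le> (tn (restr F (\<lambda>n. norm (x n) powr p)) / \<epsilon>) powr (1 / p)"
      using p by (intro powr_mono2) (auto intro: sum_nonneg)
    also have "\<dots> = \<epsilon> powr (- (1 / p)) * nu p F x"
      using eps by (simp add: nu_def powr_divide powr_minus field_simps)
    finally show "(\<Sum>q\<in>F. norm (x q) powr p) powr (1 / p) \<le> \<epsilon> powr (- (1 / p)) * nu p F x" .
  qed simp
  finally show ?thesis by simp
qed

private lemma h_nonneg: "0 \<le> h j" by (simp add: h_def sum_nonneg)

text \<open>Each selection gives the square function of b at the p-th root of a compressed vector,
  whose \<open>tn\<close> is at most 8 * 2 * \<epsilon> for every m. The factor 2 of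
  \<open>square_function_le\<close> makes 32 of 16, and the triangle inequality passes to the
  mean.\<close>

private lemma nu_h: "nu p J h \<le> 32 * B * \<epsilon> powr (1 / p)"
proof -
  define P where "P = PiE I (\<lambda>_. {..<m})"
  define n where "n = real m ^ card I"
  have n: "n > 0" using m by (simp add: n_def)
  have P: "finite P" "real (card P) = n" using I by (simp_all add: P_def n_def finite_PiE card_PiE)
  define Bf where "Bf = (\<lambda>f j. sqrt (\<Sum>i\<in>I. (u i powr (1 / p) * norm (b j (m * i + f i)))\<^sup>2))"
  have bf: "nu p J (Bf f) \<le> 32 * B * \<epsilon> powr (1 / p)" if f: "f \<in> P" for f
  proof -
    \<comment> \<open>Outside I an element of the product set is \<open>undefined\<close>, whereas
      compression asks for an index below m in every block.\<close>
    define f' where "f' = (\<lambda>i. if i \<in> I then f i else 0)"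
    have f': "f' i < m" for i using f m by (auto simp: f'_def P_def PiE_def Pi_def)
    define x where "x = (\<lambda>n. compress m f' v n powr (1 / p))"
    have c0: "0 \<le> compress m f' v n" for n by (simp add: compress_def u_nonneg)
    have B: "Bf f j = sqrt (\<Sum>q\<in>F. (norm (of_real (x q) * b j q))\<^sup>2)" for j
    proof -
      have "(\<Sum>q\<in>F. (norm (of_real (x q) * b j q))\<^sup>2) = (\<Sum>i\<in>I. \<Sum>k<m. (norm (of_real (x (m * i + k)) * b j (m * i + k)))\<^sup>2)"
        by (rule sum_blocks[OF I m])
      also have "\<dots> = (\<Sum>i\<in>I. (u i powr (1 / p) * norm (b j (m * i + f i)))\<^sup>2)"
      proof (rule sum.cong[OF refl])
        fix i assume i: "i \<in> I"
        have xk: "x (m * i + k) = (if k = f i then u i powr (1 / p) else 0)" if "k < m" for k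
          using that i m p by (simp add: x_def compress_def f'_def)
        have "(\<Sum>k<m. (norm (of_real (x (m * i + k)) * b j (m * i + k)))\<^sup>2)
           = (\<Sum>k\<in>{f i}. (norm (of_real (x (m * i + k)) * b j (m * i + k)))\<^sup>2)"
          by (rule sum.mono_neutral_right) (use f'[of i] i xk in \<open>auto simp: f'_def\<close>)
        also have "\<dots> = (u i powr (1 / p) * norm (b j (m * i + f i)))\<^sup>2"
          using f'[of i] i xk[of "f i"] by (simp add: f'_def norm_mult)
        finally show "(\<Sum>k<m. (norm (of_real (x (m * i + k)) * b j (m * i + k)))\<^sup>2)
           = (u i powr (1 / p) * norm (b j (m * i + f i)))\<^sup>2" .
      qed
      finally show ?thesis by (simp add: Bf_def)
    qed
    have fv: "fsupp v"
    proof -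
      have "restr F v n = v n" for n using v(2)[of n] by (auto simp: restr_apply)
      then have "restr F v = v" by blast
      then show ?thesis using fsupp_restr_finite[OF F, of v] by simp
    qed
    have "restr F (\<lambda>n. norm (x n) powr p) = compress m f' v"
    proof
      fix n
      show "restr F (\<lambda>n. norm (x n) powr p) n = compress m f' v n"
      proof (cases "n \<in> F")
        case True
        then show ?thesis using p c0[of n] by (simp add: restr_apply x_def powr_powr)
      next
        case False
        have "v (m * (n div m) + j) = 0" if "j < m" for j
          using v(2)[of "m * (n div m) + j"] False that by auto
        then show ?thesis using False by (simp add: restr_apply compress_def block_sum_def)
      qed
    qed
    then have nx: "nu p F x = tn (compress m f' v) powr (1 / p)" by (simp add: nu_def)
    also have "\<dots> \<le> (16 * \<epsilon>) powr (1 / p)"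
    proof (rule powr_mono2)
      have "tn (compress m f' v) \<le> 8 * tn v" by (rule tn_compress[OF m f' fv v(1)]) (use v(2) in blast)
      then show "tn (compress m f' v) \<le> 16 * \<epsilon>" using v(4) by simp
      show "0 \<le> tn (compress m f' v)" by (rule tn.nonneg[OF fsupp_Z[OF m f' fv]])
    qed (use p in simp)
    also have "\<dots> = 16 powr (1 / p) * \<epsilon> powr (1 / p)" by (rule powr_mult)
    also have "\<dots> \<le> 16 * \<epsilon> powr (1 / p)"
      using p powr_mono[of "1 / p" 1 "16::real"] by (intro mult_right_mono) auto
    finally have "nu p F x \<le> 16 * \<epsilon> powr (1 / p)" .
    then have "2 * B * nu p F x \<le> 2 * B * (16 * \<epsilon> powr (1 / p))" using AB by (intro mult_left_mono) auto
    moreover have "nu p J (Bf f) \<le> 2 * B * nu p F x"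
      using square_function_le[OF p F J AB a b, of x] unfolding ext[of "Bf f", OF B] .
    ultimately show ?thesis by simp
  qed
  have "h = (\<lambda>j. \<Sum>f\<in>P. 1 / n * Bf f j)"
    by (simp add: fun_eq_iff h_def P_def n_def Bf_def sum_divide_distrib)
  then have "nu p J h \<le> (\<Sum>f\<in>P. nu p J (\<lambda>j. 1 / n * Bf f j))"
    using nu_sum[OF p J P(1), of "\<lambda>f j. 1 / n * Bf f j"] by simp
  also have "\<dots> \<le> (\<Sum>f\<in>P. 1 / n * (32 * B * \<epsilon> powr (1 / p)))"
  proof (rule sum_mono)
    fix f assume f: "f \<in> P"
    have "nu p J (\<lambda>j. 1 / n * Bf f j) = 1 / n * nu p J (Bf f)"
      by (rule nu_scale[OF p J]) (use n in \<open>auto simp: abs_mult\<close>)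
    also have "\<dots> \<le> 1 / n * (32 * B * \<epsilon> powr (1 / p))"
      by (rule mult_left_mono[OF bf[OF f]]) (use n in simp)
    finally show "nu p J (\<lambda>j. 1 / n * Bf f j) \<le> 1 / n * (32 * B * \<epsilon> powr (1 / p))" .
  qed
  also have "\<dots> = 32 * B * \<epsilon> powr (1 / p)" using P n by simp
  finally show ?thesis .
qed

text \<open>The weight w is y times its own p-th root; y is attached to a and the root to b. For
  each j, \<open>selection_average\<close> replaces b by the mean h at the price of L j, and the two
  parts of L j are tested against h by the maximal and the dual square function estimates. The first
  resulting term is small when \<epsilon> is small for given m; the second is free of \<epsilon> and
  has a negative power of m for p < 2.\<close>

lemma trace_bound_blocks:
  "norm (\<Sum>q\<in>F. of_real (w q / m) * (\<Sum>j\<in>J. a q j * b j q))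
    \<le> 192 * A * B * (real m powr (1 - 1 / p) * \<epsilon> powr (1 / p) + real m powr (1 / 2 - 1 / p))"
proof -
  have m0: "real m > 0" using m by simp
  define Q where "Q = (\<lambda>j. sqrt (\<Sum>q\<in>F. (y q * norm (a q j))\<^sup>2))"
  have "\<exists>q\<in>F. \<forall>r\<in>F. y r * norm (a r j) \<le> y q * norm (a q j)" for j
  proof -
    let ?g = "\<lambda>q. y q * norm (a q j)"
    have "Max (?g ` F) \<in> ?g ` F" using F F_nonempty by (intro Max_in) auto
    then obtain q where q: "Max (?g ` F) = ?g q" "q \<in> F" by (rule imageE)
    have "?g r \<le> ?g q" if "r \<in> F" for r
      unfolding q(1)[symmetric] using F that by (intro Max_ge finite_imageI imageI)
    then show ?thesis using q(2) by blast
  qed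
  then obtain k where k: "\<And>j. k j \<in> F" "\<And>j r. r \<in> F \<Longrightarrow> y r * norm (a r j) \<le> y (k j) * norm (a (k j) j)"
    by metis
  define M where "M = (\<lambda>j. y (k j) * norm (a (k j) j))"
  \<comment> \<open>\<open>selection_average\<close> asks that L j dominate every weighted entry and
    that sqrt m times L j dominate their l_2-norm. The sum of the two lower bounds does
    both.\<close>
  define L where "L = (\<lambda>j. M j + Q j / sqrt m)"
  have M0: "0 \<le> M j" and Q0: "0 \<le> Q j" for j by (simp_all add: M_def Q_def sum_nonneg)
  have pt: "(\<Sum>q\<in>F. w q * (norm (a q j) * norm (b j q))) / m \<le> 3 * L j * h j" for j
  proof -
    let ?\<alpha> = "\<lambda>i l. y (m * i + l) * norm (a (m * i + l) j)"
    let ?\<beta> = "\<lambda>i l. u i powr (1 / p) * norm (b j (m * i + l))"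
    have "(\<Sum>i\<in>I. \<Sum>l<m. ?\<alpha> i l * ?\<beta> i l) / m
     \<le> 3 * L j * ((\<Sum>f\<in>PiE I (\<lambda>_. {..<m}). sqrt (\<Sum>i\<in>I. (?\<beta> i (f i))\<^sup>2)) / real m ^ card I)"
    proof (rule selection_average[OF I m])
      show "0 \<le> L j" using M0 Q0 by (simp add: L_def)
      show "?\<alpha> i l \<le> L j" if "i \<in> I" "l < m" for i l
      proof -
        have "?\<alpha> i l \<le> M j" unfolding M_def by (rule k(2)) (use that in simp)
        moreover have "0 \<le> Q j / sqrt m" using Q0 by simp
        ultimately show ?thesis unfolding L_def by linarith
      qed
      have "(\<Sum>i\<in>I. \<Sum>l<m. (?\<alpha> i l)\<^sup>2) = (Q j)\<^sup>2"
        using sum_blocks[OF I m, of "\<lambda>q. (y q * norm (a q j))\<^sup>2"] by (simp add: Q_def sum_nonneg)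
      also have "\<dots> = m * (Q j / sqrt m)\<^sup>2" using m0 by (simp add: power_divide)
      also have "\<dots> \<le> m * (L j)\<^sup>2" using M0[of j] Q0[of j] by (intro mult_left_mono power_mono) (auto simp: L_def)
      finally show "(\<Sum>i\<in>I. \<Sum>l<m. (?\<alpha> i l)\<^sup>2) \<le> m * (L j)\<^sup>2" .
    qed auto
    moreover have "(\<Sum>i\<in>I. \<Sum>l<m. ?\<alpha> i l * ?\<beta> i l) = (\<Sum>q\<in>F. w q * (norm (a q j) * norm (b j q)))"
      unfolding sum_blocks[OF I m]
    proof (intro sum.cong refl)
      fix i l assume "l \<in> {..<m}"
      then have w: "w (m * i + l) = u i" by (simp add: w_def)
      have e: "u i powr (1 - 1 / p) * u i powr (1 / p) = u i"
        using u_nonneg[of i] by (cases "u i = 0") (simp_all add: powr_add[symmetric])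
      have g: "c * s * (d * t) = (c * d) * (s * t)" for c d s t :: real by simp
      show "?\<alpha> i l * ?\<beta> i l = w (m * i + l) * (norm (a (m * i + l) j) * norm (b j (m * i + l)))"
        unfolding w by (subst g) (simp only: e)
    qed
    ultimately show ?thesis by (simp add: h_def)
  qed
  have "norm (\<Sum>q\<in>F. of_real (w q / m) * (\<Sum>j\<in>J. a q j * b j q))
      \<le> (\<Sum>q\<in>F. \<Sum>j\<in>J. w q * (norm (a q j) * norm (b j q)) / m)"
  proof (rule order_trans[OF norm_sum], rule sum_mono)
    fix q
    have "norm (of_real (w q / m) * (\<Sum>j\<in>J. a q j * b j q)) \<le> w q / m * (\<Sum>j\<in>J. norm (a q j * b j q))"
    proof -
      have "norm (of_real (w q / m) * (\<Sum>j\<in>J. a q j * b j q)) = w q / m * norm (\<Sum>j\<in>J. a q j * b j q)"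
        unfolding norm_mult norm_of_real using w_nonneg[of q] by simp
      also have "\<dots> \<le> w q / m * (\<Sum>j\<in>J. norm (a q j * b j q))"
        using w_nonneg[of q] by (intro mult_left_mono norm_sum) simp
      finally show ?thesis .
    qed
    also have "\<dots> = (\<Sum>j\<in>J. w q * (norm (a q j) * norm (b j q)) / m)"
      by (simp add: sum_distrib_left norm_mult)
    finally show "norm (of_real (w q / m) * (\<Sum>j\<in>J. a q j * b j q)) \<le> (\<Sum>j\<in>J. w q * (norm (a q j) * norm (b j q)) / m)" .
  qed
  also have "\<dots> = (\<Sum>j\<in>J. (\<Sum>q\<in>F. w q * (norm (a q j) * norm (b j q))) / m)"
    by (subst sum.swap) (simp add: sum_divide_distrib)
  also have "\<dots> \<le> (\<Sum>j\<in>J. 3 * L j * h j)" by (rule sum_mono) (rule pt)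
  also have "\<dots> = 3 * ((\<Sum>j\<in>J. h j * M j) + (\<Sum>j\<in>J. h j * Q j) / sqrt m)"
    by (simp add: L_def sum_distrib_left sum.distrib[symmetric] sum_divide_distrib algebra_simps)
  also have "\<dots> \<le> 3 * (2 * A * real m powr (1 - 1 / p) * nu p J h
      + 2 * (real m powr (1 - 1 / p) * \<epsilon> powr (- (1 / p))) * A * nu p J h / sqrt m)"
  proof (intro mult_left_mono add_mono divide_right_mono)
    show "(\<Sum>j\<in>J. h j * M j) \<le> 2 * A * real m powr (1 - 1 / p) * nu p J h"
      using maximal_function_le[OF p F J AB a b, of h w k] h_nonneg w_nonneg k(1) J' m0 by (simp add: M_def sum_w)
    show "(\<Sum>j\<in>J. h j * Q j) \<le> 2 * (real m powr (1 - 1 / p) * \<epsilon> powr (- (1 / p))) * A * nu p J h"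
      unfolding Q_def by (rule dual_square_function_le[OF p F J AB a b h_nonneg _ _ y_dual]) auto
  qed auto
  also have "\<dots> = 6 * A * real m powr (1 - 1 / p) * (1 + \<epsilon> powr (- (1 / p)) / sqrt m) * nu p J h"
    by (simp add: algebra_simps)
  also have "\<dots> \<le> 6 * A * real m powr (1 - 1 / p) * (1 + \<epsilon> powr (- (1 / p)) / sqrt m) * (32 * B * \<epsilon> powr (1 / p))"
    by (intro mult_left_mono nu_h) (use AB in \<open>auto intro!: mult_nonneg_nonneg add_nonneg_nonneg\<close>)
  also have "\<dots> = 192 * A * B * (real m powr (1 - 1 / p) * \<epsilon> powr (1 / p) + real m powr (1 / 2 - 1 / p))"
  proof -
    have "\<epsilon> powr (- (1 / p)) * \<epsilon> powr (1 / p) = 1" using eps by (simp add: powr_add[symmetric])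
    moreover have "real m powr (1 - 1 / p) / sqrt m = real m powr (1 / 2 - 1 / p)"
      using m0 by (simp add: powr_half_sqrt[symmetric] powr_diff[symmetric])
    moreover have "6 * A * x * (1 + e / s) * (32 * B * e') = 192 * A * B * (x * e' + (e * e') * (x / s))" for x e s e' :: real
      by (simp add: algebra_simps)
    ultimately show ?thesis by (simp only: mult_1_left)
  qed
  finally show ?thesis .
qed

end

text \<open>The first argument fixes the scalar field of the matrices, which p, e, F, w and N do not
  determine. The bound is uniform over finite parts J of the tail, so it survives the limit; 0 is
  excluded because formal sums begin at index 1.\<close>

definition small_trace :: "'k::real_normed_field itself \<Rightarrow> real \<Rightarrow> real \<Rightarrow> nat set \<Rightarrow> (nat \<Rightarrow> real) \<Rightarrow> nat \<Rightarrow> bool" where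
  "small_trace _ p e F w N \<longleftrightarrow> finite F \<and> 0 \<notin> F \<and> (\<forall>i. 0 \<le> w i) \<and> sum w F = 1 \<and>
    (\<forall>J A B (a :: nat \<Rightarrow> nat \<Rightarrow> 'k) b. finite J \<longrightarrow> J \<subseteq> {N..} \<longrightarrow> 0 \<le> A \<longrightarrow> 0 \<le> B \<longrightarrow>
      matrix_bound p J F A a \<longrightarrow> matrix_bound p F J B b \<longrightarrow>
      norm (\<Sum>i\<in>F. of_real (w i) * (\<Sum>j\<in>J. a i j * b j i)) \<le> e * A * B)"

lemma sum_eq_l1:
  assumes "finite F" "\<And>n. 0 \<le> v n" "\<And>n. v n \<noteq> 0 \<Longrightarrow> n \<in> F"
  shows "sum v F = l1 v"
proof -
  obtain M where M: "F \<subseteq> {..<M}" using assms(1) finite_nat_bounded by auto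
  have z: "v n = 0" if "n \<notin> F" for n using assms(3)[of n] that by blast
  have "n \<notin> F" if "M \<le> n" for n using M that by auto
  then have "l1 v = (\<Sum>n<M. \<bar>v n\<bar>)" by (intro l1_eq_sum z)
  also have "\<dots> = sum v F" using M z assms(1,2) by (intro sum.mono_neutral_cong_right) auto
  finally show ?thesis by simp
qed

lemma small_trace_ge_2:
  assumes p: "2 \<le> p" and e: "0 < e"
  shows "\<exists>F w N. small_trace TYPE('k::{real_normed_field, real_inner}) p e F w N"
proof -
  define d where "d = (e / 4) powr p"
  have d: "d > 0" using e by (simp add: d_def)
  obtain u where u: "fsupp u" "\<And>i. 0 \<le> u i" "\<And>i. u i \<noteq> 0 \<Longrightarrow> 1 \<le> i" "l1 u = 1" "tn u \<le> d"
    using small_averages[OF d, of 1] by blast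
  obtain M where M: "\<forall>n\<ge>M. u n = 0" using u(1) by (auto simp: fsupp_def)
  define F where "F = {1..<M}"
  have uF: "n \<in> F" if "u n \<noteq> 0" for n
    using u(3)[OF that] M that by (auto simp: F_def) (meson not_le)
  have F: "finite F" "0 \<notin> F" by (simp_all add: F_def)
  have sum: "sum u F = 1" using sum_eq_l1[OF F(1) u(2) uF] u(4) by simp
  have "small_trace TYPE('k) p e F u (12 ^ card F)"
    unfolding small_trace_def
  proof (intro conjI allI impI F u sum)
    fix J A B and a b :: "nat \<Rightarrow> nat \<Rightarrow> 'k"
    assume J: "finite J" "J \<subseteq> {12 ^ card F..}" and AB: "0 \<le> A" "0 \<le> B"
      and ab: "matrix_bound p J F A a" "matrix_bound p F J B b"
    have "norm (\<Sum>i\<in>F. of_real (u i) * (\<Sum>j\<in>J. a i j * b j i)) \<le> 4 * A * B * tn (restr F u) powr (1 / p)"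
      by (rule trace_bound_ge_2[OF _ F(1) J(1) AB ab p u(2) sum J(2)]) (use p in simp)
    also have "\<dots> \<le> 4 * A * B * (e / 4)"
    proof (intro mult_left_mono)
      have "tn (restr F u) \<le> d" using tn.N_restr[OF u(1), of F] u(5) by simp
      then have "tn (restr F u) powr (1 / p) \<le> d powr (1 / p)"
        using p u(1) by (intro powr_mono2 tn.nonneg) auto
      also have "\<dots> = e / 4" using p e by (simp add: d_def powr_powr)
      finally show "tn (restr F u) powr (1 / p) \<le> e / 4" .
    qed (use AB in auto)
    finally show "norm (\<Sum>i\<in>F. of_real (u i) * (\<Sum>j\<in>J. a i j * b j i)) \<le> e * A * B" by (simp add: mult_ac)
  qed
  then show ?thesis by blast
qed

text \<open>The infimum of the norms of probability vectors on F is positive, since the norm bounds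
  each of the card F coordinates. A vector within a factor 2 of the infimum replaces a minimizer, so
  no compactness is involved. By homogeneity the infimum bounds all nonnegative g from
  below.\<close>

lemma near_minimal_average:
  assumes F: "finite F" and g0: "fsupp g0" "\<And>i. 0 \<le> g0 i" "\<And>i. g0 i \<noteq> 0 \<Longrightarrow> i \<in> F" "l1 g0 = 1"
  shows "\<exists>\<epsilon> v. 0 < \<epsilon> \<and> \<epsilon> \<le> tn g0 \<and> (\<forall>n. 0 \<le> v n) \<and> (\<forall>n. v n \<noteq> 0 \<longrightarrow> n \<in> F) \<and> sum v F = 1 \<and> tn v \<le> 2 * \<epsilon> \<and>
    (\<forall>g. (\<forall>n. 0 \<le> g n) \<longrightarrow> \<epsilon> * sum g F \<le> tn (restr F g))"
proof -
  define G where "G = {g. (\<forall>n. 0 \<le> g n) \<and> (\<forall>n. g n \<noteq> 0 \<longrightarrow> n \<in> F) \<and> sum g F = (1::real)}"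
  have G0: "g0 \<in> G" using g0 sum_eq_l1[OF F g0(2) g0(3)] by (auto simp: G_def)
  have F0: "card F > 0" using G0 F by (auto simp: G_def card_gt_0_iff)
  have fs: "fsupp g" if "g \<in> G" for g
  proof -
    have "restr F g n = g n" for n using that by (auto simp: G_def restr_apply)
    then have "restr F g = g" by blast
    then show ?thesis using fsupp_restr_finite[OF F, of g] by simp
  qed
  define \<epsilon> where "\<epsilon> = (INF g\<in>G. tn g)"
  have lb: "1 / card F \<le> tn g" if g: "g \<in> G" for g
  proof -
    have "1 = sum g F" using g by (simp add: G_def)
    also have "\<dots> \<le> of_nat (card F) * tn g"
    proof (rule sum_bounded_above)
      show "g i \<le> tn g" for i using abs_le_tn[OF fs[OF g], of i] by simp
    qed
    finally show ?thesis using F0 by (simp add: field_simps)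
  qed
  have eps0: "0 < \<epsilon>"
  proof -
    have "1 / card F \<le> \<epsilon>" unfolding \<epsilon>_def by (rule cINF_greatest) (use G0 lb in auto)
    moreover have "0 < 1 / real (card F)" using F0 by simp
    ultimately show ?thesis by linarith
  qed
  have bdd: "bdd_below (tn ` G)" by (rule bdd_belowI[of _ "1 / card F"]) (use lb in auto)
  have le: "\<epsilon> \<le> tn g" if "g \<in> G" for g unfolding \<epsilon>_def by (rule cINF_lower[OF bdd that])
  have "\<exists>v\<in>G. tn v < 2 * \<epsilon>"
    using cInf_lessD[of "tn ` G" "2 * \<epsilon>"] G0 eps0 by (auto simp: \<epsilon>_def)
  then obtain v where v: "v \<in> G" "tn v < 2 * \<epsilon>" by blast
  have "\<epsilon> * sum g F \<le> tn (restr F g)" if g: "\<And>n. 0 \<le> g n" for g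
  proof (cases "sum g F = 0")
    case True
    then show ?thesis using tn.nonneg[OF fsupp_restr_finite[OF F]] by simp
  next
    case False
    then have s: "sum g F > 0" using g by (simp add: less_le sum_nonneg)
    have "(\<lambda>n. 1 / sum g F * restr F g n) \<in> G"
      using s g by (auto simp: G_def restr_apply sum_divide_distrib[symmetric])
    then have "\<epsilon> \<le> 1 / sum g F * tn (restr F g)"
      using le tn_cmult[OF fsupp_restr_finite[OF F], of "1 / sum g F" g] s by fastforce
    then show ?thesis using s by (simp add: field_simps)
  qed
  then show ?thesis using eps0 le[OF G0] v by (intro exI[of _ \<epsilon>] exI[of _ v]) (auto simp: G_def)
qed

lemma small_trace_less_2:
  assumes p: "1 \<le> p" "p < 2" and e: "0 < e"
  shows "\<exists>F w N. small_trace TYPE('k::{real_normed_field, real_inner}) p e F w N"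
proof -
  have "1 / 2 - 1 / p < 0" using p by (simp add: field_simps)
  then have "(\<lambda>m. real m powr (1 / 2 - 1 / p)) \<longlonglongrightarrow> 0"
    by (rule tendsto_neg_powr[OF _ filterlim_real_sequentially])
  \<comment> \<open>As 384 = 2 * 192, each of the two terms of \<open>trace_bound_blocks\<close>
    contributes at most e / 2. The block length m is fixed by the second term, before the norm of
    the average is chosen for the first.\<close>
  then have "\<forall>\<^sub>F m in sequentially. real m powr (1 / 2 - 1 / p) < e / 384"
    using e by (intro order_tendstoD) auto
  then obtain m0 where m0: "\<And>m. m \<ge> m0 \<Longrightarrow> real m powr (1 / 2 - 1 / p) < e / 384"
    by (auto simp: eventually_sequentially)
  define m where "m = max 1 m0"
  have m: "1 \<le> m" "real m powr (1 / 2 - 1 / p) < e / 384" using m0[of m] by (auto simp: m_def)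
  define d where "d = (e / (384 * real m powr (1 - 1 / p))) powr p"
  have mp: "real m powr (1 - 1 / p) > 0" using m by simp
  have d: "d > 0" using e mp by (simp add: d_def)
  obtain g0 where g0: "fsupp g0" "\<And>i. 0 \<le> g0 i" "\<And>i. g0 i \<noteq> 0 \<Longrightarrow> m \<le> i" "l1 g0 = 1" "tn g0 \<le> d"
    using small_averages[OF d, of m] by blast
  obtain M where M: "\<forall>n\<ge>M. g0 n = 0" using g0(1) by (auto simp: fsupp_def)
  \<comment> \<open>Leaving out block 0 puts F into [m, infinity), as compression demands. Every
    block that meets the support of g0 is included, because n div m is at most n, which is below
    M.\<close>
  define I where "I = {1..<M + 1}"
  define F where "F = {n. n div m \<in> I}"
  have I: "finite I" by (simp add: I_def)
  have F: "finite F" unfolding F_def by (rule finite_blocks[OF I m(1)])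
  have Fm: "m \<le> n" if "n \<in> F" for n
    using that m(1) div_greater_zero_iff[of n m] by (auto simp: F_def I_def)
  have gF: "n \<in> F" if "g0 n \<noteq> 0" for n
  proof -
    have "m \<le> n" "n < M" using g0(3)[OF that] M that by (auto simp: not_le[symmetric])
    then have "1 \<le> n div m" "n div m < M + 1"
      using m(1) div_greater_zero_iff[of n m] div_le_dividend[of n m] by linarith+
    then show ?thesis by (simp add: F_def I_def)
  qed
  obtain \<epsilon> v where ev: "0 < \<epsilon>" "\<epsilon> \<le> tn g0" "\<And>n. 0 \<le> v n" "\<And>n. v n \<noteq> 0 \<Longrightarrow> n \<in> F" "sum v F = 1" "tn v \<le> 2 * \<epsilon>"
    "\<And>g. (\<And>n. 0 \<le> g n) \<Longrightarrow> \<epsilon> * sum g F \<le> tn (restr F g)"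
    using near_minimal_average[OF F g0(1,2) gF g0(4)] by blast
  let ?w = "\<lambda>n. block_sum m v (n div m) / m"
  have "small_trace TYPE('k) p e F ?w (12 ^ card F)"
    unfolding small_trace_def
  proof (intro conjI allI impI F)
    show "0 \<notin> F" using Fm[of 0] m(1) by auto
    show "0 \<le> ?w i" for i using ev(3) by (simp add: block_sum_def sum_nonneg)
    show "sum ?w F = 1"
    proof -
      have "sum ?w F = (\<Sum>i\<in>I. \<Sum>j<m. block_sum m v i / m)"
        unfolding F_def sum_blocks[OF I m(1)] by (intro sum.cong refl) (use m in simp)
      also have "\<dots> = (\<Sum>i\<in>I. block_sum m v i)" using m by simp
      also have "\<dots> = sum v F" unfolding F_def sum_blocks[OF I m(1)] by (simp add: block_sum_def)
      finally show ?thesis using ev by simp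
    qed
    fix J A B and a b :: "nat \<Rightarrow> nat \<Rightarrow> 'k"
    assume J: "finite J" "J \<subseteq> {12 ^ card F..}" and AB: "0 \<le> A" "0 \<le> B"
      and ab: "matrix_bound p J F A a" "matrix_bound p F J B b"
    have "norm (\<Sum>q\<in>F. of_real (block_weight m v q / m) * (\<Sum>j\<in>J. a q j * b j q))
      \<le> 192 * A * B * (real m powr (1 - 1 / p) * \<epsilon> powr (1 / p) + real m powr (1 / 2 - 1 / p))"
      unfolding F_def
      by (rule trace_bound_blocks[OF p(1) m(1) I J(1) AB ev(1) ev(3)])
         (use ev(4-7) Fm J ab in \<open>auto simp: F_def\<close>)
    also have "\<dots> \<le> 192 * A * B * (e / 384 + e / 384)"
    proof (intro mult_left_mono add_mono)
      have "\<epsilon> powr (1 / p) \<le> d powr (1 / p)" using ev(1,2) g0(5) p by (intro powr_mono2) auto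
      also have "\<dots> = e / (384 * real m powr (1 - 1 / p))" using p e mp by (simp add: d_def powr_powr)
      finally show "real m powr (1 - 1 / p) * \<epsilon> powr (1 / p) \<le> e / 384" using mp by (simp add: field_simps)
      show "real m powr (1 / 2 - 1 / p) \<le> e / 384" using m by simp
    qed (use AB in auto)
    finally show "norm (\<Sum>i\<in>F. of_real (?w i) * (\<Sum>j\<in>J. a i j * b j i)) \<le> e * A * B"
      by (simp add: block_weight_def mult_ac)
  qed
  then show ?thesis by blast
qed

lemma small_trace_exists:
  assumes "1 \<le> p" "0 < e"
  shows "\<exists>F w N. small_trace TYPE('k::{real_normed_field, real_inner}) p e F w N"
  using small_trace_ge_2[of p e] small_trace_less_2[of p e] assms by (cases "2 \<le> p") auto

subsection \<open>Operators between normed spaces\<close>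

text \<open>The axioms of \<open>banach_space\<close> apart from completeness. Operator calculus at
  this level serves \<open>Tp p\<close>, \<open>scalars\<close> and the module of cocycles
  alike.\<close>

locale nspace =
  fixes X :: "('k::real_normed_field, 'v, 'm) normed_space_scheme" (structure)
  assumes is_module: "Module.module (scalars :: ('k, 'k) normed_space) X"
    and nrm_nonneg: "x \<in> carrier X \<Longrightarrow> 0 \<le> nrm X x"
    and nrm_eq_0_iff: "x \<in> carrier X \<Longrightarrow> nrm X x = 0 \<longleftrightarrow> x = \<zero>"
    and nrm_add_le: "x \<in> carrier X \<Longrightarrow> y \<in> carrier X \<Longrightarrow> nrm X (x \<oplus> y) \<le> nrm X x + nrm X y"
    and nrm_smult: "x \<in> carrier X \<Longrightarrow> nrm X (c \<odot> x) = norm c * nrm X x"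

lemma scalars_simps [simp]:
  "carrier scalars = UNIV" "x \<oplus>\<^bsub>scalars\<^esub> y = x + y" "\<zero>\<^bsub>scalars\<^esub> = 0" "\<one>\<^bsub>scalars\<^esub> = 1"
  "x \<otimes>\<^bsub>scalars\<^esub> y = x * y" "c \<odot>\<^bsub>scalars\<^esub> x = c * x" "nrm scalars = norm"
  by (simp_all add: scalars_def)

lemma scalars_cring: "cring (scalars :: ('k::real_normed_field, 'k) normed_space)"
  by (rule cringI, rule abelian_groupI, simp_all add: algebra_simps, metis add.left_inverse add.commute)
     (unfold_locales, simp_all add: algebra_simps)

lemma scalars_nspace: "nspace (scalars :: ('k::real_normed_field, 'k) normed_space)"
proof (rule nspace.intro)
  show "Module.module (scalars :: ('k, 'k) normed_space) (scalars :: ('k, 'k) normed_space)"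
    by (rule moduleI) (auto intro: scalars_cring cring.axioms ring.is_abelian_group simp: algebra_simps cring.axioms)
qed (auto simp: norm_mult norm_triangle_ineq)

lemma scalars_minus: "x \<ominus>\<^bsub>scalars\<^esub> y = x - (y :: 'k::real_normed_field)"
proof -
  interpret cring "scalars :: ('k, 'k) normed_space" by (rule scalars_cring)
  have "\<ominus>\<^bsub>scalars\<^esub> y = - y" by (rule minus_equality) simp_all
  then show ?thesis by (simp add: a_minus_def)
qed

context nspace
begin

interpretation module "scalars :: ('k, 'k) normed_space" X by (rule is_module)

lemma nrm_zero: "nrm X \<zero> = 0"
  using nrm_eq_0_iff by simp

lemma smult_minus_one_add: "x \<in> carrier X \<Longrightarrow> ((- 1) \<odot> x) \<oplus> x = \<zero>"
  using smult_l_distr[of "- 1" 1 x] smult_l_null[of x] smult_one[of x] by simp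

lemma minus_eq_smult: "x \<in> carrier X \<Longrightarrow> \<ominus> x = (- 1) \<odot> x"
  by (rule minus_equality) (auto simp: smult_minus_one_add)

lemma nrm_normalize:
  assumes "x \<in> carrier X" "nrm X x \<noteq> 0"
  shows "nrm X (of_real (inverse (nrm X x)) \<odot> x) = 1"
  using assms nrm_nonneg[OF assms(1)] by (simp add: nrm_smult norm_inverse)

end

locale nspace_pair = X: nspace X + Y: nspace Y
  for X :: "('k::real_normed_field, 'v, 'm) normed_space_scheme" (structure)
    and Y :: "('k, 'w, 'n) normed_space_scheme" (structure)
begin

interpretation X: module "scalars :: ('k, 'k) normed_space" X by (rule X.is_module)
interpretation Y: module "scalars :: ('k, 'k) normed_space" Y by (rule Y.is_module)

abbreviation "L \<equiv> bounded_linear_maps X Y"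
abbreviation "opn \<equiv> nrm (operator_space X Y)"

lemma L_closed: "f \<in> L \<Longrightarrow> x \<in> carrier X \<Longrightarrow> f x \<in> carrier Y"
  by (auto simp: bounded_linear_maps_def)

lemma L_add: "f \<in> L \<Longrightarrow> x \<in> carrier X \<Longrightarrow> y \<in> carrier X \<Longrightarrow> f (x \<oplus>\<^bsub>X\<^esub> y) = f x \<oplus>\<^bsub>Y\<^esub> f y"
  by (auto simp: bounded_linear_maps_def)

lemma L_smult: "f \<in> L \<Longrightarrow> x \<in> carrier X \<Longrightarrow> f (c \<odot>\<^bsub>X\<^esub> x) = c \<odot>\<^bsub>Y\<^esub> f x"
  by (auto simp: bounded_linear_maps_def)

lemma L_zero: "f \<in> L \<Longrightarrow> f \<zero>\<^bsub>X\<^esub> = \<zero>\<^bsub>Y\<^esub>"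
  using L_smult[of f "\<zero>\<^bsub>X\<^esub>" 0] L_closed[of f "\<zero>\<^bsub>X\<^esub>"] X.smult_l_null[of "\<zero>\<^bsub>X\<^esub>"] Y.smult_l_null[of "f \<zero>\<^bsub>X\<^esub>"]
  by simp

lemma LI:
  assumes "\<And>x. x \<in> carrier X \<Longrightarrow> f x \<in> carrier Y"
    "\<And>x y. x \<in> carrier X \<Longrightarrow> y \<in> carrier X \<Longrightarrow> f (x \<oplus>\<^bsub>X\<^esub> y) = f x \<oplus>\<^bsub>Y\<^esub> f y"
    "\<And>c x. x \<in> carrier X \<Longrightarrow> f (c \<odot>\<^bsub>X\<^esub> x) = c \<odot>\<^bsub>Y\<^esub> f x"
    "\<And>x. x \<in> carrier X \<Longrightarrow> nrm Y (f x) \<le> K * nrm X x"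
  shows "restrict f (carrier X) \<in> L"
proof -
  have "\<exists>K. \<forall>x\<in>carrier X. nrm Y (f x) \<le> K * nrm X x" using assms(4) by blast
  then show ?thesis using assms(1-3) by (simp add: bounded_linear_maps_def)
qed

lemma L_bound_exists:
  assumes "f \<in> L" shows "\<exists>K\<ge>0. \<forall>x\<in>carrier X. nrm Y (f x) \<le> K * nrm X x"
proof -
  obtain K where K: "\<forall>x\<in>carrier X. nrm Y (f x) \<le> K * nrm X x"
    using assms by (auto simp: bounded_linear_maps_def)
  have "nrm Y (f x) \<le> \<bar>K\<bar> * nrm X x" if "x \<in> carrier X" for x
  proof -
    have "K * nrm X x \<le> \<bar>K\<bar> * nrm X x" using X.nrm_nonneg[OF that] by (intro mult_right_mono) auto
    then show ?thesis using K that by fastforce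
  qed
  then show ?thesis by (intro exI[of _ "\<bar>K\<bar>"]) auto
qed

lemma opn_bdd:
  assumes "f \<in> L" shows "bdd_above ((\<lambda>x. nrm Y (f x)) ` {x \<in> carrier X. nrm X x \<le> 1})"
proof -
  obtain K where K: "K \<ge> 0" "\<forall>x\<in>carrier X. nrm Y (f x) \<le> K * nrm X x" using L_bound_exists[OF assms] by auto
  have "nrm Y (f x) \<le> K" if "x \<in> carrier X" "nrm X x \<le> 1" for x
    using K that mult_left_mono[of "nrm X x" 1 K] by fastforce
  then show ?thesis by (intro bdd_aboveI[of _ K]) auto
qed

lemma opn_le:
  assumes "0 \<le> K" "\<And>x. x \<in> carrier X \<Longrightarrow> nrm Y (f x) \<le> K * nrm X x"
  shows "opn f \<le> K"
proof -
  have "(SUP x\<in>{x \<in> carrier X. nrm X x \<le> 1}. nrm Y (f x)) \<le> K"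
  proof (rule cSUP_least)
    show "{x \<in> carrier X. nrm X x \<le> 1} \<noteq> {}" using X.nrm_zero by (auto intro: exI[of _ "\<zero>\<^bsub>X\<^esub>"])
    show "nrm Y (f x) \<le> K" if "x \<in> {x \<in> carrier X. nrm X x \<le> 1}" for x
      using that assms(2)[of x] mult_left_mono[OF _ assms(1), of "nrm X x" 1] by fastforce
  qed
  then show ?thesis by (simp add: operator_space_def)
qed

lemma opn_bound:
  assumes f: "f \<in> L" and x: "x \<in> carrier X" shows "nrm Y (f x) \<le> opn f * nrm X x"
proof (cases "nrm X x = 0")
  case True
  then have "x = \<zero>\<^bsub>X\<^esub>" using X.nrm_eq_0_iff x by simp
  then show ?thesis using True L_zero[OF f] Y.nrm_zero by simp
next
  case False
  then have pos: "nrm X x > 0" using X.nrm_nonneg[OF x] by simp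
  let ?y = "of_real (inverse (nrm X x)) \<odot>\<^bsub>X\<^esub> x"
  have y: "?y \<in> carrier X" using x by simp
  have "nrm Y (f ?y) \<le> opn f"
    unfolding operator_space_def using y X.nrm_normalize[OF x False] opn_bdd[OF f]
    by (auto intro!: cSUP_upper)
  moreover have "nrm Y (f ?y) = inverse (nrm X x) * nrm Y (f x)"
    using L_smult[OF f x] Y.nrm_smult[OF L_closed[OF f x]] pos by (simp add: norm_inverse)
  ultimately have "inverse (nrm X x) * nrm Y (f x) \<le> opn f" by simp
  then show ?thesis using pos by (simp add: inverse_eq_divide pos_divide_le_eq)
qed

lemma opn_nonneg: "f \<in> L \<Longrightarrow> 0 \<le> opn f"
proof -
  assume f: "f \<in> L"
  have "nrm Y (f \<zero>\<^bsub>X\<^esub>) \<le> opn f"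
    unfolding operator_space_def using X.nrm_zero opn_bdd[OF f] by (auto intro!: cSUP_upper)
  then show ?thesis using L_zero[OF f] Y.nrm_zero by simp
qed

lemma add_in_L: assumes "f \<in> L" "g \<in> L" shows "(\<lambda>x\<in>carrier X. f x \<oplus>\<^bsub>Y\<^esub> g x) \<in> L"
proof (rule LI)
  show "nrm Y (f x \<oplus>\<^bsub>Y\<^esub> g x) \<le> (opn f + opn g) * nrm X x" if "x \<in> carrier X" for x
    using Y.nrm_add_le[of "f x" "g x"] opn_bound[of f x] opn_bound[of g x] assms that L_closed
    by (fastforce simp: algebra_simps)
qed (use assms in \<open>auto simp: L_closed L_add L_smult Y.add.m_ac Y.smult_r_distr\<close>)

lemma smult_in_L: assumes "f \<in> L" shows "(\<lambda>x\<in>carrier X. c \<odot>\<^bsub>Y\<^esub> f x) \<in> L"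
proof (rule LI)
  show "nrm Y (c \<odot>\<^bsub>Y\<^esub> f x) \<le> (norm c * opn f) * nrm X x" if "x \<in> carrier X" for x
    using Y.nrm_smult[OF L_closed[OF assms that], of c] mult_left_mono[OF opn_bound[OF assms that], of "norm c"]
    by (simp add: mult_ac)
next
  show "c \<odot>\<^bsub>Y\<^esub> f (d \<odot>\<^bsub>X\<^esub> x) = d \<odot>\<^bsub>Y\<^esub> (c \<odot>\<^bsub>Y\<^esub> f x)" if "x \<in> carrier X" for d x
    using that assms Y.smult_assoc1[of c d "f x"] Y.smult_assoc1[of d c "f x"] by (simp add: L_smult L_closed mult.commute)
qed (use assms in \<open>auto simp: L_closed L_add Y.smult_r_distr\<close>)

lemma zero_in_L: "(\<lambda>x\<in>carrier X. \<zero>\<^bsub>Y\<^esub>) \<in> L"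
  by (rule LI[where K = 0]) (simp_all add: Y.nrm_zero)

lemma operator_space_abelian_group: "abelian_group (operator_space X Y)"
proof (rule abelian_groupI)
  fix f assume "f \<in> carrier (operator_space X Y)"
  then have f: "f \<in> L" by (simp add: operator_space_def)
  show "\<exists>g\<in>carrier (operator_space X Y). g \<oplus>\<^bsub>operator_space X Y\<^esub> f = \<zero>\<^bsub>operator_space X Y\<^esub>"
    by (intro bexI[of _ "\<lambda>x\<in>carrier X. (- 1) \<odot>\<^bsub>Y\<^esub> f x"])
       (auto simp: operator_space_def smult_in_L f Y.smult_minus_one_add L_closed intro!: restrict_ext)
  have "f = restrict f (carrier X)" using f by (auto simp: bounded_linear_maps_def PiE_def extensional_restrict)
  then show "\<zero>\<^bsub>operator_space X Y\<^esub> \<oplus>\<^bsub>operator_space X Y\<^esub> f = f"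
    using f by (simp add: operator_space_def L_closed cong: restrict_cong)
qed (auto simp: operator_space_def add_in_L zero_in_L L_closed Y.add.m_ac intro!: restrict_ext)

text \<open>Subtraction in HOL-Algebra goes through an inverse given by a description, so it is
  identified pointwise before distances between operators are computed.\<close>

lemma operator_space_minus:
  assumes f: "f \<in> L" and g: "g \<in> L"
  shows "f \<ominus>\<^bsub>operator_space X Y\<^esub> g = (\<lambda>x\<in>carrier X. f x \<ominus>\<^bsub>Y\<^esub> g x)"
proof -
  interpret O: abelian_group "operator_space X Y" by (rule operator_space_abelian_group)
  have "\<ominus>\<^bsub>operator_space X Y\<^esub> g = (\<lambda>x\<in>carrier X. (- 1) \<odot>\<^bsub>Y\<^esub> g x)"
    by (rule O.minus_equality)
       (auto simp: operator_space_def smult_in_L g Y.smult_minus_one_add L_closed intro!: restrict_ext)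
  then show ?thesis
    by (auto simp: a_minus_def operator_space_def Y.minus_eq_smult L_closed g intro!: restrict_ext)
qed

lemma minus_in_L: "f \<in> L \<Longrightarrow> g \<in> L \<Longrightarrow> (\<lambda>x\<in>carrier X. f x \<ominus>\<^bsub>Y\<^esub> g x) \<in> L"
  using abelian_group.minus_closed[OF operator_space_abelian_group, of f g] operator_space_minus
  by (simp add: operator_space_def)

end

section \<open>Bounded, finite-rank and approximable operators on one space\<close>

context nspace
begin

sublocale XX: nspace_pair X X by unfold_locales

interpretation module "scalars :: ('k, 'k) normed_space" X by (rule is_module)

abbreviation "BL \<equiv> bounded_linear_maps X X"
abbreviation "AO \<equiv> carrier (approximable_operators X)"
abbreviation "bn \<equiv> nrm (operator_space X X)"
abbreviation "cmp \<equiv> compose (carrier X)"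
abbreviation "idX \<equiv> (\<lambda>x\<in>carrier X. x)"

lemma bounded_operators_simps:
  "carrier (bounded_operators X) = BL" "mult (bounded_operators X) = cmp"
  "add (bounded_operators X) = add (operator_space X X)" "nrm (bounded_operators X) = bn"
  "smult (bounded_operators X) = smult (operator_space X X)"
  by (simp_all add: bounded_operators_def operator_space_def)

lemma approximable_operators_simps:
  "mult (approximable_operators X) = cmp"
  "add (approximable_operators X) = add (operator_space X X)" "nrm (approximable_operators X) = bn"
  "smult (approximable_operators X) = smult (operator_space X X)"
  by (simp_all add: approximable_operators_def bounded_operators_simps)

lemma bounded_operators_minus: "f \<ominus>\<^bsub>bounded_operators X\<^esub> g = f \<ominus>\<^bsub>operator_space X X\<^esub> g"
  by (simp add: a_minus_def a_inv_def bounded_operators_def operator_space_def)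

lemma AO_iff: "f \<in> AO \<longleftrightarrow> f \<in> BL \<and> (\<forall>e>0. \<exists>g\<in>finite_rank_operators X. bn (f \<ominus>\<^bsub>operator_space X X\<^esub> g) < e)"
  by (simp add: approximable_operators_def bounded_operators_simps bounded_operators_minus)

lemma AO_subset: "f \<in> AO \<Longrightarrow> f \<in> BL"
  by (simp add: AO_iff)

lemma FR_subset: "f \<in> finite_rank_operators X \<Longrightarrow> f \<in> BL"
  by (simp add: finite_rank_operators_def)

lemma comp_in_BL:
  assumes "f \<in> BL" "g \<in> BL" shows "cmp f g \<in> BL"
  unfolding compose_def
proof (rule XX.LI)
  show "nrm X (f (g x)) \<le> (bn f * bn g) * nrm X x" if "x \<in> carrier X" for x
    using XX.opn_bound[OF assms(1), of "g x"] mult_left_mono[OF XX.opn_bound[OF assms(2) that] XX.opn_nonneg[OF assms(1)]]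
      XX.L_closed[OF assms(2) that] by (simp add: mult_ac)
qed (use assms in \<open>auto simp: XX.L_closed XX.L_add XX.L_smult\<close>)

lemma bn_comp_le:
  assumes "f \<in> BL" "g \<in> BL" shows "bn (cmp f g) \<le> bn f * bn g"
proof (rule XX.opn_le)
  show "nrm X (cmp f g x) \<le> (bn f * bn g) * nrm X x" if "x \<in> carrier X" for x
    using XX.opn_bound[OF assms(1), of "g x"] mult_left_mono[OF XX.opn_bound[OF assms(2) that] XX.opn_nonneg[OF assms(1)]]
      XX.L_closed[OF assms(2) that] that by (simp add: mult_ac compose_def)
qed (use assms XX.opn_nonneg in simp)

lemma id_in_BL: "idX \<in> BL"
  by (rule XX.LI[where K = 1]) auto

lemma bn_id_le: "bn idX \<le> 1"
  by (rule XX.opn_le) auto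

lemma BL_extensional: "f \<in> BL \<Longrightarrow> restrict f (carrier X) = f"
  by (auto simp: bounded_linear_maps_def PiE_def extensional_restrict)

lemma comp_assoc: "f \<in> BL \<Longrightarrow> g \<in> BL \<Longrightarrow> k \<in> BL \<Longrightarrow> cmp (cmp f g) k = cmp f (cmp g k)"
  by (auto simp: compose_def XX.L_closed intro!: restrict_ext)

lemma comp_id: "f \<in> BL \<Longrightarrow> cmp idX f = f" "f \<in> BL \<Longrightarrow> cmp f idX = f"
  using BL_extensional[of f] by (auto simp: compose_def XX.L_closed cong: restrict_cong)

lemma add_BL: "f \<in> BL \<Longrightarrow> g \<in> BL \<Longrightarrow> f \<oplus>\<^bsub>operator_space X X\<^esub> g \<in> BL"
  using XX.add_in_L by (simp add: operator_space_def)

lemma smult_BL: "f \<in> BL \<Longrightarrow> c \<odot>\<^bsub>operator_space X X\<^esub> f \<in> BL"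
  using XX.smult_in_L by (simp add: operator_space_def)

lemma comp_add:
  "f \<in> BL \<Longrightarrow> g \<in> BL \<Longrightarrow> k \<in> BL \<Longrightarrow> cmp (f \<oplus>\<^bsub>operator_space X X\<^esub> g) k = cmp f k \<oplus>\<^bsub>operator_space X X\<^esub> cmp g k"
  "f \<in> BL \<Longrightarrow> g \<in> BL \<Longrightarrow> k \<in> BL \<Longrightarrow> cmp k (f \<oplus>\<^bsub>operator_space X X\<^esub> g) = cmp k f \<oplus>\<^bsub>operator_space X X\<^esub> cmp k g"
  by (auto simp: compose_def operator_space_def XX.L_closed XX.L_add intro!: restrict_ext)

lemma comp_smult:
  "f \<in> BL \<Longrightarrow> k \<in> BL \<Longrightarrow> cmp (c \<odot>\<^bsub>operator_space X X\<^esub> f) k = c \<odot>\<^bsub>operator_space X X\<^esub> cmp f k"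
  "f \<in> BL \<Longrightarrow> k \<in> BL \<Longrightarrow> cmp k (c \<odot>\<^bsub>operator_space X X\<^esub> f) = c \<odot>\<^bsub>operator_space X X\<^esub> cmp k f"
  by (auto simp: compose_def operator_space_def XX.L_closed XX.L_smult intro!: restrict_ext)

lemma bn_add_le: "f \<in> BL \<Longrightarrow> g \<in> BL \<Longrightarrow> bn (f \<oplus>\<^bsub>operator_space X X\<^esub> g) \<le> bn f + bn g"
proof (rule XX.opn_le)
  assume fg: "f \<in> BL" "g \<in> BL"
  show "0 \<le> bn f + bn g" using fg XX.opn_nonneg by simp
  show "nrm X ((f \<oplus>\<^bsub>operator_space X X\<^esub> g) x) \<le> (bn f + bn g) * nrm X x" if "x \<in> carrier X" for x
    using nrm_add_le[of "f x" "g x"] XX.opn_bound[of f x] XX.opn_bound[of g x] fg that XX.L_closed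
    by (fastforce simp: algebra_simps operator_space_def)
qed

lemma minus_distrib:
  assumes "f \<in> BL" "g \<in> BL" "f' \<in> BL" "g' \<in> BL"
  shows "(f \<oplus>\<^bsub>operator_space X X\<^esub> g) \<ominus>\<^bsub>operator_space X X\<^esub> (f' \<oplus>\<^bsub>operator_space X X\<^esub> g')
    = (f \<ominus>\<^bsub>operator_space X X\<^esub> f') \<oplus>\<^bsub>operator_space X X\<^esub> (g \<ominus>\<^bsub>operator_space X X\<^esub> g')"
proof -
  interpret O: abelian_group "operator_space X X" by (rule XX.operator_space_abelian_group)
  have "h \<in> carrier (operator_space X X)" if "h \<in> BL" for h using that by (simp add: operator_space_def)
  then show ?thesis using assms by (simp add: a_minus_def O.minus_add O.add.m_ac)
qed

lemma finite_rank_comp: "g \<in> finite_rank_operators X \<Longrightarrow> b \<in> BL \<Longrightarrow> cmp g b \<in> finite_rank_operators X"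
  unfolding finite_rank_operators_def
  using comp_in_BL[of g b] XX.L_closed[of b] by (auto simp: compose_def)

lemma span_extend:
  assumes "finite B'" "B \<subseteq> B'" "B' \<subseteq> carrier X"
  shows "\<exists>d. (\<Oplus>b\<in>B. c b \<odot> b) = (\<Oplus>b\<in>B'. d b \<odot> b)"
proof
  let ?d = "\<lambda>b. if b \<in> B then c b else 0"
  show "(\<Oplus>b\<in>B. c b \<odot> b) = (\<Oplus>b\<in>B'. ?d b \<odot> b)"
    by (rule add.finprod_mono_neutral_cong_left) (use assms in \<open>auto simp: smult_l_null[simplified]\<close>)
qed

lemma finite_rank_add:
  assumes "f \<in> finite_rank_operators X" "g \<in> finite_rank_operators X"
  shows "f \<oplus>\<^bsub>operator_space X X\<^esub> g \<in> finite_rank_operators X"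
proof -
  obtain B where B: "finite B" "B \<subseteq> carrier X" "\<And>x. x \<in> carrier X \<Longrightarrow> \<exists>c. f x = (\<Oplus>b\<in>B. c b \<odot> b)"
    using assms(1) by (auto simp: finite_rank_operators_def)
  obtain C where C: "finite C" "C \<subseteq> carrier X" "\<And>x. x \<in> carrier X \<Longrightarrow> \<exists>c. g x = (\<Oplus>b\<in>C. c b \<odot> b)"
    using assms(2) by (auto simp: finite_rank_operators_def)
  have BC: "finite (B \<union> C)" "B \<union> C \<subseteq> carrier X" using B C by auto
  have "\<exists>c. f x \<oplus> g x = (\<Oplus>b\<in>B \<union> C. c b \<odot> b)" if x: "x \<in> carrier X" for x
  proof -
    obtain c where c: "f x = (\<Oplus>b\<in>B \<union> C. c b \<odot> b)"
      using B(3)[OF x] span_extend[OF BC(1) _ BC(2), of B] by (metis Un_upper1)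
    obtain d where d: "g x = (\<Oplus>b\<in>B \<union> C. d b \<odot> b)"
      using C(3)[OF x] span_extend[OF BC(1) _ BC(2), of C] by (metis Un_upper2)
    have "f x \<oplus> g x = (\<Oplus>b\<in>B \<union> C. c b \<odot> b \<oplus> d b \<odot> b)"
      unfolding c d by (rule finsum_addf[symmetric]) (use BC in auto)
    also have "\<dots> = (\<Oplus>b\<in>B \<union> C. (c b + d b) \<odot> b)"
      by (rule finsum_cong') (use BC smult_l_distr in auto)
    finally show ?thesis by (rule exI[of _ "\<lambda>b. c b + d b"])
  qed
  then show ?thesis
    using add_BL[OF FR_subset[OF assms(1)] FR_subset[OF assms(2)]] BC
    unfolding finite_rank_operators_def by (auto simp: operator_space_def intro!: exI[of _ "B \<union> C"])
qed

lemma finite_rank_approximable: "f \<in> finite_rank_operators X \<Longrightarrow> f \<in> AO"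
proof -
  assume f: "f \<in> finite_rank_operators X"
  interpret O: abelian_group "operator_space X X" by (rule XX.operator_space_abelian_group)
  have "f \<in> carrier (operator_space X X)" using FR_subset[OF f] by (simp add: operator_space_def)
  then have e: "f \<ominus>\<^bsub>operator_space X X\<^esub> f = \<zero>\<^bsub>operator_space X X\<^esub>" by (simp add: O.r_neg a_minus_def)
  have "bn \<zero>\<^bsub>operator_space X X\<^esub> \<le> 0" by (rule XX.opn_le) (simp_all add: operator_space_def nrm_zero)
  then have "bn (f \<ominus>\<^bsub>operator_space X X\<^esub> f) < d" if "0 < d" for d using e that by simp
  then show ?thesis using f FR_subset by (auto simp: AO_iff)
qed

lemma AO_comp:
  assumes "c \<in> AO" "b \<in> BL" shows "cmp c b \<in> AO"
  unfolding AO_iff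
proof (intro conjI allI impI)
  show "cmp c b \<in> BL" using comp_in_BL AO_subset assms by simp
  fix e :: real assume e: "0 < e"
  define e' where "e' = e / (bn b + 1)"
  have pos: "bn b + 1 > 0" using XX.opn_nonneg[OF assms(2)] by simp
  then have "e' > 0" using e by (simp add: e'_def)
  then obtain g where g: "g \<in> finite_rank_operators X" "bn (c \<ominus>\<^bsub>operator_space X X\<^esub> g) < e'"
    using assms(1) by (auto simp: AO_iff)
  have cg: "c \<in> BL" "g \<in> BL" using assms AO_subset FR_subset g by auto
  have "cmp c b \<ominus>\<^bsub>operator_space X X\<^esub> cmp g b = cmp (c \<ominus>\<^bsub>operator_space X X\<^esub> g) b"
    unfolding XX.operator_space_minus[OF comp_in_BL[OF cg(1) assms(2)] comp_in_BL[OF cg(2) assms(2)]]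
       XX.operator_space_minus[OF cg]
    using assms(2) by (auto simp: compose_def XX.L_closed intro!: restrict_ext)
  then have "bn (cmp c b \<ominus>\<^bsub>operator_space X X\<^esub> cmp g b) \<le> bn (c \<ominus>\<^bsub>operator_space X X\<^esub> g) * bn b"
    using bn_comp_le[of "c \<ominus>\<^bsub>operator_space X X\<^esub> g" b] XX.minus_in_L[OF cg] XX.operator_space_minus[OF cg] assms(2) by simp
  also have "\<dots> \<le> e' * bn b" using g(2) XX.opn_nonneg[OF assms(2)] by (intro mult_right_mono) auto
  also have "\<dots> < e" using e pos by (simp add: e'_def field_simps)
  finally show "\<exists>g\<in>finite_rank_operators X. bn (cmp c b \<ominus>\<^bsub>operator_space X X\<^esub> g) < e"
    using finite_rank_comp[OF g(1) assms(2)] by blast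
qed

lemma AO_add:
  assumes "c \<in> AO" "d \<in> AO" shows "c \<oplus>\<^bsub>operator_space X X\<^esub> d \<in> AO"
  unfolding AO_iff
proof (intro conjI allI impI)
  show "c \<oplus>\<^bsub>operator_space X X\<^esub> d \<in> BL" using add_BL AO_subset assms by simp
  fix e :: real assume e: "0 < e"
  obtain g where g: "g \<in> finite_rank_operators X" "bn (c \<ominus>\<^bsub>operator_space X X\<^esub> g) < e / 2"
    using assms(1) e half_gt_zero[OF e] unfolding AO_iff by blast
  obtain h where h: "h \<in> finite_rank_operators X" "bn (d \<ominus>\<^bsub>operator_space X X\<^esub> h) < e / 2"
    using assms(2) e half_gt_zero[OF e] unfolding AO_iff by blast
  have BL: "c \<in> BL" "d \<in> BL" "g \<in> BL" "h \<in> BL" using assms g h AO_subset FR_subset by auto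
  have m: "c \<ominus>\<^bsub>operator_space X X\<^esub> g \<in> BL" "d \<ominus>\<^bsub>operator_space X X\<^esub> h \<in> BL"
    using BL XX.minus_in_L XX.operator_space_minus by simp_all
  have "bn ((c \<oplus>\<^bsub>operator_space X X\<^esub> d) \<ominus>\<^bsub>operator_space X X\<^esub> (g \<oplus>\<^bsub>operator_space X X\<^esub> h)) < e"
    unfolding minus_distrib[OF BL] using bn_add_le[OF m] g h by simp
  then show "\<exists>g\<in>finite_rank_operators X. bn (c \<oplus>\<^bsub>operator_space X X\<^esub> d \<ominus>\<^bsub>operator_space X X\<^esub> g) < e"
    using finite_rank_add[OF g(1) h(1)] by blast
qed

lemma AO_smult:
  assumes "c \<in> AO" shows "a \<odot>\<^bsub>operator_space X X\<^esub> c \<in> AO"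
proof -
  have c: "c \<in> BL" using assms AO_subset by simp
  \<comment> \<open>A multiple of c is the composition of c with a multiple of the identity, so this
    is a case of the ideal property \<open>AO_comp\<close>.\<close>
  have "a \<odot>\<^bsub>operator_space X X\<^esub> c = cmp c (a \<odot>\<^bsub>operator_space X X\<^esub> idX)"
    using comp_smult(2)[OF id_in_BL c, of a] comp_id(2)[OF c] by simp
  then show ?thesis using AO_comp[OF assms smult_BL[OF id_in_BL]] by simp
qed

end

subsection \<open>A bimodule of trilinear forms\<close>

text \<open>A weighted sup-norm space of functions on \<open>D\<close>, cut out by the linear relations
  \<open>g s = c * g t + d * g u\<close> with \<open>(s, c, t, d, u) \<in> R\<close>; multilinearity and cocycle identities have this form.\<close>
definition wspace ::
  "'s set \<Rightarrow> ('s \<Rightarrow> real) \<Rightarrow> ('s \<times> 'k \<times> 's \<times> 'k \<times> 's) set \<Rightarrow> ('s \<Rightarrow> 'k::real_normed_field) set" where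
  "wspace D wt R = {g. (\<forall>s. s \<notin> D \<longrightarrow> g s = 0) \<and> (\<forall>(s, c, t, d, u)\<in>R. g s = c * g t + d * g u) \<and>
     (\<exists>K\<ge>0. \<forall>s\<in>D. norm (g s) \<le> K * wt s)}"

definition wnorm :: "'s set \<Rightarrow> ('s \<Rightarrow> real) \<Rightarrow> ('s \<Rightarrow> 'k::real_normed_field) \<Rightarrow> real" where
  "wnorm D wt g = Inf {K. 0 \<le> K \<and> (\<forall>s\<in>D. norm (g s) \<le> K * wt s)}"

lemma wspaceI:
  assumes "\<And>s. s \<notin> D \<Longrightarrow> g s = 0" "\<And>s c t d u. (s, c, t, d, u) \<in> R \<Longrightarrow> g s = c * g t + d * g u"
    "0 \<le> K" "\<And>s. s \<in> D \<Longrightarrow> norm (g s) \<le> K * wt s"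
  shows "g \<in> wspace D wt R"
  using assms unfolding wspace_def by blast

lemma wspaceD:
  assumes "g \<in> wspace D wt R"
  shows "s \<notin> D \<Longrightarrow> g s = 0" "(s, c, t, d, u) \<in> R \<Longrightarrow> g s = c * g t + d * g u"
    "\<exists>K\<ge>0. \<forall>s\<in>D. norm (g s) \<le> K * wt s"
  using assms unfolding wspace_def by blast+

lemma wnorm_le: "0 \<le> K \<Longrightarrow> (\<And>s. s \<in> D \<Longrightarrow> norm (g s) \<le> K * wt s) \<Longrightarrow> wnorm D wt g \<le> K"
  unfolding wnorm_def by (rule cInf_lower) (auto intro: bdd_belowI[of _ 0])

context
  fixes D :: "'s set" and wt :: "'s \<Rightarrow> real" and R :: "('s \<times> 'k::real_normed_field \<times> 's \<times> 'k \<times> 's) set"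
  assumes wt: "\<And>s. s \<in> D \<Longrightarrow> 0 \<le> wt s"
begin

private abbreviation "G \<equiv> wspace D wt R"
private abbreviation "wn \<equiv> wnorm D wt :: ('s \<Rightarrow> 'k) \<Rightarrow> real"

lemma wnorm_nonneg: "g \<in> G \<Longrightarrow> 0 \<le> wn g"
  unfolding wnorm_def using wspaceD(3)[of g D wt R] by (intro cInf_greatest) auto

lemma wnorm_bound:
  assumes "g \<in> G" "s \<in> D" shows "norm (g s) \<le> wn g * wt s"
proof (cases "wt s = 0")
  case True
  then show ?thesis using wspaceD(3)[OF assms(1)] assms(2) by fastforce
next
  case False
  then have w: "wt s > 0" using wt[OF assms(2)] by simp
  have "norm (g s) / wt s \<le> wn g"
    unfolding wnorm_def using wspaceD(3)[OF assms(1)] assms(2) w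
    by (intro cInf_greatest) (auto simp: field_simps)
  then show ?thesis using w by (simp add: field_simps)
qed

lemma wspace_zero: "(\<lambda>s. 0) \<in> G"
  by (rule wspaceI[where K = 0]) auto

lemma wspace_lincomb:
  assumes "g \<in> G" "h \<in> G" shows "(\<lambda>s. a * g s + b * h s) \<in> G"
    and "wn (\<lambda>s. a * g s + b * h s) \<le> norm a * wn g + norm b * wn h"
proof -
  have K: "0 \<le> norm a * wn g + norm b * wn h" using wnorm_nonneg assms by simp
  have le: "norm (a * g s + b * h s) \<le> (norm a * wn g + norm b * wn h) * wt s" if s: "s \<in> D" for s
  proof -
    have "norm (a * g s + b * h s) \<le> norm a * norm (g s) + norm b * norm (h s)"
      by (metis norm_mult norm_triangle_ineq)
    also have "\<dots> \<le> norm a * (wn g * wt s) + norm b * (wn h * wt s)"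
      by (intro add_mono mult_left_mono wnorm_bound assms s) auto
    finally show ?thesis by (simp add: algebra_simps)
  qed
  show "(\<lambda>s. a * g s + b * h s) \<in> G"
  proof (rule wspaceI[OF _ _ K le])
    show "a * g s + b * h s = c * (a * g t + b * h t) + d * (a * g u + b * h u)" if "(s, c, t, d, u) \<in> R" for s c t d u
      using wspaceD(2)[OF assms(1) that] wspaceD(2)[OF assms(2) that] by (simp add: algebra_simps)
  qed (use wspaceD(1)[OF assms(1)] wspaceD(1)[OF assms(2)] in auto)
  show "wn (\<lambda>s. a * g s + b * h s) \<le> norm a * wn g + norm b * wn h" by (rule wnorm_le[OF K le])
qed

lemma wspace_add: "g \<in> G \<Longrightarrow> h \<in> G \<Longrightarrow> (\<lambda>s. g s + h s) \<in> G"
  using wspace_lincomb(1)[of g h 1 1] by simp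

lemma wspace_smult: "g \<in> G \<Longrightarrow> (\<lambda>s. c * g s) \<in> G"
  using wspace_lincomb(1)[of g g c 0] by simp

lemma wspace_diff: "g \<in> G \<Longrightarrow> h \<in> G \<Longrightarrow> (\<lambda>s. g s - h s) \<in> G"
  using wspace_lincomb(1)[of g h 1 "-1"] by simp

lemma wnorm_smult:
  assumes "g \<in> G" shows "wn (\<lambda>s. c * g s) = norm c * wn g"
proof (rule antisym)
  show "wn (\<lambda>s. c * g s) \<le> norm c * wn g" using wspace_lincomb(2)[OF assms assms, of c 0] by simp
  show "norm c * wn g \<le> wn (\<lambda>s. c * g s)"
  proof (cases "c = 0")
    case False
    have "wn (\<lambda>s. inverse c * (c * g s)) \<le> norm (inverse c) * wn (\<lambda>s. c * g s)"
      using wspace_lincomb(2)[OF wspace_smult[OF assms, of c] assms, of "inverse c" 0] by simp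
    moreover have "(\<lambda>s. inverse c * (c * g s)) = g" using False by (simp add: mult.assoc[symmetric])
    ultimately have "wn g \<le> wn (\<lambda>s. c * g s) / norm c" by (simp add: norm_inverse divide_inverse mult.commute)
    then show ?thesis using False by (simp add: field_simps)
  qed (use wnorm_nonneg[OF wspace_smult[OF assms, of 0]] in simp)
qed

lemma wnorm_eq_0: assumes "g \<in> G" shows "wn g = 0 \<longleftrightarrow> g = (\<lambda>s. 0)"
proof
  assume "wn g = 0"
  then have "g s = 0" for s using wnorm_bound[OF assms, of s] wspaceD(1)[OF assms, of s] by (cases "s \<in> D") auto
  then show "g = (\<lambda>s. 0)" by blast
next
  assume "g = (\<lambda>s. 0)"
  then have "wn g \<le> 0" by (intro wnorm_le) auto
  then show "wn g = 0" using wnorm_nonneg[OF assms] by simp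
qed

end

text \<open>Cauchy sequences converge pointwise, and both the relations in R and the weighted bounds
  survive pointwise limits.\<close>

lemma wspace_complete:
  fixes R :: "('s \<times> 'k::{real_normed_field, banach} \<times> 's \<times> 'k \<times> 's) set"
  assumes wt: "\<And>s. s \<in> D \<Longrightarrow> 0 \<le> wt s" and g: "\<And>n. g n \<in> wspace D wt R"
    and cau: "\<And>e. e > 0 \<Longrightarrow> \<exists>N. \<forall>m\<ge>N. \<forall>n\<ge>N. wnorm D wt (\<lambda>s. g m s - g n s) < e"
  shows "\<exists>h\<in>wspace D wt R. (\<lambda>n. wnorm D wt (\<lambda>s. g n s - h s)) \<longlonglongrightarrow> 0"
proof -
  have diff: "norm (g m s - g n s) \<le> wnorm D wt (\<lambda>s. g m s - g n s) * wt s" if "s \<in> D" for m n s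
    using wnorm_bound[OF wt wspace_diff[OF wt g g, of m n] that] by simp
  have pc: "convergent (\<lambda>n. g n s)" for s
  proof (cases "s \<in> D")
    case True
    show ?thesis
    proof (rule Cauchy_convergent, rule CauchyI)
      fix e :: real assume e: "0 < e"
      define e' where "e' = e / (wt s + 1)"
      have pos: "wt s + 1 > 0" using wt[OF True] by simp
      then have "e' > 0" using e by (simp add: e'_def)
      then obtain N where N: "\<forall>m\<ge>N. \<forall>n\<ge>N. wnorm D wt (\<lambda>s. g m s - g n s) < e'" using cau by blast
      have "norm (g m s - g n s) < e" if "m \<ge> N" "n \<ge> N" for m n
      proof -
        have "wnorm D wt (\<lambda>s. g m s - g n s) * wt s \<le> e' * wt s"
          using N that by (intro mult_right_mono wt[OF True]) (simp add: less_imp_le)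
        then have "norm (g m s - g n s) \<le> e' * wt s" using diff[OF True, of m n] by linarith
        also have "\<dots> < e" using e pos by (simp add: e'_def field_simps)
        finally show ?thesis .
      qed
      then show "\<exists>M. \<forall>m\<ge>M. \<forall>n\<ge>M. norm (g m s - g n s) < e" by blast
    qed
  next
    case False
    then show ?thesis using wspaceD(1)[OF g False] by (simp add: convergent_const)
  qed
  define h where "h = (\<lambda>s. lim (\<lambda>n. g n s))"
  have lim: "(\<lambda>n. g n s) \<longlonglongrightarrow> h s" for s using pc by (simp add: h_def convergent_LIMSEQ_iff)
  have tail: "\<exists>N. \<forall>n\<ge>N. \<forall>s\<in>D. norm (g n s - h s) \<le> e * wt s" if e: "e > 0" for e
  proof -
    obtain N where N: "\<forall>m\<ge>N. \<forall>n\<ge>N. wnorm D wt (\<lambda>s. g m s - g n s) < e" using cau[OF e] by blast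
    have "norm (g n s - h s) \<le> e * wt s" if "n \<ge> N" "s \<in> D" for n s
    proof (rule LIMSEQ_le_const2)
      show "(\<lambda>m. norm (g n s - g m s)) \<longlonglongrightarrow> norm (g n s - h s)" by (intro tendsto_intros lim)
      show "\<exists>M. \<forall>m\<ge>M. norm (g n s - g m s) \<le> e * wt s"
      proof (intro exI[of _ N] allI impI)
        fix m assume m: "N \<le> m"
        have "wnorm D wt (\<lambda>s. g n s - g m s) * wt s \<le> e * wt s"
          using N that m by (intro mult_right_mono wt) (simp_all add: less_imp_le)
        then show "norm (g n s - g m s) \<le> e * wt s" using diff[OF that(2), of n m] by linarith
      qed
    qed
    then show ?thesis by blast
  qed
  have "h \<in> wspace D wt R"
  proof -
    obtain N where N: "\<forall>n\<ge>N. \<forall>s\<in>D. norm (g n s - h s) \<le> 1 * wt s" using tail[of 1] by auto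
    obtain K where K: "K \<ge> 0" "\<forall>s\<in>D. norm (g N s) \<le> K * wt s" using wspaceD(3)[OF g[of N]] by auto
    show ?thesis
    proof (rule wspaceI[where K = "K + 1"])
      show "h s = 0" if "s \<notin> D" for s
        using lim[of s] wspaceD(1)[OF g that] by (simp add: LIMSEQ_const_iff)
      show "h s = c * h t + d * h u" if "(s, c, t, d, u) \<in> R" for s c t d u
      proof (rule LIMSEQ_unique[OF lim])
        have "(\<lambda>n. c * g n t + d * g n u) \<longlonglongrightarrow> c * h t + d * h u" by (intro tendsto_intros lim)
        then show "(\<lambda>n. g n s) \<longlonglongrightarrow> c * h t + d * h u" using wspaceD(2)[OF g that] by simp
      qed
      show "norm (h s) \<le> (K + 1) * wt s" if s: "s \<in> D" for s
      proof -
        have "norm (h s) \<le> norm (g N s) + norm (g N s - h s)" by (metis norm_triangle_sub add.commute norm_minus_commute)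
        then show ?thesis using N K s by (auto simp: algebra_simps dest!: bspec)
      qed
    qed (use K in simp)
  qed
  moreover have "(\<lambda>n. wnorm D wt (\<lambda>s. g n s - h s)) \<longlonglongrightarrow> 0"
  proof (rule LIMSEQ_I)
    fix r :: real assume r: "0 < r"
    obtain N where N: "\<forall>n\<ge>N. \<forall>s\<in>D. norm (g n s - h s) \<le> r / 2 * wt s" using tail[of "r / 2"] r by auto
    have "norm (wnorm D wt (\<lambda>s. g n s - h s) - 0) < r" if "n \<ge> N" for n
    proof -
      have "wnorm D wt (\<lambda>s. g n s - h s) \<le> r / 2" by (rule wnorm_le) (use N that r in auto)
      moreover have "0 \<le> wnorm D wt (\<lambda>s. g n s - h s)"
        by (rule wnorm_nonneg[OF wt wspace_diff[OF wt g \<open>h \<in> wspace D wt R\<close>]])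
      ultimately show ?thesis using r by simp
    qed
    then show "\<exists>N. \<forall>n\<ge>N. norm (wnorm D wt (\<lambda>s. g n s - h s) - 0) < r" by blast
  qed
  ultimately show ?thesis by blast
qed

text \<open>The coding \<iota> with its left inverse \<kappa> carries the space over to the type on
  which \<open>amenable\<close> lets bimodules live.\<close>

lemma wspace_banach:
  fixes E :: "('k::{real_normed_field, banach}, 'e, 'm) normed_space_scheme"
    and \<iota> :: "('s \<Rightarrow> 'k) \<Rightarrow> 'e" and \<kappa> :: "'e \<Rightarrow> 's \<Rightarrow> 'k"
  assumes k: "\<And>g. \<kappa> (\<iota> g) = g" and wt: "\<And>s. s \<in> D \<Longrightarrow> 0 \<le> wt s"
    and E: "carrier E = \<iota> ` wspace D wt R" "zero E = \<iota> (\<lambda>s. 0)"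
      "add E = (\<lambda>x y. \<iota> (\<lambda>s. \<kappa> x s + \<kappa> y s))" "smult E = (\<lambda>c x. \<iota> (\<lambda>s. c * \<kappa> x s))"
      "nrm E = (\<lambda>x. wnorm D wt (\<kappa> x))"
  shows "banach_space E" and "x \<in> carrier E \<Longrightarrow> y \<in> carrier E \<Longrightarrow> x \<ominus>\<^bsub>E\<^esub> y = \<iota> (\<lambda>s. \<kappa> x s - \<kappa> y s)"
proof -
  have ag: "abelian_group E"
  proof (rule abelian_groupI)
    fix x assume "x \<in> carrier E"
    then obtain g where g: "x = \<iota> g" "g \<in> wspace D wt R" by (auto simp: E)
    show "\<exists>y\<in>carrier E. y \<oplus>\<^bsub>E\<^esub> x = \<zero>\<^bsub>E\<^esub>"
      using wspace_smult[OF wt g(2), of "-1"] by (auto simp: E g k intro!: bexI[of _ "\<lambda>s. - g s"])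
  qed (auto simp: E k algebra_simps intro!: imageI wspace_zero wspace_add wt)
  show minus: "x \<ominus>\<^bsub>E\<^esub> y = \<iota> (\<lambda>s. \<kappa> x s - \<kappa> y s)" if xy: "x \<in> carrier E" "y \<in> carrier E" for x y
  proof -
    obtain g where g: "y = \<iota> g" "g \<in> wspace D wt R" using xy by (auto simp: E)
    have "\<ominus>\<^bsub>E\<^esub> y = \<iota> (\<lambda>s. - g s)"
      by (rule abelian_group.minus_equality[OF ag])
         (use wspace_smult[OF wt g(2), of "-1"] g in \<open>auto simp: E k\<close>)
    then show ?thesis by (simp add: a_minus_def E k g)
  qed
  show "banach_space E"
  proof (rule banach_space.intro)
    show "Module.module (scalars :: ('k, 'k) normed_space) E"
      by (rule moduleI[OF scalars_cring ag])
         (auto simp: E k algebra_simps intro!: imageI wspace_smult wt)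
    show "\<exists>x\<in>carrier E. (\<lambda>n. nrm E (s n \<ominus>\<^bsub>E\<^esub> x)) \<longlonglongrightarrow> 0"
      if s: "\<And>n. s n \<in> carrier E" and c: "\<And>e. e > 0 \<Longrightarrow> \<exists>N. \<forall>m\<ge>N. \<forall>n\<ge>N. nrm E (s m \<ominus>\<^bsub>E\<^esub> s n) < e" for s
    proof -
      have "\<kappa> (s n) \<in> wspace D wt R" for n using s[of n] by (auto simp: E k)
      moreover have "\<exists>N. \<forall>m\<ge>N. \<forall>n\<ge>N. wnorm D wt (\<lambda>t. \<kappa> (s m) t - \<kappa> (s n) t) < e" if "e > 0" for e
        using c[OF that] by (simp add: minus s k E(5))
      ultimately obtain h where h: "h \<in> wspace D wt R" "(\<lambda>n. wnorm D wt (\<lambda>t. \<kappa> (s n) t - h t)) \<longlonglongrightarrow> 0"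
        using wspace_complete[of D wt "\<lambda>n. \<kappa> (s n)" R, OF wt] by blast
      then have "\<iota> h \<in> carrier E" by (simp add: E)
      then show ?thesis using h by (intro bexI[of _ "\<iota> h"]) (simp_all add: minus s k E(5))
    qed
    show "nrm E (x \<oplus>\<^bsub>E\<^esub> y) \<le> nrm E x + nrm E y" if "x \<in> carrier E" "y \<in> carrier E" for x y
      using that wspace_lincomb(2)[where a = 1 and b = 1 and R = R, OF wt] by (auto simp: E k)
    show "nrm E x = 0 \<longleftrightarrow> x = \<zero>\<^bsub>E\<^esub>" if x: "x \<in> carrier E" for x
    proof -
      obtain g where g: "x = \<iota> g" "g \<in> wspace D wt R" using x by (auto simp: E)
      then show ?thesis using wnorm_eq_0[OF wt g(2)] by (auto simp: E k) (metis k)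
    qed
  qed (auto simp: E k wnorm_smult[OF wt] wnorm_nonneg[OF wt])
qed

lemma banach_space_nspace: "banach_space X \<Longrightarrow> nspace X"
  by (simp add: banach_space_def nspace_def)

section \<open>Trilinear cocycles and the two module actions\<close>

context nspace
begin

abbreviation "oadd \<equiv> add (operator_space X X)"
abbreviation "osmult \<equiv> smult (operator_space X X)"

definition triples :: "(('v \<Rightarrow> 'v) \<times> ('v \<Rightarrow> 'v) \<times> ('v \<Rightarrow> 'v)) set" where
  "triples = BL \<times> AO \<times> BL"

definition triple_weight :: "('v \<Rightarrow> 'v) \<times> ('v \<Rightarrow> 'v) \<times> ('v \<Rightarrow> 'v) \<Rightarrow> real" where
  "triple_weight s = bn (fst s) * bn (fst (snd s)) * bn (snd (snd s))"

text \<open>Bounded trilinear forms \<open>g\<close> on \<open>\<B>(X) \<times> \<A>(X) \<times> \<B>(X)\<close> with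
  \<open>g(a, cd, b) = g(ac, d, b) + g(a, c, db)\<close>. The prototype is \<open>\<beta>(ac, b) - \<beta>(a, cb)\<close> for a bilinear
  form \<open>\<beta>\<close>; it vanishes exactly when \<open>\<beta>\<close> is balanced.\<close>
definition cocycle_relations ::
  "((('v \<Rightarrow> 'v) \<times> ('v \<Rightarrow> 'v) \<times> ('v \<Rightarrow> 'v)) \<times> 'k \<times> (('v \<Rightarrow> 'v) \<times> ('v \<Rightarrow> 'v) \<times> ('v \<Rightarrow> 'v)) \<times> 'k
    \<times> (('v \<Rightarrow> 'v) \<times> ('v \<Rightarrow> 'v) \<times> ('v \<Rightarrow> 'v))) set" where
  "cocycle_relations =
     {((oadd a a', c, b), 1, (a, c, b), 1, (a', c, b)) | a a' c b. a \<in> BL \<and> a' \<in> BL \<and> c \<in> AO \<and> b \<in> BL} \<union>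
     {((osmult r a, c, b), r, (a, c, b), 0, (a, c, b)) | r a c b. a \<in> BL \<and> c \<in> AO \<and> b \<in> BL} \<union>
     {((a, oadd c c', b), 1, (a, c, b), 1, (a, c', b)) | a c c' b. a \<in> BL \<and> c \<in> AO \<and> c' \<in> AO \<and> b \<in> BL} \<union>
     {((a, osmult r c, b), r, (a, c, b), 0, (a, c, b)) | r a c b. a \<in> BL \<and> c \<in> AO \<and> b \<in> BL} \<union>
     {((a, c, oadd b b'), 1, (a, c, b), 1, (a, c, b')) | a c b b'. a \<in> BL \<and> c \<in> AO \<and> b \<in> BL \<and> b' \<in> BL} \<union>
     {((a, c, osmult r b), r, (a, c, b), 0, (a, c, b)) | r a c b. a \<in> BL \<and> c \<in> AO \<and> b \<in> BL} \<union>
     {((a, cmp c d, b), 1, (cmp a c, d, b), 1, (a, c, cmp d b)) | a c d b. a \<in> BL \<and> c \<in> AO \<and> d \<in> AO \<and> b \<in> BL}"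

abbreviation "cocycles \<equiv> wspace triples triple_weight cocycle_relations"

lemma in_triples: "(a, c, b) \<in> triples \<longleftrightarrow> a \<in> BL \<and> c \<in> AO \<and> b \<in> BL"
  by (simp add: triples_def)

lemma triple_weight_nonneg: "s \<in> triples \<Longrightarrow> 0 \<le> triple_weight s"
  using XX.opn_nonneg AO_subset by (auto simp: triples_def triple_weight_def)

lemma cocyclesI:
  assumes "\<And>a c b. (a, c, b) \<notin> triples \<Longrightarrow> g (a, c, b) = 0"
    "\<And>a a' c b. a \<in> BL \<Longrightarrow> a' \<in> BL \<Longrightarrow> c \<in> AO \<Longrightarrow> b \<in> BL \<Longrightarrow> g (oadd a a', c, b) = g (a, c, b) + g (a', c, b)"
    "\<And>r a c b. a \<in> BL \<Longrightarrow> c \<in> AO \<Longrightarrow> b \<in> BL \<Longrightarrow> g (osmult r a, c, b) = r * g (a, c, b)"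
    "\<And>a c c' b. a \<in> BL \<Longrightarrow> c \<in> AO \<Longrightarrow> c' \<in> AO \<Longrightarrow> b \<in> BL \<Longrightarrow> g (a, oadd c c', b) = g (a, c, b) + g (a, c', b)"
    "\<And>r a c b. a \<in> BL \<Longrightarrow> c \<in> AO \<Longrightarrow> b \<in> BL \<Longrightarrow> g (a, osmult r c, b) = r * g (a, c, b)"
    "\<And>a c b b'. a \<in> BL \<Longrightarrow> c \<in> AO \<Longrightarrow> b \<in> BL \<Longrightarrow> b' \<in> BL \<Longrightarrow> g (a, c, oadd b b') = g (a, c, b) + g (a, c, b')"
    "\<And>r a c b. a \<in> BL \<Longrightarrow> c \<in> AO \<Longrightarrow> b \<in> BL \<Longrightarrow> g (a, c, osmult r b) = r * g (a, c, b)"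
    "\<And>a c d b. a \<in> BL \<Longrightarrow> c \<in> AO \<Longrightarrow> d \<in> AO \<Longrightarrow> b \<in> BL \<Longrightarrow> g (a, cmp c d, b) = g (cmp a c, d, b) + g (a, c, cmp d b)"
    "0 \<le> K" "\<And>a c b. a \<in> BL \<Longrightarrow> c \<in> AO \<Longrightarrow> b \<in> BL \<Longrightarrow> norm (g (a, c, b)) \<le> K * (bn a * bn c * bn b)"
  shows "g \<in> cocycles"
proof (rule wspaceI[where K = K])
  fix s t u c d assume "(s, c, t, d, u) \<in> cocycle_relations"
  then show "g s = c * g t + d * g u"
    unfolding cocycle_relations_def using assms(2-8) by auto
qed (use assms(1,9,10) in \<open>auto simp: triples_def triple_weight_def\<close>)

lemma cocyclesD:
  assumes "g \<in> cocycles"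
  shows "(a, c, b) \<notin> triples \<Longrightarrow> g (a, c, b) = 0"
    "a \<in> BL \<Longrightarrow> a' \<in> BL \<Longrightarrow> c \<in> AO \<Longrightarrow> b \<in> BL \<Longrightarrow> g (oadd a a', c, b) = g (a, c, b) + g (a', c, b)"
    "a \<in> BL \<Longrightarrow> c \<in> AO \<Longrightarrow> b \<in> BL \<Longrightarrow> g (osmult r a, c, b) = r * g (a, c, b)"
    "a \<in> BL \<Longrightarrow> c \<in> AO \<Longrightarrow> c' \<in> AO \<Longrightarrow> b \<in> BL \<Longrightarrow> g (a, oadd c c', b) = g (a, c, b) + g (a, c', b)"
    "a \<in> BL \<Longrightarrow> c \<in> AO \<Longrightarrow> b \<in> BL \<Longrightarrow> g (a, osmult r c, b) = r * g (a, c, b)"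
    "a \<in> BL \<Longrightarrow> c \<in> AO \<Longrightarrow> b \<in> BL \<Longrightarrow> b' \<in> BL \<Longrightarrow> g (a, c, oadd b b') = g (a, c, b) + g (a, c, b')"
    "a \<in> BL \<Longrightarrow> c \<in> AO \<Longrightarrow> b \<in> BL \<Longrightarrow> g (a, c, osmult r b) = r * g (a, c, b)"
    "a \<in> BL \<Longrightarrow> c \<in> AO \<Longrightarrow> d \<in> AO \<Longrightarrow> b \<in> BL \<Longrightarrow> g (a, cmp c d, b) = g (cmp a c, d, b) + g (a, c, cmp d b)"
    "a \<in> BL \<Longrightarrow> c \<in> AO \<Longrightarrow> b \<in> BL \<Longrightarrow> norm (g (a, c, b)) \<le> wnorm triples triple_weight g * (bn a * bn c * bn b)"
proof -
  have rel: "g s = x * g t + y * g u" if "(s, x, t, y, u) \<in> cocycle_relations" for s x t y u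
    by (rule wspaceD(2)[OF assms that])
  show "g (a, c, b) = 0" if "(a, c, b) \<notin> triples" by (rule wspaceD(1)[OF assms that])
  show "g (oadd a a', c, b) = g (a, c, b) + g (a', c, b)" if "a \<in> BL" "a' \<in> BL" "c \<in> AO" "b \<in> BL"
    using rel[of "(oadd a a', c, b)" 1 "(a, c, b)" 1 "(a', c, b)"] that unfolding cocycle_relations_def by auto
  show "g (osmult r a, c, b) = r * g (a, c, b)" if "a \<in> BL" "c \<in> AO" "b \<in> BL"
    using rel[of "(osmult r a, c, b)" r "(a, c, b)" 0 "(a, c, b)"] that unfolding cocycle_relations_def by auto
  show "g (a, oadd c c', b) = g (a, c, b) + g (a, c', b)" if "a \<in> BL" "c \<in> AO" "c' \<in> AO" "b \<in> BL"
    using rel[of "(a, oadd c c', b)" 1 "(a, c, b)" 1 "(a, c', b)"] that unfolding cocycle_relations_def by auto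
  show "g (a, osmult r c, b) = r * g (a, c, b)" if "a \<in> BL" "c \<in> AO" "b \<in> BL"
    using rel[of "(a, osmult r c, b)" r "(a, c, b)" 0 "(a, c, b)"] that unfolding cocycle_relations_def by auto
  show "g (a, c, oadd b b') = g (a, c, b) + g (a, c, b')" if "a \<in> BL" "c \<in> AO" "b \<in> BL" "b' \<in> BL"
    using rel[of "(a, c, oadd b b')" 1 "(a, c, b)" 1 "(a, c, b')"] that unfolding cocycle_relations_def by auto
  show "g (a, c, osmult r b) = r * g (a, c, b)" if "a \<in> BL" "c \<in> AO" "b \<in> BL"
    using rel[of "(a, c, osmult r b)" r "(a, c, b)" 0 "(a, c, b)"] that unfolding cocycle_relations_def by auto
  show "g (a, cmp c d, b) = g (cmp a c, d, b) + g (a, c, cmp d b)" if "a \<in> BL" "c \<in> AO" "d \<in> AO" "b \<in> BL"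
    using rel[of "(a, cmp c d, b)" 1 "(cmp a c, d, b)" 1 "(a, c, cmp d b)"] that unfolding cocycle_relations_def by auto
  show "norm (g (a, c, b)) \<le> wnorm triples triple_weight g * (bn a * bn c * bn b)" if "a \<in> BL" "c \<in> AO" "b \<in> BL"
    using wnorm_bound[OF triple_weight_nonneg assms, of "(a, c, b)"] that by (simp add: triples_def triple_weight_def)
qed

text \<open>\<open>left_shift\<close> and \<open>right_shift\<close> are the left and the right
  action on trilinear forms. On the dual module they act on the outer factors from outside, as
  multiplication does on a tensor product. The value 0 off \<open>triples\<close> keeps the results
  in \<open>wspace\<close>.\<close>

definition left_shift :: "('v \<Rightarrow> 'v) \<Rightarrow> (('v \<Rightarrow> 'v) \<times> ('v \<Rightarrow> 'v) \<times> ('v \<Rightarrow> 'v) \<Rightarrow> 'k) \<Rightarrow> ('v \<Rightarrow> 'v) \<times> ('v \<Rightarrow> 'v) \<times> ('v \<Rightarrow> 'v) \<Rightarrow> 'k" where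
  "left_shift d g = (\<lambda>(a, c, b). if (a, c, b) \<in> triples then g (a, c, cmp b d) else 0)"

definition right_shift :: "('v \<Rightarrow> 'v) \<Rightarrow> (('v \<Rightarrow> 'v) \<times> ('v \<Rightarrow> 'v) \<times> ('v \<Rightarrow> 'v) \<Rightarrow> 'k) \<Rightarrow> ('v \<Rightarrow> 'v) \<times> ('v \<Rightarrow> 'v) \<times> ('v \<Rightarrow> 'v) \<Rightarrow> 'k" where
  "right_shift d g = (\<lambda>(a, c, b). if (a, c, b) \<in> triples then g (cmp d a, c, b) else 0)"

lemmas closure_rules = comp_in_BL add_BL smult_BL AO_add AO_smult AO_comp AO_subset id_in_BL

lemma left_shift_bound:
  assumes g: "g \<in> cocycles" and d: "d \<in> BL" and s: "a \<in> BL" "c \<in> AO" "b \<in> BL"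
  shows "norm (left_shift d g (a, c, b)) \<le> (bn d * wnorm triples triple_weight g) * (bn a * bn c * bn b)"
proof -
  let ?W = "wnorm triples triple_weight g"
  have W: "0 \<le> ?W" by (rule wnorm_nonneg[OF triple_weight_nonneg g])
  have nn: "0 \<le> bn a" "0 \<le> bn c" "0 \<le> bn b" "0 \<le> bn d" using s d AO_subset XX.opn_nonneg by auto
  have "norm (g (a, c, cmp b d)) \<le> ?W * (bn a * bn c * bn (cmp b d))"
    by (rule cocyclesD(9)[OF g]) (use s d closure_rules in auto)
  also have "\<dots> \<le> ?W * (bn a * bn c * (bn b * bn d))"
    by (intro mult_left_mono bn_comp_le) (use s d W nn in auto)
  finally show ?thesis using s by (simp add: left_shift_def triples_def mult_ac)
qed

lemma right_shift_bound:
  assumes g: "g \<in> cocycles" and d: "d \<in> BL" and s: "a \<in> BL" "c \<in> AO" "b \<in> BL"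
  shows "norm (right_shift d g (a, c, b)) \<le> (bn d * wnorm triples triple_weight g) * (bn a * bn c * bn b)"
proof -
  let ?W = "wnorm triples triple_weight g"
  have W: "0 \<le> ?W" by (rule wnorm_nonneg[OF triple_weight_nonneg g])
  have nn: "0 \<le> bn a" "0 \<le> bn c" "0 \<le> bn b" "0 \<le> bn d" using s d AO_subset XX.opn_nonneg by auto
  have "norm (g (cmp d a, c, b)) \<le> ?W * (bn (cmp d a) * bn c * bn b)"
    by (rule cocyclesD(9)[OF g]) (use s d closure_rules in auto)
  also have "\<dots> \<le> ?W * ((bn d * bn a) * bn c * bn b)"
    by (intro mult_left_mono mult_right_mono bn_comp_le) (use s d W nn in auto)
  finally show ?thesis using s by (simp add: right_shift_def triples_def mult_ac)
qed

lemma left_shift_cocycle: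
  assumes g: "g \<in> cocycles" and d: "d \<in> BL" shows "left_shift d g \<in> cocycles"
proof (rule cocyclesI)
  show "0 \<le> bn d * wnorm triples triple_weight g"
    using XX.opn_nonneg[OF d] wnorm_nonneg[OF triple_weight_nonneg g] by simp
  show "left_shift d g (a, c, b) = 0" if "(a, c, b) \<notin> triples" for a c b
    using that by (simp add: left_shift_def)
next
  fix a c b assume s: "a \<in> BL" "c \<in> AO" "b \<in> BL"
  show "norm (left_shift d g (a, c, b)) \<le> (bn d * wnorm triples triple_weight g) * (bn a * bn c * bn b)"
    by (rule left_shift_bound[OF g d s])
  show "left_shift d g (osmult r a, c, b) = r * left_shift d g (a, c, b)" for r
    using s d by (simp add: left_shift_def in_triples comp_smult smult_BL comp_in_BL cocyclesD(3)[OF g])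
  show "left_shift d g (a, osmult r c, b) = r * left_shift d g (a, c, b)" for r
    using s d by (simp add: left_shift_def in_triples AO_smult comp_in_BL cocyclesD(5)[OF g])
  show "left_shift d g (a, c, osmult r b) = r * left_shift d g (a, c, b)" for r
    using s d by (simp add: left_shift_def in_triples comp_smult smult_BL comp_in_BL cocyclesD(7)[OF g])
  show "left_shift d g (oadd a a', c, b) = left_shift d g (a, c, b) + left_shift d g (a', c, b)" if "a' \<in> BL" for a'
    using s d that by (simp add: left_shift_def in_triples comp_add add_BL comp_in_BL cocyclesD(2)[OF g])
  show "left_shift d g (a, oadd c c', b) = left_shift d g (a, c, b) + left_shift d g (a, c', b)" if "c' \<in> AO" for c'
    using s d that by (simp add: left_shift_def in_triples AO_add comp_in_BL cocyclesD(4)[OF g])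
  show "left_shift d g (a, c, oadd b b') = left_shift d g (a, c, b) + left_shift d g (a, c, b')" if "b' \<in> BL" for b'
    using s d that by (simp add: left_shift_def in_triples comp_add add_BL comp_in_BL cocyclesD(6)[OF g])
  show "left_shift d g (a, cmp c e, b) = left_shift d g (cmp a c, e, b) + left_shift d g (a, c, cmp e b)" if "e \<in> AO" for e
    using s d that AO_subset[OF s(2)] AO_subset[OF that]
    by (simp add: left_shift_def in_triples comp_assoc AO_comp comp_in_BL cocyclesD(8)[OF g])
qed

lemma right_shift_cocycle:
  assumes g: "g \<in> cocycles" and d: "d \<in> BL" shows "right_shift d g \<in> cocycles"
proof (rule cocyclesI)
  show "0 \<le> bn d * wnorm triples triple_weight g"
    using XX.opn_nonneg[OF d] wnorm_nonneg[OF triple_weight_nonneg g] by simp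
  show "right_shift d g (a, c, b) = 0" if "(a, c, b) \<notin> triples" for a c b
    using that by (simp add: right_shift_def)
next
  fix a c b assume s: "a \<in> BL" "c \<in> AO" "b \<in> BL"
  show "norm (right_shift d g (a, c, b)) \<le> (bn d * wnorm triples triple_weight g) * (bn a * bn c * bn b)"
    by (rule right_shift_bound[OF g d s])
  show "right_shift d g (osmult r a, c, b) = r * right_shift d g (a, c, b)" for r
    using s d by (simp add: right_shift_def in_triples comp_smult smult_BL comp_in_BL cocyclesD(3)[OF g])
  show "right_shift d g (a, osmult r c, b) = r * right_shift d g (a, c, b)" for r
    using s d by (simp add: right_shift_def in_triples AO_smult comp_in_BL cocyclesD(5)[OF g])
  show "right_shift d g (a, c, osmult r b) = r * right_shift d g (a, c, b)" for r
    using s d by (simp add: right_shift_def in_triples comp_smult smult_BL comp_in_BL cocyclesD(7)[OF g])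
  show "right_shift d g (oadd a a', c, b) = right_shift d g (a, c, b) + right_shift d g (a', c, b)" if "a' \<in> BL" for a'
    using s d that by (simp add: right_shift_def in_triples comp_add add_BL comp_in_BL cocyclesD(2)[OF g])
  show "right_shift d g (a, oadd c c', b) = right_shift d g (a, c, b) + right_shift d g (a, c', b)" if "c' \<in> AO" for c'
    using s d that by (simp add: right_shift_def in_triples AO_add comp_in_BL cocyclesD(4)[OF g])
  show "right_shift d g (a, c, oadd b b') = right_shift d g (a, c, b) + right_shift d g (a, c, b')" if "b' \<in> BL" for b'
    using s d that by (simp add: right_shift_def in_triples comp_add add_BL comp_in_BL cocyclesD(6)[OF g])
  show "right_shift d g (a, cmp c e, b) = right_shift d g (cmp a c, e, b) + right_shift d g (a, c, cmp e b)" if "e \<in> AO" for e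
    using s d that AO_subset[OF s(2)] AO_subset[OF that]
    by (simp add: right_shift_def in_triples comp_assoc AO_comp comp_in_BL cocyclesD(8)[OF g])
qed

lemma shift_linear:
  "left_shift d (\<lambda>s. g s + h s) = (\<lambda>s. left_shift d g s + left_shift d h s)"
  "right_shift d (\<lambda>s. g s + h s) = (\<lambda>s. right_shift d g s + right_shift d h s)"
  "left_shift d (\<lambda>s. r * g s) = (\<lambda>s. r * left_shift d g s)"
  "right_shift d (\<lambda>s. r * g s) = (\<lambda>s. r * right_shift d g s)"
  by (auto simp: left_shift_def right_shift_def fun_eq_iff)

lemma triples_ext:
  assumes "\<And>a c b. a \<in> BL \<Longrightarrow> c \<in> AO \<Longrightarrow> b \<in> BL \<Longrightarrow> k (a, c, b) = l (a, c, b)"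
    "\<And>a c b. (a, c, b) \<notin> triples \<Longrightarrow> k (a, c, b) = l (a, c, b)"
  shows "k = l"
proof (rule ext)
  fix s :: "('v \<Rightarrow> 'v) \<times> ('v \<Rightarrow> 'v) \<times> ('v \<Rightarrow> 'v)"
  obtain a c b where "s = (a, c, b)" by (cases s)
  then show "k s = l s" using assms by (cases "(a, c, b) \<in> triples") (auto simp: in_triples)
qed

lemma shift_smult:
  assumes g: "g \<in> cocycles" and d: "d \<in> BL"
  shows "left_shift (osmult r d) g = (\<lambda>s. r * left_shift d g s)"
    "right_shift (osmult r d) g = (\<lambda>s. r * right_shift d g s)"
  by (rule triples_ext, simp add: left_shift_def in_triples d comp_smult comp_in_BL cocyclesD(7)[OF g], simp add: left_shift_def)
     (rule triples_ext, simp add: right_shift_def in_triples d comp_smult comp_in_BL cocyclesD(3)[OF g], simp add: right_shift_def)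

lemma shift_action:
  assumes g: "g \<in> cocycles" and de: "d \<in> BL" "e \<in> BL"
  shows "left_shift (oadd d e) g = (\<lambda>s. left_shift d g s + left_shift e g s)"
    "right_shift (oadd d e) g = (\<lambda>s. right_shift d g s + right_shift e g s)"
    "left_shift (cmp d e) g = left_shift d (left_shift e g)"
    "right_shift (cmp d e) g = right_shift e (right_shift d g)"
    "left_shift d (right_shift e g) = right_shift e (left_shift d g)"
proof -
  note S = left_shift_def right_shift_def
  show "left_shift (oadd d e) g = (\<lambda>s. left_shift d g s + left_shift e g s)"
    by (rule triples_ext, simp add: S in_triples de comp_add comp_in_BL cocyclesD(6)[OF g], simp add: S)
  show "right_shift (oadd d e) g = (\<lambda>s. right_shift d g s + right_shift e g s)"
    by (rule triples_ext, simp add: S in_triples de comp_add comp_in_BL cocyclesD(2)[OF g], simp add: S)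
  show "left_shift (cmp d e) g = left_shift d (left_shift e g)"
    by (rule triples_ext, simp add: S in_triples de comp_assoc comp_in_BL, simp add: S)
  show "right_shift (cmp d e) g = right_shift e (right_shift d g)"
    by (rule triples_ext, simp add: S in_triples de comp_assoc comp_in_BL, simp add: S)
  show "left_shift d (right_shift e g) = right_shift e (left_shift d g)"
    by (rule triples_ext, simp add: S in_triples de comp_in_BL, simp add: S)
qed

lemma shift_norm_le:
  assumes g: "g \<in> cocycles" and d: "d \<in> BL"
  shows "wnorm triples triple_weight (left_shift d g) \<le> bn d * wnorm triples triple_weight g"
    "wnorm triples triple_weight (right_shift d g) \<le> bn d * wnorm triples triple_weight g"
  using left_shift_bound[OF g d] right_shift_bound[OF g d] XX.opn_nonneg[OF d] wnorm_nonneg[OF triple_weight_nonneg g]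
  by (auto intro!: wnorm_le simp: triples_def triple_weight_def)

end

locale coded_nspace = nspace X
  for X :: "('k::{real_normed_field, banach}, 'v, 'm) normed_space_scheme" (structure) +
  fixes \<iota> :: "(('v \<Rightarrow> 'v) \<times> ('v \<Rightarrow> 'v) \<times> ('v \<Rightarrow> 'v) \<Rightarrow> 'k) \<Rightarrow> 'e"
    and \<kappa> :: "'e \<Rightarrow> ('v \<Rightarrow> 'v) \<times> ('v \<Rightarrow> 'v) \<times> ('v \<Rightarrow> 'v) \<Rightarrow> 'k"
  assumes decode [simp]: "\<kappa> (\<iota> g) = g"
begin

definition cocycle_module :: "('k, 'v \<Rightarrow> 'v, 'e) bimodule" where
  "cocycle_module =
    \<lparr>carrier = \<iota> ` cocycles, mult = undefined, one = undefined, zero = \<iota> (\<lambda>s. 0),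
     add = (\<lambda>x y. \<iota> (\<lambda>s. \<kappa> x s + \<kappa> y s)), smult = (\<lambda>c x. \<iota> (\<lambda>s. c * \<kappa> x s)),
     nrm = (\<lambda>x. wnorm triples triple_weight (\<kappa> x)),
     lact = (\<lambda>d x. \<iota> (left_shift d (\<kappa> x))), ract = (\<lambda>x d. \<iota> (right_shift d (\<kappa> x)))\<rparr>"

lemma cocycle_module_banach: "banach_space cocycle_module"
  by (rule wspace_banach(1)[OF decode triple_weight_nonneg]) (simp_all add: cocycle_module_def)

lemma cocycle_bimodule: "banach_bimodule (approximable_operators X) cocycle_module"
proof (rule banach_bimodule.intro[OF cocycle_module_banach], rule banach_bimodule_axioms.intro)
  note simps = cocycle_module_def approximable_operators_simps
  show "\<exists>K. \<forall>a\<in>AO. \<forall>x\<in>carrier cocycle_module.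
      nrm cocycle_module (lact cocycle_module a x) \<le> K * nrm (approximable_operators X) a * nrm cocycle_module x"
    by (rule exI[of _ 1]) (auto simp: simps shift_norm_le AO_subset)
  show "\<exists>K. \<forall>a\<in>AO. \<forall>x\<in>carrier cocycle_module.
      nrm cocycle_module (ract cocycle_module x a) \<le> K * nrm (approximable_operators X) a * nrm cocycle_module x"
    by (rule exI[of _ 1]) (auto simp: simps shift_norm_le AO_subset)
qed (auto simp: cocycle_module_def approximable_operators_simps left_shift_cocycle right_shift_cocycle
      AO_subset shift_linear shift_action shift_smult)

end

section \<open>Bilinear forms and their coboundaries\<close>

context nspace
begin

definition bilinear_bound :: "(('v \<Rightarrow> 'v) \<Rightarrow> ('v \<Rightarrow> 'v) \<Rightarrow> 'k) \<Rightarrow> real \<Rightarrow> bool" where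
  "bilinear_bound \<beta> C \<longleftrightarrow> 0 \<le> C \<and>
     (\<forall>a\<in>BL. \<forall>a'\<in>BL. \<forall>b\<in>BL. \<beta> (oadd a a') b = \<beta> a b + \<beta> a' b \<and> \<beta> b (oadd a a') = \<beta> b a + \<beta> b a') \<and>
     (\<forall>r. \<forall>a\<in>BL. \<forall>b\<in>BL. \<beta> (osmult r a) b = r * \<beta> a b \<and> \<beta> a (osmult r b) = r * \<beta> a b) \<and>
     (\<forall>a\<in>BL. \<forall>b\<in>BL. norm (\<beta> a b) \<le> C * (bn a * bn b))"

lemma bilinear_boundD:
  assumes "bilinear_bound \<beta> C"
  shows "0 \<le> C"
    "a \<in> BL \<Longrightarrow> a' \<in> BL \<Longrightarrow> b \<in> BL \<Longrightarrow> \<beta> (oadd a a') b = \<beta> a b + \<beta> a' b"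
    "a \<in> BL \<Longrightarrow> a' \<in> BL \<Longrightarrow> b \<in> BL \<Longrightarrow> \<beta> b (oadd a a') = \<beta> b a + \<beta> b a'"
    "a \<in> BL \<Longrightarrow> b \<in> BL \<Longrightarrow> \<beta> (osmult r a) b = r * \<beta> a b"
    "a \<in> BL \<Longrightarrow> b \<in> BL \<Longrightarrow> \<beta> a (osmult r b) = r * \<beta> a b"
    "a \<in> BL \<Longrightarrow> b \<in> BL \<Longrightarrow> norm (\<beta> a b) \<le> C * (bn a * bn b)"
  using assms unfolding bilinear_bound_def by auto

definition coboundary :: "(('v \<Rightarrow> 'v) \<Rightarrow> ('v \<Rightarrow> 'v) \<Rightarrow> 'k) \<Rightarrow> ('v \<Rightarrow> 'v) \<times> ('v \<Rightarrow> 'v) \<times> ('v \<Rightarrow> 'v) \<Rightarrow> 'k" where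
  "coboundary \<beta> = (\<lambda>(a, c, b). if (a, c, b) \<in> triples then \<beta> (cmp a c) b - \<beta> a (cmp c b) else 0)"

lemma coboundary_bound:
  assumes \<beta>: "bilinear_bound \<beta> C" and s: "a \<in> BL" "c \<in> AO" "b \<in> BL"
  shows "norm (coboundary \<beta> (a, c, b)) \<le> (2 * C) * (bn a * bn c * bn b)"
proof -
  have c: "c \<in> BL" using s AO_subset by simp
  have nn: "0 \<le> bn a" "0 \<le> bn c" "0 \<le> bn b" "0 \<le> C"
    using s c XX.opn_nonneg bilinear_boundD(1)[OF \<beta>] by auto
  have "norm (\<beta> (cmp a c) b) \<le> C * (bn (cmp a c) * bn b)"
    by (rule bilinear_boundD(6)[OF \<beta>]) (use s c comp_in_BL in auto)
  also have "\<dots> \<le> C * ((bn a * bn c) * bn b)"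
    by (intro mult_left_mono mult_right_mono bn_comp_le) (use s c nn in auto)
  finally have 1: "norm (\<beta> (cmp a c) b) \<le> C * (bn a * bn c * bn b)" .
  have "norm (\<beta> a (cmp c b)) \<le> C * (bn a * bn (cmp c b))"
    by (rule bilinear_boundD(6)[OF \<beta>]) (use s c comp_in_BL in auto)
  also have "\<dots> \<le> C * (bn a * (bn c * bn b))"
    by (intro mult_left_mono mult_right_mono bn_comp_le) (use s c nn in auto)
  finally have 2: "norm (\<beta> a (cmp c b)) \<le> C * (bn a * bn c * bn b)" by (simp add: mult_ac)
  show ?thesis using norm_triangle_ineq4[of "\<beta> (cmp a c) b" "\<beta> a (cmp c b)"] 1 2 s
    by (simp add: coboundary_def in_triples)
qed

text \<open>The cocycle identity telescopes: at (a, cd, b) both sides are \<beta>(acd, b) -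
  \<beta>(a, cdb), and on the right the terms \<beta>(ac, db) cancel.\<close>

lemma coboundary_cocycle:
  assumes \<beta>: "bilinear_bound \<beta> C" shows "coboundary \<beta> \<in> cocycles"
proof (rule cocyclesI)
  show "0 \<le> 2 * C" using bilinear_boundD(1)[OF \<beta>] by simp
  show "coboundary \<beta> (a, c, b) = 0" if "(a, c, b) \<notin> triples" for a c b using that by (simp add: coboundary_def)
next
  fix a c b assume s: "a \<in> BL" "c \<in> AO" "b \<in> BL"
  have c: "c \<in> BL" using s AO_subset by simp
  show "norm (coboundary \<beta> (a, c, b)) \<le> (2 * C) * (bn a * bn c * bn b)" by (rule coboundary_bound[OF \<beta> s])
  note D = bilinear_boundD(2-5)[OF \<beta>]
  show "coboundary \<beta> (osmult r a, c, b) = r * coboundary \<beta> (a, c, b)" for r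
    using s c by (simp add: coboundary_def in_triples comp_smult smult_BL comp_in_BL D algebra_simps)
  show "coboundary \<beta> (a, osmult r c, b) = r * coboundary \<beta> (a, c, b)" for r
    using s c by (simp add: coboundary_def in_triples comp_smult AO_smult comp_in_BL D algebra_simps)
  show "coboundary \<beta> (a, c, osmult r b) = r * coboundary \<beta> (a, c, b)" for r
    using s c by (simp add: coboundary_def in_triples comp_smult smult_BL comp_in_BL D algebra_simps)
  show "coboundary \<beta> (oadd a a', c, b) = coboundary \<beta> (a, c, b) + coboundary \<beta> (a', c, b)" if "a' \<in> BL" for a'
    using s c that by (simp add: coboundary_def in_triples comp_add add_BL comp_in_BL D algebra_simps)
  show "coboundary \<beta> (a, oadd c c', b) = coboundary \<beta> (a, c, b) + coboundary \<beta> (a, c', b)" if "c' \<in> AO" for c'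
    using s c that AO_subset[OF that] by (simp add: coboundary_def in_triples comp_add AO_add comp_in_BL D algebra_simps)
  show "coboundary \<beta> (a, c, oadd b b') = coboundary \<beta> (a, c, b) + coboundary \<beta> (a, c, b')" if "b' \<in> BL" for b'
    using s c that by (simp add: coboundary_def in_triples comp_add add_BL comp_in_BL D algebra_simps)
  show "coboundary \<beta> (a, cmp c e, b) = coboundary \<beta> (cmp a c, e, b) + coboundary \<beta> (a, c, cmp e b)" if "e \<in> AO" for e
    using s c that AO_subset[OF that] by (simp add: coboundary_def in_triples comp_assoc AO_comp comp_in_BL)
qed

lemma left_shift_coboundary:
  assumes "d \<in> BL" shows "left_shift d (coboundary \<beta>) = coboundary (\<lambda>a b. \<beta> a (cmp b d))"
  by (rule triples_ext, use AO_subset assms in \<open>simp add: left_shift_def coboundary_def in_triples comp_in_BL comp_assoc\<close>,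
      simp add: left_shift_def coboundary_def)

lemma right_shift_coboundary:
  assumes "d \<in> BL" shows "right_shift d (coboundary \<beta>) = coboundary (\<lambda>a b. \<beta> (cmp d a) b)"
  by (rule triples_ext, use AO_subset assms in \<open>simp add: right_shift_def coboundary_def in_triples comp_in_BL comp_assoc\<close>,
      simp add: right_shift_def coboundary_def)

end

section \<open>The derivation into the dual module and the virtual diagonal\<close>

context coded_nspace
begin

abbreviation "E \<equiv> cocycle_module"
abbreviation "E' \<equiv> dual_bimodule E"

lemma E_nspace: "nspace E"
  by (rule banach_space_nspace[OF cocycle_module_banach])

sublocale ES: nspace_pair E "scalars :: ('k, 'k) normed_space"
  unfolding nspace_pair_def using E_nspace scalars_nspace by simp

definition derivation :: "('v \<Rightarrow> 'v) \<Rightarrow> 'e \<Rightarrow> 'k" where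
  "derivation = (\<lambda>c\<in>AO. \<lambda>x\<in>carrier E. \<kappa> x (idX, c, idX))"

lemma E_simps:
  "carrier E = \<iota> ` cocycles" "\<zero>\<^bsub>E\<^esub> = \<iota> (\<lambda>s. 0)" "x \<oplus>\<^bsub>E\<^esub> y = \<iota> (\<lambda>s. \<kappa> x s + \<kappa> y s)"
  "r \<odot>\<^bsub>E\<^esub> x = \<iota> (\<lambda>s. r * \<kappa> x s)" "nrm E x = wnorm triples triple_weight (\<kappa> x)"
  "lact E d x = \<iota> (left_shift d (\<kappa> x))" "ract E x d = \<iota> (right_shift d (\<kappa> x))"
  by (simp_all add: cocycle_module_def)

lemma dual_simps:
  "carrier E' = bounded_linear_maps E scalars" "f \<oplus>\<^bsub>E'\<^esub> g = (\<lambda>x\<in>carrier E. f x + g x)"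
  "r \<odot>\<^bsub>E'\<^esub> f = (\<lambda>x\<in>carrier E. r * f x)" "nrm E' = nrm (operator_space E scalars)"
  "lact E' a f = (\<lambda>x\<in>carrier E. f (ract E x a))" "ract E' f a = (\<lambda>x\<in>carrier E. f (lact E a x))"
  "f \<ominus>\<^bsub>E'\<^esub> g = f \<ominus>\<^bsub>operator_space E scalars\<^esub> g"
  by (simp_all add: dual_bimodule_def operator_space_def normed_space.extend_def bimodule.fields_def a_minus_def a_inv_def m_inv_def)

lemma derivation_apply: "c \<in> AO \<Longrightarrow> g \<in> cocycles \<Longrightarrow> derivation c (\<iota> g) = g (idX, c, idX)"
  by (simp add: derivation_def E_simps)

lemma derivation_bound:
  assumes "c \<in> AO" "g \<in> cocycles"
  shows "norm (g (idX, c, idX)) \<le> bn c * wnorm triples triple_weight g"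
proof -
  let ?W = "wnorm triples triple_weight g"
  have nn: "0 \<le> ?W" "0 \<le> bn c" "0 \<le> bn idX"
    using wnorm_nonneg[OF triple_weight_nonneg assms(2)] XX.opn_nonneg assms(1) AO_subset id_in_BL by auto
  have "norm (g (idX, c, idX)) \<le> ?W * (bn idX * bn c * bn idX)"
    by (rule cocyclesD(9)[OF assms(2)]) (use assms id_in_BL in auto)
  also have "\<dots> \<le> ?W * (1 * bn c * 1)"
    by (intro mult_left_mono mult_mono mult_right_mono bn_id_le) (use nn in auto)
  finally show ?thesis by (simp add: mult.commute)
qed

lemma derivation_in_dual:
  assumes "c \<in> AO" shows "derivation c \<in> bounded_linear_maps E scalars"
proof -
  have "(\<lambda>x\<in>carrier E. \<kappa> x (idX, c, idX)) \<in> bounded_linear_maps E scalars"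
    by (rule ES.LI[where K = "bn c"]) (use assms derivation_bound in \<open>auto simp: E_simps\<close>)
  then show ?thesis using assms by (simp add: derivation_def)
qed

lemma derivation_continuous: "continuous_derivation (approximable_operators X) E' derivation"
  unfolding continuous_derivation_def
proof (intro conjI ballI)
  show "derivation \<in> bounded_linear_maps (approximable_operators X) E'"
    unfolding bounded_linear_maps_def[of "approximable_operators X"]
  proof (intro CollectI conjI ballI allI)
    show "derivation \<in> AO \<rightarrow>\<^sub>E carrier E'"
      using derivation_in_dual by (auto simp: dual_simps PiE_def Pi_def extensional_def derivation_def)
    show "derivation (c \<oplus>\<^bsub>approximable_operators X\<^esub> d) = derivation c \<oplus>\<^bsub>E'\<^esub> derivation d" if "c \<in> AO" "d \<in> AO" for c d
      using that by (auto simp: derivation_def approximable_operators_simps AO_add dual_simps E_simps cocyclesD(4) id_in_BL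
          intro!: restrict_ext)
    show "derivation (r \<odot>\<^bsub>approximable_operators X\<^esub> c) = r \<odot>\<^bsub>E'\<^esub> derivation c" if "c \<in> AO" for r c
      using that by (auto simp: derivation_def approximable_operators_simps AO_smult dual_simps E_simps cocyclesD(5) id_in_BL
          intro!: restrict_ext)
    show "\<exists>K. \<forall>c\<in>AO. nrm E' (derivation c) \<le> K * nrm (approximable_operators X) c"
    proof (intro exI[of _ 1] ballI)
      fix c assume c: "c \<in> AO"
      have "nrm (operator_space E scalars) (derivation c) \<le> bn c"
      proof (rule ES.opn_le)
        show "0 \<le> bn c" using c AO_subset XX.opn_nonneg by simp
        show "nrm scalars (derivation c x) \<le> bn c * nrm E x" if "x \<in> carrier E" for x
          using that c derivation_bound by (auto simp: E_simps derivation_apply)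
      qed
      then show "nrm E' (derivation c) \<le> 1 * nrm (approximable_operators X) c"
        by (simp add: dual_simps approximable_operators_simps)
    qed
  qed
  show "derivation (c \<otimes>\<^bsub>approximable_operators X\<^esub> d) = lact E' c (derivation d) \<oplus>\<^bsub>E'\<^esub> ract E' (derivation c) d"
    if cd: "c \<in> AO" "d \<in> AO" for c d
  proof -
    have BL: "c \<in> BL" "d \<in> BL" using cd AO_subset by auto
    \<comment> \<open>This is the cocycle identity at a = b = 1. Its terms are the values of
      \<open>derivation d\<close> at the right translate of g and of \<open>derivation c\<close> at
      the left translate, that is, the two terms of the product rule.\<close>
    have "g (idX, cmp c d, idX) = right_shift c g (idX, d, idX) + left_shift d g (idX, c, idX)" if "g \<in> cocycles" for g
      using cocyclesD(8)[OF that id_in_BL cd id_in_BL] cd BL id_in_BL comp_id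
      by (simp add: right_shift_def left_shift_def in_triples)
    then show ?thesis
      using cd BL by (auto simp: derivation_def approximable_operators_simps AO_comp dual_simps E_simps
          left_shift_cocycle right_shift_cocycle intro!: restrict_ext)
  qed
qed

lemma inner_derivation_functional:
  assumes "inner_derivation (approximable_operators X) E' derivation"
  shows "\<exists>f\<in>bounded_linear_maps E scalars. \<forall>c\<in>AO. \<forall>g\<in>cocycles.
     g (idX, c, idX) = f (\<iota> (right_shift c g)) - f (\<iota> (left_shift c g))"
proof -
  obtain f where f: "f \<in> bounded_linear_maps E scalars"
    and D: "\<And>c. c \<in> AO \<Longrightarrow> derivation c = lact E' c f \<ominus>\<^bsub>E'\<^esub> ract E' f c"
    using assms unfolding inner_derivation_def dual_simps(1) by blast
  have "g (idX, c, idX) = f (\<iota> (right_shift c g)) - f (\<iota> (left_shift c g))" if c: "c \<in> AO" and g: "g \<in> cocycles" for c g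
  proof -
    have cB: "c \<in> BL" using c AO_subset by simp
    have bnd: "norm (f (\<iota> h)) \<le> nrm (operator_space E scalars) f * wnorm triples triple_weight h" if "h \<in> cocycles" for h
      using ES.opn_bound[OF f, of "\<iota> h"] that by (simp add: E_simps)
    have f0: "0 \<le> nrm (operator_space E scalars) f" by (rule ES.opn_nonneg[OF f])
    have fadd: "f (\<iota> (\<lambda>s. h s + k s)) = f (\<iota> h) + f (\<iota> k)" if "h \<in> cocycles" "k \<in> cocycles" for h k
      using ES.L_add[OF f, of "\<iota> h" "\<iota> k"] that by (simp add: E_simps)
    have fsm: "f (\<iota> (\<lambda>s. r * h s)) = r * f (\<iota> h)" if "h \<in> cocycles" for h r
      using ES.L_smult[OF f, of "\<iota> h" r] that by (simp add: E_simps)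
    have b1: "norm (f (\<iota> (right_shift c h))) \<le> (nrm (operator_space E scalars) f * bn c) * wnorm triples triple_weight h"
      "norm (f (\<iota> (left_shift c h))) \<le> (nrm (operator_space E scalars) f * bn c) * wnorm triples triple_weight h" if h: "h \<in> cocycles" for h
      using order_trans[OF bnd[OF right_shift_cocycle[OF h cB]] mult_left_mono[OF shift_norm_le(2)[OF h cB] f0]]
        order_trans[OF bnd[OF left_shift_cocycle[OF h cB]] mult_left_mono[OF shift_norm_le(1)[OF h cB] f0]]
      by (simp_all add: mult_ac)
    have L: "lact E' c f \<in> bounded_linear_maps E scalars" "ract E' f c \<in> bounded_linear_maps E scalars"
      unfolding dual_simps
      by (rule ES.LI[where K = "nrm (operator_space E scalars) f * bn c"];
          use b1 fadd fsm cB in \<open>auto simp: E_simps shift_linear left_shift_cocycle right_shift_cocycle\<close>)+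
    have "derivation c (\<iota> g) = lact E' c f (\<iota> g) - ract E' f c (\<iota> g)"
      using g unfolding D[OF c] dual_simps(7) ES.operator_space_minus[OF L] by (simp add: scalars_minus E_simps)
    then show ?thesis using c g by (simp add: derivation_apply dual_simps E_simps)
  qed
  then show ?thesis using f by blast
qed

text \<open>If \<open>f\<close> implements the derivation, then \<open>\<phi>(\<beta>) = \<beta>(1, 1) - f(coboundary \<beta>)\<close> is a virtual diagonal.\<close>
lemma virtual_diagonal:
  assumes "inner_derivation (approximable_operators X) E' derivation"
  shows "\<exists>\<phi> K. 0 \<le> K \<and>
    (\<forall>\<beta> C. bilinear_bound \<beta> C \<longrightarrow> norm (\<phi> \<beta>) \<le> K * C) \<and>
    (\<forall>\<beta> C \<beta>' C' r t. bilinear_bound \<beta> C \<longrightarrow> bilinear_bound \<beta>' C' \<longrightarrow> \<phi> (\<lambda>a b. r * \<beta> a b + t * \<beta>' a b) = r * \<phi> \<beta> + t * \<phi> \<beta>') \<and>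
    (\<forall>\<beta> C c. bilinear_bound \<beta> C \<longrightarrow> c \<in> AO \<longrightarrow> \<phi> (\<lambda>a b. \<beta> (cmp c a) b) = \<phi> (\<lambda>a b. \<beta> a (cmp b c))) \<and>
    (\<forall>\<Lambda>. \<phi> (\<lambda>a b. \<Lambda> (cmp a b)) = \<Lambda> idX)"
proof -
  obtain f where f: "f \<in> bounded_linear_maps E scalars"
    and D: "\<And>c g. c \<in> AO \<Longrightarrow> g \<in> cocycles \<Longrightarrow> g (idX, c, idX) = f (\<iota> (right_shift c g)) - f (\<iota> (left_shift c g))"
    using inner_derivation_functional[OF assms] by blast
  define N where "N = nrm (operator_space E scalars) f"
  have N: "0 \<le> N" unfolding N_def by (rule ES.opn_nonneg[OF f])
  define \<phi> where "\<phi> = (\<lambda>\<beta>. \<beta> idX idX - f (\<iota> (coboundary \<beta>)))"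
  have id2: "cmp idX idX = idX" using comp_id[OF id_in_BL] by simp
  show ?thesis
  proof (intro exI[of _ \<phi>] exI[of _ "1 + 2 * N"] conjI allI impI)
    show "0 \<le> 1 + 2 * N" using N by simp
    show "norm (\<phi> \<beta>) \<le> (1 + 2 * N) * C" if \<beta>: "bilinear_bound \<beta> C" for \<beta> C
    proof -
      have C: "0 \<le> C" by (rule bilinear_boundD(1)[OF \<beta>])
      have "norm (\<beta> idX idX) \<le> C * (bn idX * bn idX)" by (rule bilinear_boundD(6)[OF \<beta> id_in_BL id_in_BL])
      also have "\<dots> \<le> C * (1 * 1)"
        by (intro mult_left_mono mult_mono bn_id_le C) (use XX.opn_nonneg id_in_BL in auto)
      finally have 1: "norm (\<beta> idX idX) \<le> C" by simp
      have "wnorm triples triple_weight (coboundary \<beta>) \<le> 2 * C"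
        by (rule wnorm_le) (use C coboundary_bound[OF \<beta>] in \<open>auto simp: triples_def triple_weight_def\<close>)
      then have "N * wnorm triples triple_weight (coboundary \<beta>) \<le> N * (2 * C)" by (rule mult_left_mono[OF _ N])
      moreover have "norm (f (\<iota> (coboundary \<beta>))) \<le> N * wnorm triples triple_weight (coboundary \<beta>)"
        using ES.opn_bound[OF f, of "\<iota> (coboundary \<beta>)"] coboundary_cocycle[OF \<beta>] by (simp add: E_simps N_def)
      ultimately show ?thesis
        using norm_triangle_ineq4[of "\<beta> idX idX" "f (\<iota> (coboundary \<beta>))"] 1 by (simp add: \<phi>_def algebra_simps)
    qed
    show "\<phi> (\<lambda>a b. r * \<beta> a b + t * \<beta>' a b) = r * \<phi> \<beta> + t * \<phi> \<beta>'"
      if b: "bilinear_bound \<beta> C" "bilinear_bound \<beta>' C'" for \<beta> C \<beta>' C' r t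
    proof -
      let ?g = "coboundary \<beta>" and ?h = "coboundary \<beta>'"
      have gh: "?g \<in> cocycles" "?h \<in> cocycles" using b coboundary_cocycle by auto
      have "coboundary (\<lambda>a b. r * \<beta> a b + t * \<beta>' a b) = (\<lambda>s. r * ?g s + t * ?h s)"
        by (auto simp: coboundary_def fun_eq_iff algebra_simps)
      moreover have "f (\<iota> (\<lambda>s. r * ?g s + t * ?h s)) = r * f (\<iota> ?g) + t * f (\<iota> ?h)"
        using ES.L_add[OF f, of "\<iota> (\<lambda>s. r * ?g s)" "\<iota> (\<lambda>s. t * ?h s)"] ES.L_smult[OF f, of "\<iota> ?g" r] ES.L_smult[OF f, of "\<iota> ?h" t]
          gh wspace_smult[OF triple_weight_nonneg gh(1), of r] wspace_smult[OF triple_weight_nonneg gh(2), of t]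
        by (simp add: E_simps)
      ultimately show ?thesis by (simp add: \<phi>_def algebra_simps)
    qed
    show "\<phi> (\<lambda>a b. \<beta> (cmp c a) b) = \<phi> (\<lambda>a b. \<beta> a (cmp b c))" if \<beta>: "bilinear_bound \<beta> C" and c: "c \<in> AO" for \<beta> C c
    proof -
      have cB: "c \<in> BL" using c AO_subset by simp
      \<comment> \<open>For the coboundary g of \<beta>, innerness reads \<beta>(c, 1) - \<beta>(1,
        c) = f(g.c) - f(c.g), and translates of g are coboundaries of translates of \<beta>.
        Regrouping gives the commutation.\<close>
      have "coboundary \<beta> (idX, c, idX) = f (\<iota> (right_shift c (coboundary \<beta>))) - f (\<iota> (left_shift c (coboundary \<beta>)))"
        by (rule D[OF c coboundary_cocycle[OF \<beta>]])
      moreover have "coboundary \<beta> (idX, c, idX) = \<beta> (cmp c idX) idX - \<beta> idX (cmp idX c)"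
        using c cB id_in_BL by (simp add: coboundary_def in_triples comp_id)
      ultimately show ?thesis
        by (simp add: \<phi>_def left_shift_coboundary[OF cB] right_shift_coboundary[OF cB] algebra_simps)
    qed
    show "\<phi> (\<lambda>a b. \<Lambda> (cmp a b)) = \<Lambda> idX" for \<Lambda>
    proof -
      \<comment> \<open>A form that depends only on the product ab has coboundary 0 by
        associativity.\<close>
      have "coboundary (\<lambda>a b. \<Lambda> (cmp a b)) = (\<lambda>s. 0)"
        by (rule triples_ext) (use AO_subset in \<open>simp_all add: coboundary_def in_triples comp_assoc\<close>)
      moreover have "f (\<iota> (\<lambda>s. 0)) = 0" using ES.L_zero[OF f] by (simp add: E_simps)
      ultimately show ?thesis by (simp add: \<phi>_def id2)
    qed
  qed
qed

end

subsection \<open>Operators on \<open>T\<^sup>(\<^sup>p\<^sup>)\<close>\<close>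

lemma tsirelson_seq_norm:
  fixes x :: "nat \<Rightarrow> 'k::real_normed_field"
  shows "tsirelson_seq m x = ts m (\<lambda>n. norm (x n))"
proof (induction m arbitrary: x)
  case (Suc m)
  have "restr E (\<lambda>n. norm (x n)) = (\<lambda>n. norm (restr E x n))" for E by (auto simp: restr_def)
  then show ?case by (simp add: tsirelson_seq.simps Suc)
qed (simp add: tsirelson_seq.simps)

lemma tsirelson_norm_norm:
  fixes x :: "nat \<Rightarrow> 'k::real_normed_field"
  shows "tsirelson_norm x = tn (\<lambda>n. norm (x n))"
  by (simp add: tsirelson_norm_def tsirelson_seq_norm[of _ x])

lemma nu_subset:
  assumes "1 \<le> p" "finite S'" "S \<subseteq> S'" shows "nu p S x \<le> nu p S' x"
  unfolding nu_def using assms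
  by (intro powr_mono2 tn.mono tn.nonneg fsupp_restr_finite)
     (auto simp: restr_apply finite_subset[OF assms(3,2)])

lemma nu_restr:
  assumes "1 \<le> p" shows "nu p S (restr A x) = nu p (S \<inter> A) x"
proof -
  have "restr S (\<lambda>n. norm (restr A x n) powr p) = restr (S \<inter> A) (\<lambda>n. norm (x n) powr p)"
    using assms by (auto simp: restr_def)
  then show ?thesis by (simp add: nu_def)
qed

lemma nu_supp:
  assumes "1 \<le> p" "\<And>n. n \<in> S' \<Longrightarrow> n \<notin> S \<Longrightarrow> x n = 0" "S \<subseteq> S'" shows "nu p S' x = nu p S x"
proof -
  have "restr S' (\<lambda>n. norm (x n) powr p) n = restr S (\<lambda>n. norm (x n) powr p) n" for n
    using assms(1,3) assms(2)[of n] by (auto simp: restr_apply)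
  then have "restr S' (\<lambda>n. norm (x n) powr p) = restr S (\<lambda>n. norm (x n) powr p)" by blast
  then show ?thesis by (simp add: nu_def)
qed

text \<open>The sort of 'k covers the real and the complex numbers at once; the real inner product
  on the scalars is the one in Khintchine's inequality.\<close>

locale tsirelson_space =
  fixes p :: real and X :: "('k::{real_normed_field, banach, real_inner}, nat \<Rightarrow> 'k) normed_space" (structure)
  assumes p: "1 \<le> p" and X: "X = Tp p"
begin

lemma tsirelson_norm_restr: "tsirelson_norm (restr S (abs_powr p x)) = tn (restr S (\<lambda>n. norm (x n :: 'k) powr p))"
proof -
  have "(\<lambda>n. norm (restr S (abs_powr p x) n)) = restr S (\<lambda>n. norm (x n) powr p)"
    by (auto simp: restr_def abs_powr_def)
  then show ?thesis by (subst tsirelson_norm_norm) simp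
qed

lemma nu_less_iff:
  assumes "finite S" "0 < e"
  shows "nu p S x < e \<longleftrightarrow> tn (restr S (\<lambda>n. norm (x n :: 'k) powr p)) < e powr p"
proof
  assume "nu p S x < e"
  then have "nu p S x powr p < e powr p" using p nu_nonneg[OF p assms(1), of x] by (intro powr_less_mono2) auto
  then show "tn (restr S (\<lambda>n. norm (x n) powr p)) < e powr p" by (simp add: nu_powr[OF p assms(1)])
next
  assume "tn (restr S (\<lambda>n. norm (x n) powr p)) < e powr p"
  then have "nu p S x < (e powr p) powr (1 / p)"
    unfolding nu_def using p assms by (intro powr_less_mono2 tn.nonneg fsupp_restr_finite) auto
  then show "nu p S x < e" using p assms by (simp add: powr_powr)
qed

lemma carrier_iff:
  "x \<in> carrier X \<longleftrightarrow> x 0 = 0 \<and> (\<forall>e>0. \<exists>N. \<forall>m n. N \<le> m \<and> m \<le> n \<longrightarrow> nu p {m<..n} x < e)"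
proof -
  have "x \<in> carrier X \<longleftrightarrow> x 0 = 0 \<and> (\<forall>e>0. \<exists>N. \<forall>m n. N \<le> m \<and> m \<le> n \<longrightarrow> tn (restr {m<..n} (\<lambda>n. norm (x n) powr p)) < e)"
    using p by (simp add: X Tp_def Tstar_def tsirelson_norm_restr abs_powr_def[of p x, THEN fun_cong, of 0])
  also have "(\<forall>e>0. \<exists>N. \<forall>m n. N \<le> m \<and> m \<le> n \<longrightarrow> tn (restr {m<..n} (\<lambda>n. norm (x n) powr p)) < e)
     \<longleftrightarrow> (\<forall>e>0. \<exists>N. \<forall>m n. N \<le> m \<and> m \<le> n \<longrightarrow> nu p {m<..n} x < e)" (is "?L \<longleftrightarrow> ?R")
  proof
    assume ?L
    show ?R
    proof (intro allI impI)
      fix e :: real assume e: "0 < e"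
      then have "0 < e powr p" by simp
      then show "\<exists>N. \<forall>m n. N \<le> m \<and> m \<le> n \<longrightarrow> nu p {m<..n} x < e"
        using \<open>?L\<close> nu_less_iff[OF _ e] by simp
    qed
  next
    assume ?R
    show ?L
    proof (intro allI impI)
      fix e :: real assume e: "0 < e"
      then have e': "0 < e powr (1 / p)" by simp
      have "(e powr (1 / p)) powr p = e" using e p by (simp add: powr_powr)
      then show "\<exists>N. \<forall>m n. N \<le> m \<and> m \<le> n \<longrightarrow> tn (restr {m<..n} (\<lambda>n. norm (x n) powr p)) < e"
        using \<open>?R\<close>[rule_format, OF e'] by (simp add: nu_less_iff[OF _ e'])
    qed
  qed
  finally show ?thesis .
qed

lemma X_simps: "\<zero> = (\<lambda>n. 0)" "x \<oplus> y = (\<lambda>n. x n + y n)" "c \<odot> x = (\<lambda>n. c * x n)"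
  by (simp_all add: X Tp_def)

text \<open>The norm is defined by a \<open>lim\<close>, which is informative only once convergence
  is known. The p-th powers of the partial norms increase and are bounded by the Cauchy condition
  with bound 1.\<close>

lemma nrm_tendsto: assumes "x \<in> carrier X" shows "(\<lambda>n. nu p {..n} x) \<longlonglongrightarrow> nrm X x"
proof -
  define g where "g = (\<lambda>n. norm (x n) powr p)"
  let ?t = "\<lambda>n. tn (restr {..n} g)"
  obtain N where N: "\<And>n. N \<le> n \<Longrightarrow> nu p {N<..n} x < 1"
    using assms unfolding carrier_iff by (metis order_refl zero_less_one)
  have inc: "incseq ?t"
    unfolding incseq_def by (intro allI impI tn.mono) (auto simp: restr_apply)
  have bd: "?t n \<le> ?t N + 1" for n
  proof (cases "n \<le> N")
    case True
    then show ?thesis using incseqD[OF inc] by fastforce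
  next
    case False
    have "?t n \<le> tn (restr {..N} g) + tn (restr {N<..n} g)"
    proof -
      have "restr {..n} g = (\<lambda>i. restr {..N} g i + restr {N<..n} g i)" using False by (auto simp: restr_def)
      then show ?thesis using tn.tri[of "restr {..N} g" "restr {N<..n} g"] by (simp add: fsupp_restr_finite)
    qed
    moreover have "tn (restr {N<..n} g) < 1 powr p"
      using N[of n] False nu_less_iff[of "{N<..n}" 1 x] by (simp add: g_def)
    ultimately show ?thesis by simp
  qed
  obtain L where L: "?t \<longlonglongrightarrow> L" using incseq_convergent[OF inc, of "?t N + 1"] bd by metis
  have "nrm X x = lim ?t powr (1 / p)"
    by (simp add: X Tp_def Tstar_norm_def tsirelson_norm_restr g_def)
  moreover have "lim ?t = L" by (rule limI[OF L])
  moreover have "(\<lambda>n. ?t n powr (1 / p)) \<longlonglongrightarrow> L powr (1 / p)"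
    by (rule tendsto_powr'[OF L tendsto_const]) (use p tn.nonneg in auto)
  ultimately show ?thesis by (simp add: nu_def g_def)
qed

lemma nu_le_nrm: assumes "x \<in> carrier X" "finite S" shows "nu p S x \<le> nrm X x"
proof -
  obtain M where "S \<subseteq> {..M}" using assms(2) finite_nat_iff_bounded_le by auto
  then have "nu p S x \<le> nu p {..M} x" by (intro nu_subset[OF p]) auto
  also have "\<dots> \<le> nrm X x"
    by (rule incseq_le[OF _ nrm_tendsto[OF assms(1)]]) (auto simp: incseq_def intro: nu_subset[OF p])
  finally show ?thesis .
qed

lemma nrm_le: "x \<in> carrier X \<Longrightarrow> (\<And>n. nu p {..n} x \<le> K) \<Longrightarrow> nrm X x \<le> K"
  by (rule LIMSEQ_le_const2[OF nrm_tendsto]) auto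

lemma add_carrier: assumes "x \<in> carrier X" "y \<in> carrier X" shows "(\<lambda>n. x n + y n) \<in> carrier X"
  unfolding carrier_iff
proof (intro conjI allI impI)
  show "x 0 + y 0 = 0" using assms by (simp add: carrier_iff)
  fix e :: real assume e: "0 < e"
  obtain N where N: "\<And>m n. N \<le> m \<and> m \<le> n \<Longrightarrow> nu p {m<..n} x < e / 2"
    using assms(1) half_gt_zero[OF e] unfolding carrier_iff by blast
  obtain M where M: "\<And>m n. M \<le> m \<and> m \<le> n \<Longrightarrow> nu p {m<..n} y < e / 2"
    using assms(2) half_gt_zero[OF e] unfolding carrier_iff by blast
  have "nu p {m<..n} (\<lambda>n. x n + y n) < e" if "max N M \<le> m \<and> m \<le> n" for m n
    using N[of m n] M[of m n] that nu_tri[OF p, of "{m<..n}" x y] by simp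
  then show "\<exists>N. \<forall>m n. N \<le> m \<and> m \<le> n \<longrightarrow> nu p {m<..n} (\<lambda>n. x n + y n) < e" by blast
qed

lemma dominated_carrier:
  assumes "x \<in> carrier X" "\<And>n. norm (y n) \<le> C * norm (x n)" "0 \<le> C" shows "y \<in> carrier X"
  unfolding carrier_iff
proof (intro conjI allI impI)
  show "y 0 = 0" using assms(1) assms(2)[of 0] by (simp add: carrier_iff)
  fix e :: real assume e: "0 < e"
  have "0 < e / (C + 1)" using e assms(3) by simp
  then obtain N where N: "\<And>m n. N \<le> m \<and> m \<le> n \<Longrightarrow> nu p {m<..n} x < e / (C + 1)"
    using assms(1) unfolding carrier_iff by blast
  have "nu p {m<..n} y < e" if "N \<le> m \<and> m \<le> n" for m n
  proof -
    have "nu p {m<..n} y \<le> nu p {m<..n} (\<lambda>n. C * norm (x n))"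
      by (rule nu_mono[OF p]) (use assms(2,3) in auto)
    also have "\<dots> = C * nu p {m<..n} x"
      by (rule nu_scale[OF p]) (use assms(3) in \<open>auto simp: abs_mult\<close>)
    also have "\<dots> \<le> (C + 1) * nu p {m<..n} x"
      using nu_nonneg[OF p, of "{m<..n}" x] by (intro mult_right_mono) auto
    also have "\<dots> < e" using N[OF that] assms(3) by (simp add: field_simps)
    finally show ?thesis .
  qed
  then show "\<exists>N. \<forall>m n. N \<le> m \<and> m \<le> n \<longrightarrow> nu p {m<..n} y < e" by blast
qed

lemma smult_carrier: "x \<in> carrier X \<Longrightarrow> (\<lambda>n. c * x n) \<in> carrier X"
  by (rule dominated_carrier[of x _ "norm c"]) (auto simp: norm_mult)

lemma restr_carrier: "x \<in> carrier X \<Longrightarrow> restr A x \<in> carrier X"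
  by (rule dominated_carrier[of x _ 1]) (auto simp: restr_apply)

lemma finite_support_carrier:
  assumes "finite S" "0 \<notin> S" "\<And>n. n \<notin> S \<Longrightarrow> x n = 0" shows "x \<in> carrier X" "nrm X x = nu p S x"
proof -
  obtain M where M: "S \<subseteq> {..M}" using assms(1) finite_nat_iff_bounded_le by auto
  have "nu p {m<..n} x = 0" if "M \<le> m" for m n
    by (rule nu_zero[OF p]) (use assms(3) M that in fastforce)+
  then have "\<forall>m n. M \<le> m \<and> m \<le> n \<longrightarrow> nu p {m<..n} x < e" if "0 < e" for e using that by simp
  then show x: "x \<in> carrier X" unfolding carrier_iff using assms(2,3) by blast
  have "nu p {..n} x = nu p S x" if "M \<le> n" for n
    by (rule nu_supp[OF p]) (use assms(3) M that in auto)
  then have "(\<lambda>n. nu p {..n} x) \<longlonglongrightarrow> nu p S x"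
    by (intro tendsto_eventually) (auto simp: eventually_sequentially)
  then show "nrm X x = nu p S x" using nrm_tendsto[OF x] LIMSEQ_unique by blast
qed

lemma norm_le_nrm: "x \<in> carrier X \<Longrightarrow> norm (x i) \<le> nrm X x"
  using norm_le_nu[OF p, of "{i}" i x] nu_le_nrm[of x "{i}"] by simp

lemma X_nspace: "nspace X"
proof (rule nspace.intro)
  have ag: "abelian_group X"
  proof (rule abelian_groupI)
    show "\<zero> \<in> carrier X" using finite_support_carrier(1)[of "{}"] by (simp add: X_simps)
    fix x assume x: "x \<in> carrier X"
    show "\<exists>y\<in>carrier X. y \<oplus> x = \<zero>"
      using smult_carrier[OF x, of "- 1"] by (intro bexI[of _ "\<lambda>n. - x n"]) (auto simp: X_simps)
  qed (auto simp: X_simps add_carrier algebra_simps)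
  show "Module.module (scalars :: ('k, 'k) normed_space) X"
    by (rule moduleI[OF scalars_cring ag]) (auto simp: X_simps smult_carrier algebra_simps)
  show "0 \<le> nrm X x" if "x \<in> carrier X" for x
    using nu_le_nrm[OF that, of "{}"] nu_nonneg[OF p, of "{}" x] by simp
  show "nrm X x = 0 \<longleftrightarrow> x = \<zero>" if "x \<in> carrier X" for x
  proof
    assume "nrm X x = 0"
    then have "x n = 0" for n using norm_le_nrm[OF that, of n] by simp
    then show "x = \<zero>" by (auto simp: X_simps)
  next
    assume "x = \<zero>"
    then show "nrm X x = 0"
      using finite_support_carrier(2)[of "{}" x] nu_zero[OF p, of "{}" x] by (simp add: X_simps)
  qed
  show "nrm X (x \<oplus> y) \<le> nrm X x + nrm X y" if "x \<in> carrier X" "y \<in> carrier X" for x y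
  proof (rule nrm_le)
    show "nu p {..n} (x \<oplus> y) \<le> nrm X x + nrm X y" for n
      using nu_tri[OF p, of "{..n}" x y] nu_le_nrm[OF that(1), of "{..n}"] nu_le_nrm[OF that(2), of "{..n}"]
      by (simp add: X_simps)
  qed (use that add_carrier in \<open>simp add: X_simps\<close>)
  show "nrm X (c \<odot> x) = norm c * nrm X x" if x: "x \<in> carrier X" for c x
  proof (rule LIMSEQ_unique)
    show "(\<lambda>n. nu p {..n} (c \<odot> x)) \<longlonglongrightarrow> nrm X (c \<odot> x)"
      by (rule nrm_tendsto) (simp add: X_simps smult_carrier x)
    have "nu p {..n} (c \<odot> x) = norm c * nu p {..n} x" for n
      by (rule nu_scale[OF p]) (auto simp: X_simps norm_mult)
    then show "(\<lambda>n. nu p {..n} (c \<odot> x)) \<longlonglongrightarrow> norm c * nrm X x"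
      using tendsto_mult_left[OF nrm_tendsto[OF x], of "norm c"] by simp
  qed
qed

sublocale nspace X by (rule X_nspace)

lemma tail_tendsto: assumes "x \<in> carrier X" shows "(\<lambda>M. nrm X (restr {M<..} x)) \<longlonglongrightarrow> 0"
proof (rule LIMSEQ_I)
  fix e :: real assume e: "0 < e"
  obtain N where N: "\<And>m n. N \<le> m \<and> m \<le> n \<Longrightarrow> nu p {m<..n} x < e / 2"
    using assms half_gt_zero[OF e] unfolding carrier_iff by blast
  have "nrm X (restr {M<..} x) \<le> e / 2" if "N \<le> M" for M
  proof (rule nrm_le[OF restr_carrier[OF assms]])
    fix n
    have "{..n} \<inter> {M<..} = {M<..n}" by auto
    then have "nu p {..n} (restr {M<..} x) = nu p {M<..n} x" by (simp add: nu_restr[OF p])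
    also have "\<dots> \<le> e / 2"
    proof (cases "M \<le> n")
      case True
      then show ?thesis using N[of M n] that by simp
    next
      case False
      then show ?thesis using e nu_zero[OF p, of "{M<..n}" x] by simp
    qed
    finally show "nu p {..n} (restr {M<..} x) \<le> e / 2" .
  qed
  note le = this
  have ge: "0 \<le> nrm X (restr {M<..} x)" for M by (rule nrm_nonneg[OF restr_carrier[OF assms]])
  show "\<exists>N. \<forall>M\<ge>N. norm (nrm X (restr {M<..} x) - 0) < e"
  proof (intro exI[of _ N] allI impI)
    fix M assume "N \<le> M"
    then have "nrm X (restr {M<..} x) \<le> e / 2" by (rule le)
    then show "norm (nrm X (restr {M<..} x) - 0) < e"
      using ge[of M] e by simp
  qed
qed

section \<open>Matrix entries of bounded operators\<close>

definition ev :: "nat \<Rightarrow> nat \<Rightarrow> 'k" where "ev j = (\<lambda>n. if n = j then 1 else 0)"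

definition entry :: "((nat \<Rightarrow> 'k) \<Rightarrow> nat \<Rightarrow> 'k) \<Rightarrow> nat \<Rightarrow> nat \<Rightarrow> 'k" where "entry a i j = a (ev j) i"

definition unit_matrix :: "nat \<Rightarrow> nat \<Rightarrow> (nat \<Rightarrow> 'k) \<Rightarrow> nat \<Rightarrow> 'k" where
  "unit_matrix i j = (\<lambda>x\<in>carrier X. \<lambda>n. x j * ev i n)"

lemma ev_carrier: assumes "j \<noteq> 0" shows "ev j \<in> carrier X" "nrm X (ev j) \<le> 1"
proof -
  show "ev j \<in> carrier X" by (rule finite_support_carrier(1)[of "{j}"]) (use assms in \<open>auto simp: ev_def\<close>)
  have "nrm X (ev j) = nu p {j} (ev j)" by (rule finite_support_carrier(2)) (use assms in \<open>auto simp: ev_def\<close>)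
  also have "\<dots> \<le> 1"
  proof -
    have "tn (restr {j} (\<lambda>n. norm (ev j n) powr p)) \<le> l1 (restr {j} (\<lambda>n. norm (ev j n) powr p))"
      by (rule tn.le_l1) (simp add: fsupp_restr_finite)
    also have "\<dots> = (\<Sum>n<Suc j. \<bar>restr {j} (\<lambda>n. norm (ev j n) powr p) n\<bar>)"
      by (rule l1_eq_sum) (simp add: restr_apply)
    also have "\<dots> = (\<Sum>n\<in>{j}. \<bar>restr {j} (\<lambda>n. norm (ev j n) powr p) n\<bar>)"
      by (rule sum.mono_neutral_right) (auto simp: restr_apply)
    also have "\<dots> = 1" by (simp add: restr_apply ev_def)
    finally have "tn (restr {j} (\<lambda>n. norm (ev j n) powr p)) powr (1 / p) \<le> 1 powr (1 / p)"
      using p by (intro powr_mono2 tn.nonneg) (auto simp: fsupp_restr_finite)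
    then show ?thesis by (simp add: nu_def)
  qed
  finally show "nrm X (ev j) \<le> 1" .
qed

lemma entry_bound: assumes "a \<in> BL" "j \<noteq> 0" shows "norm (entry a i j) \<le> bn a"
proof -
  have "norm (entry a i j) \<le> nrm X (a (ev j))"
    unfolding entry_def by (rule norm_le_nrm) (use assms ev_carrier XX.L_closed in auto)
  also have "\<dots> \<le> bn a * nrm X (ev j)" by (rule XX.opn_bound) (use assms ev_carrier in auto)
  also have "\<dots> \<le> bn a * 1" by (intro mult_left_mono ev_carrier XX.opn_nonneg assms)
  finally show ?thesis by simp
qed

lemma apply_finite_support:
  assumes a: "a \<in> BL" and J: "finite J" "0 \<notin> J"
  shows "a (restr J x) i = (\<Sum>j\<in>J. entry a i j * x j)"
  using J
proof (induction J rule: finite_induct)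
  case empty
  have "restr {} x = \<zero>" by (auto simp: restr_def X_simps)
  then show ?case using XX.L_zero[OF a] by (simp add: X_simps)
next
  case (insert j J)
  have e: "restr (insert j J) x = (x j \<odot> ev j) \<oplus> restr J x"
    using insert by (auto simp: restr_def X_simps ev_def)
  have c: "x j \<odot> ev j \<in> carrier X" "ev j \<in> carrier X" "restr J x \<in> carrier X"
    using ev_carrier insert by (auto simp: X_simps smult_carrier restr_apply intro: finite_support_carrier(1)[of J])
  have "a (restr (insert j J) x) = (x j \<odot> a (ev j)) \<oplus> a (restr J x)"
    unfolding e using XX.L_add[OF a c(1,3)] XX.L_smult[OF a c(2)] by simp
  then show ?case using insert by (simp add: X_simps entry_def)
qed

lemma matrix_bound_entry:
  assumes a: "a \<in> BL" and J: "finite J" "0 \<notin> J" and F: "finite F"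
  shows "matrix_bound p J F (bn a) (entry a)"
  unfolding matrix_bound_def
proof
  fix x :: "nat \<Rightarrow> 'k"
  have c: "restr J x \<in> carrier X" "nrm X (restr J x) = nu p J x"
    using finite_support_carrier[OF J, of "restr J x"] nu_restr[OF p, of J J x] by (auto simp: restr_apply)
  have "nu p F (\<lambda>i. \<Sum>j\<in>J. entry a i j * x j) = nu p F (a (restr J x))"
    by (simp add: apply_finite_support[OF a J, symmetric])
  also have "\<dots> \<le> nrm X (a (restr J x))" by (rule nu_le_nrm[OF XX.L_closed[OF a c(1)] F])
  also have "\<dots> \<le> bn a * nrm X (restr J x)" by (rule XX.opn_bound[OF a c(1)])
  finally show "nu p F (\<lambda>i. \<Sum>j\<in>J. entry a i j * x j) \<le> bn a * nu p J x" using c by simp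
qed

text \<open>Matrix units have rank at most one. They are the only elements of A(X) for which the
  commutation property of the virtual diagonal is used.\<close>

lemma unit_matrix_AO: assumes "i \<noteq> 0" shows "unit_matrix i j \<in> AO"
proof (rule finite_rank_approximable)
  interpret module "scalars :: ('k, 'k) normed_space" X by (rule is_module)
  have s: "(\<lambda>n. x j * ev i n) = x j \<odot> ev i" for x by (simp add: X_simps)
  have "(\<lambda>x\<in>carrier X. \<lambda>n. x j * ev i n) \<in> BL"
  proof (rule XX.LI[where K = 1])
    show "(\<lambda>n. x j * ev i n) \<in> carrier X" for x unfolding s using ev_carrier(1)[OF assms] by simp
    show "nrm X (\<lambda>n. x j * ev i n) \<le> 1 * nrm X x" if x: "x \<in> carrier X" for x
    proof -
      have "nrm X (\<lambda>n. x j * ev i n) = norm (x j) * nrm X (ev i)"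
        unfolding s by (rule nrm_smult[OF ev_carrier(1)[OF assms]])
      also have "\<dots> \<le> nrm X x * 1"
        by (intro mult_mono norm_le_nrm[OF x] ev_carrier(2) assms nrm_nonneg ev_carrier(1) x)
      finally show ?thesis by simp
    qed
  qed (auto simp: X_simps algebra_simps)
  moreover have "\<exists>c. (\<lambda>n. x j * ev i n) = (\<Oplus>b\<in>{ev i}. c b \<odot> b)" for x
    by (rule exI[of _ "\<lambda>b. x j"]) (use ev_carrier(1)[OF assms] in \<open>simp add: s finsum_insert\<close>)
  ultimately show "unit_matrix i j \<in> finite_rank_operators X"
    unfolding finite_rank_operators_def unit_matrix_def
    using ev_carrier(1)[OF assms] by (auto intro!: exI[of _ "{ev i}"])
qed

lemma entry_unit_matrix:
  assumes "a \<in> BL" "i \<noteq> 0" "j \<noteq> 0" "i' \<noteq> 0"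
  shows "entry (cmp (unit_matrix i' i) a) i' j = entry a i j" "entry (cmp a (unit_matrix i' i)) j i = entry a j i'"
proof -
  show "entry (cmp (unit_matrix i' i) a) i' j = entry a i j"
    using ev_carrier(1)[OF assms(3)] XX.L_closed[OF assms(1) ev_carrier(1)[OF assms(3)]]
    by (simp add: entry_def compose_def unit_matrix_def ev_def)
  have "(\<lambda>n. ev i i * ev i' n) = ev i'" by (simp add: ev_def)
  then show "entry (cmp a (unit_matrix i' i)) j i = entry a j i'"
    using ev_carrier(1)[OF assms(2)] by (simp add: entry_def compose_def unit_matrix_def)
qed

lemma entry_linear:
  "a \<in> BL \<Longrightarrow> b \<in> BL \<Longrightarrow> j \<noteq> 0 \<Longrightarrow> entry (add (operator_space X X) a b) i j = entry a i j + entry b i j"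
  "a \<in> BL \<Longrightarrow> j \<noteq> 0 \<Longrightarrow> entry (smult (operator_space X X) r a) i j = r * entry a i j"
  using ev_carrier(1)[of j] by (simp_all add: entry_def operator_space_def X_simps)

lemma bilinear_boundI:
  assumes "0 \<le> C"
    "\<And>a a' b. a \<in> BL \<Longrightarrow> a' \<in> BL \<Longrightarrow> b \<in> BL \<Longrightarrow> \<beta> (oadd a a') b = \<beta> a b + \<beta> a' b"
    "\<And>a a' b. a \<in> BL \<Longrightarrow> a' \<in> BL \<Longrightarrow> b \<in> BL \<Longrightarrow> \<beta> b (oadd a a') = \<beta> b a + \<beta> b a'"
    "\<And>r a b. a \<in> BL \<Longrightarrow> b \<in> BL \<Longrightarrow> \<beta> (osmult r a) b = r * \<beta> a b"
    "\<And>r a b. a \<in> BL \<Longrightarrow> b \<in> BL \<Longrightarrow> \<beta> a (osmult r b) = r * \<beta> a b"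
    "\<And>a b. a \<in> BL \<Longrightarrow> b \<in> BL \<Longrightarrow> norm (\<beta> a b) \<le> C * (bn a * bn b)"
  shows "bilinear_bound \<beta> C"
  unfolding bilinear_bound_def by (intro conjI ballI allI; rule assms)

lemma bilinear_bound_improve:
  assumes "bilinear_bound \<beta> C" "0 \<le> C'" "\<And>a b. a \<in> BL \<Longrightarrow> b \<in> BL \<Longrightarrow> norm (\<beta> a b) \<le> C' * (bn a * bn b)"
  shows "bilinear_bound \<beta> C'"
  using assms unfolding bilinear_bound_def by blast

lemma bilinear_bound_lincomb:
  assumes "bilinear_bound \<beta> C" "bilinear_bound \<beta>' C'"
  shows "bilinear_bound (\<lambda>a b. r * \<beta> a b + t * \<beta>' a b) (norm r * C + norm t * C')"
proof (rule bilinear_boundI)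
  note D = bilinear_boundD[OF assms(1)] and D' = bilinear_boundD[OF assms(2)]
  show "0 \<le> norm r * C + norm t * C'" using D(1) D'(1) by simp
  fix a b assume ab: "a \<in> BL" "b \<in> BL"
  have "norm (r * \<beta> a b + t * \<beta>' a b) \<le> norm r * norm (\<beta> a b) + norm t * norm (\<beta>' a b)"
    by (metis norm_mult norm_triangle_ineq)
  also have "\<dots> \<le> norm r * (C * (bn a * bn b)) + norm t * (C' * (bn a * bn b))"
    by (intro add_mono mult_left_mono D(6) D'(6) ab) auto
  finally show "norm (r * \<beta> a b + t * \<beta>' a b) \<le> (norm r * C + norm t * C') * (bn a * bn b)" by (simp add: algebra_simps)
qed (simp_all add: bilinear_boundD[OF assms(1)] bilinear_boundD[OF assms(2)] algebra_simps)

lemma entry_product_bound: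
  assumes "j \<noteq> 0" "i' \<noteq> 0" shows "bilinear_bound (\<lambda>a b. entry a i j * entry b j' i') 1"
proof (rule bilinear_boundI)
  show "norm (entry a i j * entry b j' i') \<le> 1 * (bn a * bn b)" if "a \<in> BL" "b \<in> BL" for a b
    using that assms by (auto simp: norm_mult intro!: mult_mono entry_bound XX.opn_nonneg)
qed (use assms in \<open>auto simp: entry_linear algebra_simps\<close>)

lemma balanced_entry_bound:
  assumes "i \<noteq> 0" shows "bilinear_bound (\<lambda>a b. entry (cmp a b) i i) 1"
proof (rule bilinear_boundI)
  show "norm (entry (cmp a b) i i) \<le> 1 * (bn a * bn b)" if "a \<in> BL" "b \<in> BL" for a b
    using entry_bound[OF comp_in_BL[OF that] assms, of i] bn_comp_le[OF that] by simp
qed (use assms in \<open>simp_all add: entry_linear comp_add comp_smult comp_in_BL\<close>)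

section \<open>The contradiction with a virtual diagonal\<close>

context
  fixes \<phi> :: "(((nat \<Rightarrow> 'k) \<Rightarrow> nat \<Rightarrow> 'k) \<Rightarrow> ((nat \<Rightarrow> 'k) \<Rightarrow> nat \<Rightarrow> 'k) \<Rightarrow> 'k) \<Rightarrow> 'k" and K :: real
  assumes K: "0 \<le> K" and \<phi>_bound: "\<And>\<beta> C. bilinear_bound \<beta> C \<Longrightarrow> norm (\<phi> \<beta>) \<le> K * C"
    and \<phi>_linear: "\<And>\<beta> C \<beta>' C' r t. bilinear_bound \<beta> C \<Longrightarrow> bilinear_bound \<beta>' C' \<Longrightarrow>
      \<phi> (\<lambda>a b. r * \<beta> a b + t * \<beta>' a b) = r * \<phi> \<beta> + t * \<phi> \<beta>'"
    and \<phi>_commute: "\<And>\<beta> C c. bilinear_bound \<beta> C \<Longrightarrow> c \<in> AO \<Longrightarrow> \<phi> (\<lambda>a b. \<beta> (cmp c a) b) = \<phi> (\<lambda>a b. \<beta> a (cmp b c))"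
    and \<phi>_balanced: "\<And>\<Lambda>. \<phi> (\<lambda>a b. \<Lambda> (cmp a b)) = \<Lambda> idX"
begin

text \<open>Here \<phi> is defined on arbitrary functions of two operators and might depend on
  values outside \<open>BL\<close>. Its bound excludes this, since the difference of the two forms
  admits the bound 0.\<close>

lemma \<phi>_cong:
  assumes "bilinear_bound \<beta> C" "\<And>a b. a \<in> BL \<Longrightarrow> b \<in> BL \<Longrightarrow> \<beta>' a b = \<beta> a b"
  shows "\<phi> \<beta>' = \<phi> \<beta>"
proof -
  have \<beta>': "bilinear_bound \<beta>' C"
    using assms unfolding bilinear_bound_def by (simp add: add_BL smult_BL)
  have "bilinear_bound (\<lambda>a b. 1 * \<beta>' a b + (- 1) * \<beta> a b) 0"
    by (rule bilinear_bound_improve[OF bilinear_bound_lincomb[OF \<beta>' assms(1)]]) (use assms(2) in auto)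
  then have "norm (\<phi> (\<lambda>a b. 1 * \<beta>' a b + (- 1) * \<beta> a b)) \<le> 0" using \<phi>_bound by fastforce
  then show ?thesis using \<phi>_linear[OF \<beta>' assms(1), of 1 "- 1"] by simp
qed

lemma \<phi>_sum:
  assumes "finite Q" "\<And>q. q \<in> Q \<Longrightarrow> bilinear_bound (\<beta> q) (C q)"
  shows "bilinear_bound (\<lambda>a b. \<Sum>q\<in>Q. r q * \<beta> q a b) (\<Sum>q\<in>Q. norm (r q) * C q) \<and>
    \<phi> (\<lambda>a b. \<Sum>q\<in>Q. r q * \<beta> q a b) = (\<Sum>q\<in>Q. r q * \<phi> (\<beta> q))"
  using assms
proof (induction Q rule: finite_induct)
  case empty
  have z: "bilinear_bound (\<lambda>a b. 0) 0" by (rule bilinear_boundI) auto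
  then show ?case using \<phi>_bound[OF z] by simp
next
  case (insert q Q)
  have IH: "bilinear_bound (\<lambda>a b. \<Sum>q\<in>Q. r q * \<beta> q a b) (\<Sum>q\<in>Q. norm (r q) * C q)"
    "\<phi> (\<lambda>a b. \<Sum>q\<in>Q. r q * \<beta> q a b) = (\<Sum>q\<in>Q. r q * \<phi> (\<beta> q))" using insert by auto
  have q: "bilinear_bound (\<beta> q) (C q)" using insert by simp
  show ?case using bilinear_bound_lincomb[OF q IH(1), of "r q" 1] \<phi>_linear[OF q IH(1), of "r q" 1] IH(2) insert(1,2) by simp
qed

lemma \<phi>_entry:
  assumes "i \<noteq> 0" "j \<noteq> 0" shows "\<phi> (\<lambda>a b. entry a i j * entry b j i) = 0"
proof -
  let ?\<beta> = "\<lambda>i a b. entry a i j * entry b j i"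
  define t where "t = \<phi> (?\<beta> 1)"
  have bb: "bilinear_bound (?\<beta> l) 1" if "l \<noteq> 0" for l by (rule entry_product_bound) (use that assms in auto)
  have eq: "\<phi> (?\<beta> l) = t" if l: "l \<noteq> 0" for l
  proof -
    \<comment> \<open>Commuting this form with the matrix unit in position (1, l) gives the form for
      l on one side and the form for 1 on the other.\<close>
    let ?\<theta> = "\<lambda>a b. entry a 1 j * entry b j l"
    have \<theta>: "bilinear_bound ?\<theta> 1" by (rule entry_product_bound) (use l assms in auto)
    have c: "unit_matrix 1 l \<in> AO" by (rule unit_matrix_AO) simp
    have "\<phi> (\<lambda>a b. ?\<theta> (cmp (unit_matrix 1 l) a) b) = \<phi> (?\<beta> l)"
      by (rule \<phi>_cong[OF bb[OF l]]) (use l assms entry_unit_matrix(1)[of _ l j 1] in simp)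
    moreover have "\<phi> (\<lambda>a b. ?\<theta> a (cmp b (unit_matrix 1 l))) = \<phi> (?\<beta> 1)"
      by (rule \<phi>_cong[OF bb]) (use l assms entry_unit_matrix(2)[of _ l j 1] in simp_all)
    ultimately show ?thesis using \<phi>_commute[OF \<theta> c] by (simp add: t_def)
  qed
  have "real L * norm t \<le> K" for L
  proof -
    have fin: "finite {1..L}" by simp
    have S: "bilinear_bound (\<lambda>a b. \<Sum>l\<in>{1..L}. 1 * ?\<beta> l a b) (\<Sum>l\<in>{1..L}. norm (1::'k) * 1)"
        "\<phi> (\<lambda>a b. \<Sum>l\<in>{1..L}. 1 * ?\<beta> l a b) = (\<Sum>l\<in>{1..L}. 1 * \<phi> (?\<beta> l))"
      using \<phi>_sum[OF fin, of ?\<beta> "\<lambda>l. 1" "\<lambda>l. 1"] bb by simp_all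
    have "bilinear_bound (\<lambda>a b. \<Sum>l\<in>{1..L}. 1 * ?\<beta> l a b) 1"
    proof (rule bilinear_bound_improve[OF S(1)])
      fix a b assume ab: "a \<in> BL" "b \<in> BL"
      have e: "ev j \<in> carrier X" "nrm X (ev j) \<le> 1" using ev_carrier[OF assms(2)] by auto
      have c: "a (ev j) \<in> carrier X" "restr {1..L} (a (ev j)) \<in> carrier X"
        using XX.L_closed[OF ab(1) e(1)] restr_carrier by auto
      \<comment> \<open>The sum is entry (j, j) of bPa with P the projection onto the first L
        coordinates, which does not increase norms. So the sum of L forms has bound 1, while \<phi>
        takes it to L * t.\<close>
      have "(\<Sum>l\<in>{1..L}. 1 * ?\<beta> l a b) = b (restr {1..L} (a (ev j))) j"
        by (subst apply_finite_support[OF ab(2)]) (auto simp: entry_def mult.commute)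
      also have "norm \<dots> \<le> nrm X (b (restr {1..L} (a (ev j))))" by (rule norm_le_nrm[OF XX.L_closed[OF ab(2) c(2)]])
      also have "\<dots> \<le> bn b * nrm X (restr {1..L} (a (ev j)))" by (rule XX.opn_bound[OF ab(2) c(2)])
      also have "\<dots> \<le> bn b * nrm X (a (ev j))"
      proof (rule mult_left_mono[OF _ XX.opn_nonneg[OF ab(2)]], rule nrm_le[OF c(2)])
        fix n
        have "nu p {..n} (restr {1..L} (a (ev j))) \<le> nu p {..n} (a (ev j))"
          by (rule nu_mono[OF p]) (auto simp: restr_apply)
        also have "\<dots> \<le> nrm X (a (ev j))" by (rule nu_le_nrm[OF c(1)]) simp
        finally show "nu p {..n} (restr {1..L} (a (ev j))) \<le> nrm X (a (ev j))" .
      qed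
      also have "\<dots> \<le> bn b * (bn a * nrm X (ev j))" by (intro mult_left_mono XX.opn_bound ab e XX.opn_nonneg)
      also have "\<dots> \<le> bn b * (bn a * 1)" by (intro mult_left_mono e XX.opn_nonneg ab)
      finally show "norm (\<Sum>l\<in>{1..L}. 1 * ?\<beta> l a b) \<le> 1 * (bn a * bn b)" by (simp add: mult.commute)
    qed simp
    then have "norm (\<Sum>l\<in>{1..L}. 1 * \<phi> (?\<beta> l)) \<le> K" using \<phi>_bound S(2) by fastforce
    moreover have "(\<Sum>l\<in>{1..L}. 1 * \<phi> (?\<beta> l)) = of_nat L * t" using eq by simp
    ultimately show ?thesis by (simp add: norm_mult)
  qed
  then have "norm t = 0"
    by (metis norm_ge_zero real_archimedian_rdiv_eq_0 K)
  then show ?thesis using eq[OF assms(1)] by simp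
qed

lemma no_virtual_diagonal: False
proof -
  \<comment> \<open>This makes K * e less than 1, against the value 1 of \<phi> at \<Gamma>; adding
    1 allows for K = 0.\<close>
  define e where "e = 1 / (2 * (K + 1))"
  have e: "0 < e" using K by (simp add: e_def)
  obtain F w N where st: "small_trace TYPE('k) p e F w N" using small_trace_exists[OF p e] by blast
  have F: "finite F" "0 \<notin> F" "sum w F = 1" using st by (auto simp: small_trace_def)
  \<comment> \<open>M is at least 1, so that the tail avoids the coordinate 0.\<close>
  define M where "M = max N 1"
  let ?\<beta> = "\<lambda>i j a b. entry a i j * entry b j i"
  let ?l = "\<lambda>i a b. entry (cmp a b) i i"
  define \<gamma> where "\<gamma> = (\<lambda>i a b. 1 * ?l i a b + (- 1) * (\<Sum>j\<in>{1..<M}. 1 * ?\<beta> i j a b))"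
  define \<Gamma> where "\<Gamma> = (\<lambda>a b. \<Sum>i\<in>F. of_real (w i) * \<gamma> i a b)"
  have i0: "i \<noteq> 0" if "i \<in> F" for i using F that by metis
  have bs: "bilinear_bound (\<lambda>a b. \<Sum>j\<in>{1..<M}. 1 * ?\<beta> i j a b) (\<Sum>j\<in>{1..<M}. norm (1::'k) * 1) \<and>
     \<phi> (\<lambda>a b. \<Sum>j\<in>{1..<M}. 1 * ?\<beta> i j a b) = (\<Sum>j\<in>{1..<M}. 1 * \<phi> (?\<beta> i j))" if i: "i \<in> F" for i
    by (rule \<phi>_sum) (use i0[OF i] in \<open>auto intro: entry_product_bound\<close>)
  define C where "C = norm (1::'k) * 1 + norm (- 1 :: 'k) * (\<Sum>j\<in>{1..<M}. norm (1::'k) * 1)"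
  have g: "bilinear_bound (\<gamma> i) C" "\<phi> (\<gamma> i) = 1" if i: "i \<in> F" for i
  proof -
    have l: "bilinear_bound (?l i) 1" by (rule balanced_entry_bound[OF i0[OF i]])
    show "bilinear_bound (\<gamma> i) C" unfolding \<gamma>_def C_def by (rule bilinear_bound_lincomb[OF l conjunct1[OF bs[OF i]]])
    have "\<phi> (\<gamma> i) = 1 * \<phi> (?l i) + (- 1) * (\<Sum>j\<in>{1..<M}. 1 * \<phi> (?\<beta> i j))"
      unfolding \<gamma>_def \<phi>_linear[OF l conjunct1[OF bs[OF i]]] using bs[OF i] by simp
    also have "(\<Sum>j\<in>{1..<M}. 1 * \<phi> (?\<beta> i j)) = 0" by (rule sum.neutral) (use \<phi>_entry i0[OF i] in auto)
    also have "\<phi> (?l i) = entry idX i i" by (rule \<phi>_balanced)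
    also have "\<dots> = 1" using ev_carrier(1)[OF i0[OF i]] by (simp add: entry_def ev_def)
    finally show "\<phi> (\<gamma> i) = 1" by simp
  qed
  have G: "bilinear_bound \<Gamma> (\<Sum>i\<in>F. norm (of_real (w i) :: 'k) * C)" "\<phi> \<Gamma> = (\<Sum>i\<in>F. of_real (w i) * \<phi> (\<gamma> i))"
    using \<phi>_sum[OF F(1), of \<gamma> "\<lambda>i. C" "\<lambda>i. of_real (w i)"] g(1) unfolding \<Gamma>_def by blast+
  have "\<phi> \<Gamma> = of_real (sum w F)" using G(2) g(2) by simp
  then have one: "\<phi> \<Gamma> = 1" using F by simp
  have "bilinear_bound \<Gamma> e"
  proof (rule bilinear_bound_improve[OF G(1)])
    fix a b assume ab: "a \<in> BL" "b \<in> BL"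
    \<comment> \<open>\<open>small_trace\<close> bounds finite parts of the tail. They converge to
      \<gamma> i a b because the partial sums of b (ev i) converge in norm and a is
      continuous.\<close>
    have lim: "(\<lambda>n. \<Sum>j\<in>{M..n}. ?\<beta> i j a b) \<longlonglongrightarrow> \<gamma> i a b" if i: "i \<in> F" for i
    proof -
      define x where "x = b (ev i)"
      have ei: "ev i \<in> carrier X" by (rule ev_carrier(1)[OF i0[OF i]])
      have x: "x \<in> carrier X" unfolding x_def by (rule XX.L_closed[OF ab(2) ei])
      have x0: "x 0 = 0" using x by (simp add: carrier_iff)
      have pre: "a (restr {1..n} x) i = (\<Sum>j\<in>{1..n}. ?\<beta> i j a b)" for n
        by (subst apply_finite_support[OF ab(1)]) (auto simp: x_def entry_def)
      have diff: "norm (a x i - a (restr {1..n} x) i) \<le> bn a * nrm X (restr {n<..} x)" for n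
      proof -
        have "x = restr {1..n} x \<oplus> restr {n<..} x" using x0 by (auto simp: X_simps restr_def not_less_eq_eq fun_eq_iff)
        then have "a x = a (restr {1..n} x) \<oplus> a (restr {n<..} x)" using XX.L_add[OF ab(1) restr_carrier[OF x] restr_carrier[OF x]] by metis
        then have "a x i - a (restr {1..n} x) i = a (restr {n<..} x) i" by (simp add: X_simps)
        then have "norm (a x i - a (restr {1..n} x) i) \<le> nrm X (a (restr {n<..} x))"
          using norm_le_nrm[OF XX.L_closed[OF ab(1) restr_carrier[OF x]]] by simp
        also have "\<dots> \<le> bn a * nrm X (restr {n<..} x)" by (rule XX.opn_bound[OF ab(1) restr_carrier[OF x]])
        finally show ?thesis .
      qed
      have "(\<lambda>n. bn a * nrm X (restr {n<..} x)) \<longlonglongrightarrow> bn a * 0" by (intro tendsto_mult_left tail_tendsto x)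
      then have "(\<lambda>n. a x i - a (restr {1..n} x) i) \<longlonglongrightarrow> 0"
        by (intro Lim_null_comparison[OF always_eventually[OF allI[OF diff]]]) simp
      then have "(\<lambda>n. a x i - (a x i - a (restr {1..n} x) i)) \<longlonglongrightarrow> a x i - 0" by (intro tendsto_diff tendsto_const)
      then have "(\<lambda>n. a (restr {1..n} x) i) \<longlonglongrightarrow> a x i" by simp
      then have "(\<lambda>n. \<Sum>j\<in>{1..n}. ?\<beta> i j a b) \<longlonglongrightarrow> a x i" unfolding pre .
      then have c1: "(\<lambda>n. (\<Sum>j\<in>{1..n}. ?\<beta> i j a b) - (\<Sum>j\<in>{1..<M}. ?\<beta> i j a b)) \<longlonglongrightarrow> a x i - (\<Sum>j\<in>{1..<M}. ?\<beta> i j a b)"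
        by (intro tendsto_diff tendsto_const)
      have c2: "a x i - (\<Sum>j\<in>{1..<M}. ?\<beta> i j a b) = \<gamma> i a b"
        using ei by (simp add: \<gamma>_def x_def entry_def compose_def)
      have c3: "(\<Sum>j\<in>{1..n}. ?\<beta> i j a b) - (\<Sum>j\<in>{1..<M}. ?\<beta> i j a b) = (\<Sum>j\<in>{M..n}. ?\<beta> i j a b)" if "M \<le> n" for n
      proof -
        have "{1..n} = {1..<M} \<union> {M..n}" using that by (auto simp: M_def)
        then have "(\<Sum>j\<in>{1..n}. ?\<beta> i j a b) = (\<Sum>j\<in>{1..<M}. ?\<beta> i j a b) + (\<Sum>j\<in>{M..n}. ?\<beta> i j a b)"
          by (simp only:) (rule sum.union_disjoint, auto)
        then show ?thesis by simp
      qed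
      show ?thesis
        by (rule Lim_transform_eventually[OF c1[unfolded c2]]) (use c3 in \<open>auto simp: eventually_sequentially\<close>)
    qed
    have "(\<lambda>n. \<Sum>i\<in>F. of_real (w i) * (\<Sum>j\<in>{M..n}. ?\<beta> i j a b)) \<longlonglongrightarrow> \<Gamma> a b"
      unfolding \<Gamma>_def by (intro tendsto_sum tendsto_mult_left lim)
    then have "(\<lambda>n. norm (\<Sum>i\<in>F. of_real (w i) * (\<Sum>j\<in>{M..n}. ?\<beta> i j a b))) \<longlonglongrightarrow> norm (\<Gamma> a b)" by (rule tendsto_norm)
    moreover have "norm (\<Sum>i\<in>F. of_real (w i) * (\<Sum>j\<in>{M..n}. ?\<beta> i j a b)) \<le> e * (bn a * bn b)" for n
    proof -
      have J: "finite {M..n}" "{M..n} \<subseteq> {N..}" "0 \<notin> {M..n}" by (auto simp: M_def)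
      have "matrix_bound p {M..n} F (bn a) (entry a)" "matrix_bound p F {M..n} (bn b) (entry b)"
        using matrix_bound_entry ab J F by auto
      then show ?thesis using st J XX.opn_nonneg ab unfolding small_trace_def by (auto simp: mult.assoc)
    qed
    ultimately show "norm (\<Gamma> a b) \<le> e * (bn a * bn b)" by (intro LIMSEQ_le_const2) auto
  qed (use e in simp)
  then have "norm (\<phi> \<Gamma>) \<le> K * e" by (rule \<phi>_bound)
  then have "1 \<le> K * e" using one by simp
  then show False using K by (simp add: e_def field_simps)
qed

end

end

text \<open>The second and third operator are interleaved into a single one, to fit the type over which \<^const>\<open>amenable\<close>
  quantifies.\<close>
definition encode_triple ::
  "(((nat \<Rightarrow> 'k) \<Rightarrow> nat \<Rightarrow> 'k) \<times> ((nat \<Rightarrow> 'k) \<Rightarrow> nat \<Rightarrow> 'k) \<times> ((nat \<Rightarrow> 'k) \<Rightarrow> nat \<Rightarrow> 'k) \<Rightarrow> 'k)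
    \<Rightarrow> (((nat \<Rightarrow> 'k) \<Rightarrow> nat \<Rightarrow> 'k) \<Rightarrow> ((nat \<Rightarrow> 'k) \<Rightarrow> nat \<Rightarrow> 'k) \<Rightarrow> 'k) set" where
  "encode_triple g = {\<lambda>a e. g (a, \<lambda>x n. e x (2 * n), \<lambda>x n. e x (2 * n + 1))}"

definition decode_triple ::
  "(((nat \<Rightarrow> 'k) \<Rightarrow> nat \<Rightarrow> 'k) \<Rightarrow> ((nat \<Rightarrow> 'k) \<Rightarrow> nat \<Rightarrow> 'k) \<Rightarrow> 'k) set
    \<Rightarrow> ((nat \<Rightarrow> 'k) \<Rightarrow> nat \<Rightarrow> 'k) \<times> ((nat \<Rightarrow> 'k) \<Rightarrow> nat \<Rightarrow> 'k) \<times> ((nat \<Rightarrow> 'k) \<Rightarrow> nat \<Rightarrow> 'k) \<Rightarrow> 'k" where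
  "decode_triple G = (\<lambda>(a, c, b). the_elem G a (\<lambda>x n. if even n then c x (n div 2) else b x (n div 2)))"

lemma decode_encode_triple: "decode_triple (encode_triple g) = g"
  by (auto simp: decode_triple_def encode_triple_def fun_eq_iff)

lemma not_amenable_Tp:
  assumes p: "1 \<le> p"
  shows "\<not> amenable (approximable_operators (Tp p :: ('k::{real_normed_field, banach, real_inner}, nat \<Rightarrow> 'k) normed_space))"
proof
  let ?X = "Tp p :: ('k, nat \<Rightarrow> 'k) normed_space"
  assume am: "amenable (approximable_operators ?X)"
  interpret T: tsirelson_space p ?X by unfold_locales (use p in auto)
  interpret C: coded_nspace ?X encode_triple decode_triple
    by unfold_locales (rule decode_encode_triple)
  have "inner_derivation (approximable_operators ?X) (dual_bimodule C.cocycle_module) C.derivation"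
    using am C.cocycle_bimodule C.derivation_continuous unfolding amenable_def by blast
  from C.virtual_diagonal[OF this] show False using T.no_virtual_diagonal by blast
qed

theorem corollary5p8:
  fixes p :: real
  assumes "1 \<le> p"
  shows "\<not> amenable (approximable_operators (Tp p :: (real, nat \<Rightarrow> real) normed_space)) \<and>
    \<not> amenable (approximable_operators (Tp p :: (complex, nat \<Rightarrow> complex) normed_space))"
  by (intro conjI not_amenable_Tp assms)

end
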